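(* A graph property $\mathcal{P}$ is testable in the VDF (Vertex-Distribution-Free) model if and only if $\mathcal{P}$ is hereditary and extendable.
   Context: All graphs are finite, simple, undirected, with nonempty vertex set. A graph property is a family of graphs closed under isomorphism. $\mathcal{P}$ is hereditary if it is closed under removal of vertices. $\mathcal{P}$ is extendable if for every graph $G$ satisfying $\mathcal{P}$ there is a graph on $|V(G)|+1$ vertices which satisfies $\mathcal{P}$ and contains $G$ as an induced subgraph. A vertex-weighted graph is a pair $(G,\mathcal{D})$ with $G$ a graph and $\mathcal{D}$ a probability distribution on $V(G)$ (weight $0$ is allowed). For graphs $G_1,G_2$ on the same vertex set $V$ and a distribution $\mathcal{D}$ on $V$, their distance with respect to $\mathcal{D}$ is $\sum_{\{x,y\}\in E(G_1)\triangle E(G_2)}\mathcal{D}(x)\mathcal{D}(y)$. $(G,\mathcal{D})$ is $\varepsilon$-far from $\mathcal{P}$ if for every $G'\in\mathcal{P}$ with $V(G')=V(G)$ the distance between $G$ and $G'$ with respect to $\mathcal{D}$ is at least $\varepsilon$ (vacuously true if no such $G'$ exists). VDF model. The input is $(G,\mathcal{D})$, with $\mathcal{D}$ arbitrary and unknown to the algorithm, and a parameter $\varepsilon\in(0,1)$. A (randomized, possibly adaptive) algorithm can access the input only by drawing independent random vertices distributed according to $\mathcal{D}$ (it can tell whether two samples are the same vertex, but vertex names carry no other information) and by making edge queries "is $\{u,v\}$ an edge of $G$?" for sampled vertices $u,v$. It is not given $|V(G)|$. Only the number of samples and queries is counted; there is no restriction on computation. A tester for $\mathcal{P}$ is such an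 algorithm which, for every $\varepsilon\in(0,1)$ and every $(G,\mathcal{D})$, accepts with probability at least $2/3$ if $G\in\mathcal{P}$ and rejects with probability at least $2/3$ if $(G,\mathcal{D})$ is $\varepsilon$-far from $\mathcal{P}$. $\mathcal{P}$ is testable in the VDF model if there are a function $q:(0,1)\to\mathbb{N}$ and a tester for $\mathcal{P}$ that always makes a total of at most $q(\varepsilon)$ vertex samples and edge queries, for every input $(G,\mathcal{D})$ and every $\varepsilon$. *)

theory Defs
  imports "HOL-Probability.Probability_Mass_Function"
begin

text \<open>
  Every finite graph is isomorphic to one with vertices in \<^typ>\<open>nat\<close>, and graph properties are
  closed under isomorphism, so taking vertices from \<^typ>\<open>nat\<close> loses no generality.
\<close>

record graph =
  verts :: "nat set"
  edges :: "nat set set"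

definition simple_graph :: "graph \<Rightarrow> bool" where
  "simple_graph G \<longleftrightarrow>
     finite (verts G) \<and> verts G \<noteq> {} \<and> (\<forall>e\<in>edges G. e \<subseteq> verts G \<and> card e = 2)"

definition isomorphic :: "graph \<Rightarrow> graph \<Rightarrow> bool" where
  "isomorphic G H \<longleftrightarrow>
     (\<exists>f. bij_betw f (verts G) (verts H) \<and>
          (\<forall>x\<in>verts G. \<forall>y\<in>verts G. {x, y} \<in> edges G \<longleftrightarrow> {f x, f y} \<in> edges H))"

definition graph_property :: "graph set \<Rightarrow> bool" where
  "graph_property P \<longleftrightarrow>
     (\<forall>G\<in>P. simple_graph G) \<and>
     (\<forall>G\<in>P. \<forall>H. simple_graph H \<and> isomorphic G H \<longrightarrow> H \<in> P)"

definition induced_subgraph :: "graph \<Rightarrow> nat set \<Rightarrow> graph" where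
  "induced_subgraph G U = \<lparr>verts = U, edges = {e \<in> edges G. e \<subseteq> U}\<rparr>"

text \<open>
  The removed set is a proper subset of the vertices because graphs are nonempty.
\<close>

definition hereditary :: "graph set \<Rightarrow> bool" where
  "hereditary P \<longleftrightarrow> (\<forall>G\<in>P. \<forall>S. S \<subset> verts G \<longrightarrow> induced_subgraph G (verts G - S) \<in> P)"

definition extendable :: "graph set \<Rightarrow> bool" where
  "extendable P \<longleftrightarrow>
     (\<forall>G\<in>P. \<exists>H\<in>P. card (verts H) = card (verts G) + 1 \<and>
        (\<exists>U\<subseteq>verts H. isomorphic G (induced_subgraph H U)))"

definition weighted_graph :: "graph \<Rightarrow> nat pmf \<Rightarrow> bool" where
  "weighted_graph G D \<longleftrightarrow> simple_graph G \<and> set_pmf D \<subseteq> verts G"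

text \<open>
  An edge \<open>e = {x, y}\<close> has exactly two elements, so the product below is \<open>D(x) D(y)\<close>.
\<close>

definition graph_distance :: "nat pmf \<Rightarrow> graph \<Rightarrow> graph \<Rightarrow> real" where
  "graph_distance D G H =
     (\<Sum>e \<in> (edges G - edges H) \<union> (edges H - edges G). \<Prod>x\<in>e. pmf D x)"

definition far :: "real \<Rightarrow> graph \<Rightarrow> nat pmf \<Rightarrow> graph set \<Rightarrow> bool" where
  "far \<epsilon> G D P \<longleftrightarrow> (\<forall>H\<in>P. verts H = verts G \<longrightarrow> \<epsilon> \<le> graph_distance D G H)"

text \<open>
  Randomized adaptive algorithms as interaction trees. \<open>Sample\<close> draws a fresh vertex,
  \<open>Query i j\<close> asks for the edge between the \<open>i\<close>-th and the \<open>j\<close>-th sample (counted from 0),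
  and \<open>Random\<close> is an internal random choice, which is free of charge. The branching functions
  are arbitrary: there is no restriction on computation.
\<close>

datatype algorithm =
    Output bool
  | Sample "nat \<Rightarrow> algorithm"
  | Query nat nat "bool \<Rightarrow> algorithm"
  | Random "nat pmf" "nat \<Rightarrow> algorithm"

text \<open>
  The algorithm never sees a vertex name. After drawing \<open>x\<close> it is told the position of the first
  sample equal to \<open>x\<close>, which is the position of the new sample itself if \<open>x\<close> did not occur
  before; this conveys exactly which samples coincide.
\<close>

definition first_position :: "nat list \<Rightarrow> nat \<Rightarrow> nat" where
  "first_position xs x = length (takeWhile (\<lambda>y. y \<noteq> x) xs)"

text \<open>
  \<open>run A G D xs n\<close> is the joint distribution of the verdict (\<^term>\<open>True\<close> for acceptance) and the
  total number of samples and queries, when the samples \<open>xs\<close> have been drawn and \<open>n\<close> operations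
  have been made so far. A query that refers to a sample not yet drawn is answered
  \<^term>\<open>False\<close>, which gives no information about the input.
\<close>

primrec run :: "algorithm \<Rightarrow> graph \<Rightarrow> nat pmf \<Rightarrow> nat list \<Rightarrow> nat \<Rightarrow> (bool \<times> nat) pmf" where
  "run (Output b) G D xs n = return_pmf (b, n)"
| "run (Sample k) G D xs n =
     bind_pmf D (\<lambda>x. run (k (first_position xs x)) G D (xs @ [x]) (Suc n))"
| "run (Query i j k) G D xs n =
     run (k (i < length xs \<and> j < length xs \<and> {xs ! i, xs ! j} \<in> edges G)) G D xs (Suc n)"
| "run (Random p k) G D xs n = bind_pmf p (\<lambda>r. run (k r) G D xs n)"

definition execution :: "algorithm \<Rightarrow> graph \<Rightarrow> nat pmf \<Rightarrow> (bool \<times> nat) pmf" where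
  "execution A G D = run A G D [] 0"

definition accept_prob :: "algorithm \<Rightarrow> graph \<Rightarrow> nat pmf \<Rightarrow> real" where
  "accept_prob A G D = measure_pmf.prob (execution A G D) {r. fst r}"

definition reject_prob :: "algorithm \<Rightarrow> graph \<Rightarrow> nat pmf \<Rightarrow> real" where
  "reject_prob A G D = measure_pmf.prob (execution A G D) {r. \<not> fst r}"

definition tester :: "graph set \<Rightarrow> (real \<Rightarrow> algorithm) \<Rightarrow> bool" where
  "tester P T \<longleftrightarrow>
     (\<forall>\<epsilon>\<in>{0<..<1}. \<forall>G D. weighted_graph G D \<longrightarrow>
        (G \<in> P \<longrightarrow> 2 / 3 \<le> accept_prob (T \<epsilon>) G D) \<and>
        (far \<epsilon> G D P \<longrightarrow> 2 / 3 \<le> reject_prob (T \<epsilon>) G D))"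

definition vdf_testable :: "graph set \<Rightarrow> bool" where
  "vdf_testable P \<longleftrightarrow>
     (\<exists>(q :: real \<Rightarrow> nat) T. tester P T \<and>
        (\<forall>\<epsilon>\<in>{0<..<1}. \<forall>G D. weighted_graph G D \<longrightarrow>
           (\<forall>r\<in>set_pmf (execution (T \<epsilon>) G D). snd r \<le> q \<epsilon>)))"

end

theory Submission
  imports Defs
begin

text \<open>
  If \<open>P\<close> is testable, a tester cannot see the part of \<open>G\<close> outside the support \<open>U\<close> of \<open>D\<close>. Taking
  \<open>D\<close> uniform on \<open>U\<close> and \<open>\<epsilon> < 1 / |U|\<^sup>2\<close>, a graph on a different vertex set that agrees on \<open>U\<close> with
  a member of \<open>P\<close> is not \<open>\<epsilon>\<close>-far, so it can be changed outside \<open>U\<close> into a member of \<open>P\<close>. Deleting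
  vertices gives heredity, adding an isolated vertex of weight \<open>0\<close> gives extendability.

  Conversely, the tester samples vertices and accepts iff they induce a member of \<open>P\<close>. If samples
  of bounded size almost always induce members of \<open>P\<close>, then \<open>G\<close> is close to \<open>P\<close>, as follows.
  By pigeonhole there are \<open>\<eta>' \<ll> \<eta>\<close> such that few vertices, by weight, have weight in
  \<open>(\<eta>', \<eta>]\<close>; these are discarded. Start from a partition in which vertices heavier than \<open>\<eta>\<close> are
  singletons and all other classes have small weight. Iterating weak (cut norm) regularity with
  energy increments gives partitions \<open>q\<close>, \<open>p\<close>, \<open>r\<close>, each refining the previous one, with \<open>r\<close> cut
  regular far beyond the size of \<open>p\<close>. A random \<open>p\<close>-class \<open>b i\<close> inside each class \<open>i\<close> of \<open>q\<close>
  then yields pairwise regular sets whose densities reflect those of \<open>q\<close>. Clean \<open>G\<close>: make each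
  class of light vertices a clique or an independent set, whichever (by Ramsey) occurs with
  positive density in \<open>b i\<close>, and empty or fill the pairs of classes whose density is close to
  \<open>0\<close> or \<open>1\<close>. If the cleaned graph were not in \<open>P\<close>, some forbidden graph of bounded size would
  have the same reduced structure and so would occur with positive density in \<open>G\<close> by the counting
  lemma. Hence the cleaned graph is in \<open>P\<close>, and extendability restores the discarded vertices.
\<close>

subsection \<open>Weak regularity and energy increments\<close>

text \<open>A heavy vertex drawn twice is still one vertex, so a forbidden graph can use it only
  once: it cannot be part of a larger class and must stay a singleton. There are fewer than
  \<open>1 / \<eta>\<close> such vertices, up to equality. All other vertices must be light compared
  with \<open>sum w (b i)\<close>, otherwise the Ramsey argument fails; the lower bound for
  \<open>sum w (b i)\<close> depends on the number of classes, hence on \<open>\<eta>\<close>.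
  Vertices between the two scales fit neither role. This forces the gap, with \<open>\<eta>'\<close>
  chosen after \<open>\<eta>\<close>; it also makes the total weight of \<open>V\<close> only at
  most \<open>1\<close>. The other obstacle is circular: the size of the forbidden graph to be found
  depends on the number \<open>m\<close> of classes of \<open>q\<close>, and so do the required
  regularity and class weights. Hence the tolerances are functions of \<open>m\<close>, and two
  energy arguments are nested. A small energy gap from \<open>q\<close> to \<open>p\<close> makes
  the densities of representatives typical; one from \<open>p\<close> to \<open>r\<close> makes the
  averages of \<open>r\<close> close to those of \<open>p\<close> on the chosen blocks. So the
  \<open>b i\<close> inherit regularity from \<open>r\<close>, although their weights are bounded in
  terms of \<open>p\<close> alone.\<close>

locale weighted_relation =
  fixes V :: "'a set" and w :: "'a \<Rightarrow> real" and A :: "'a \<Rightarrow> 'a \<Rightarrow> real"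
  assumes finite_V [simp]: "finite V"
    and w_nonneg: "x \<in> V \<Longrightarrow> 0 \<le> w x"
    and w_total: "sum w V \<le> 1"
    and A_range: "A x y \<in> {0, 1}"
    and A_sym: "A x y = A y x"
begin

definition cls :: "('a \<Rightarrow> nat) \<Rightarrow> nat \<Rightarrow> 'a set" where
  "cls p i = {x \<in> V. p x = i}"

definition wsum :: "('a \<Rightarrow> 'a \<Rightarrow> real) \<Rightarrow> 'a set \<Rightarrow> 'a set \<Rightarrow> real" where
  "wsum f S T = (\<Sum>x\<in>S. \<Sum>y\<in>T. w x * w y * f x y)"

definition average :: "('a \<Rightarrow> 'a \<Rightarrow> real) \<Rightarrow> 'a set \<Rightarrow> 'a set \<Rightarrow> real" where
  "average f S T = wsum f S T / (sum w S * sum w T)"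

text \<open>The conditional expectation of \<open>f\<close> on the product partition. On blocks of
  weight \<open>0\<close> it is \<open>0\<close>, by the convention for division by zero.\<close>

definition step :: "('a \<Rightarrow> 'a \<Rightarrow> real) \<Rightarrow> ('a \<Rightarrow> nat) \<Rightarrow> 'a \<Rightarrow> 'a \<Rightarrow> real" where
  "step f p x y = average f (cls p (p x)) (cls p (p y))"

text \<open>The squared L2 norm of the conditional expectation of \<open>A\<close>, known as the
  index or mean square density in regularity lemmas.\<close>

definition energy :: "('a \<Rightarrow> nat) \<Rightarrow> real" where
  "energy p = wsum (\<lambda>x y. (step A p x y)\<^sup>2) V V"

definition refines :: "('a \<Rightarrow> nat) \<Rightarrow> ('a \<Rightarrow> nat) \<Rightarrow> bool" where
  "refines q p \<longleftrightarrow> (\<forall>x\<in>V. \<forall>y\<in>V. q x = q y \<longrightarrow> p x = p y)"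

text \<open>Weak regularity in the sense of Frieze and Kannan. The bound is absolute, so it controls
  a single pair of classes only if \<open>\<gamma>\<close> is small compared with the product of
  their weights.\<close>

definition cut_regular :: "('a \<Rightarrow> nat) \<Rightarrow> real \<Rightarrow> bool" where
  "cut_regular p \<gamma> \<longleftrightarrow>
     (\<forall>S T. S \<subseteq> V \<longrightarrow> T \<subseteq> V \<longrightarrow> \<bar>wsum (\<lambda>x y. A x y - step A p x y) S T\<bar> \<le> \<gamma>)"

lemma cls_subset: "cls p i \<subseteq> V" and finite_cls [simp]: "finite (cls p i)"
  by (auto simp: cls_def)

lemma sum_w_nonneg: "S \<subseteq> V \<Longrightarrow> 0 \<le> sum w S"
  by (meson subsetD sum_nonneg w_nonneg)

lemma sum_w_mono: "S \<subseteq> T \<Longrightarrow> T \<subseteq> V \<Longrightarrow> sum w S \<le> sum w T"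
  by (meson finite_V finite_subset subset_iff sum_mono2 w_nonneg Diff_subset)

lemma sum_w_le_1: "S \<subseteq> V \<Longrightarrow> sum w S \<le> 1"
  using sum_w_mono[of S V] w_total by auto

lemma wsum_cong:
  "S = S' \<Longrightarrow> T = T' \<Longrightarrow> (\<And>x y. x \<in> S' \<Longrightarrow> y \<in> T' \<Longrightarrow> f x y = g x y) \<Longrightarrow> wsum f S T = wsum g S' T'"
  unfolding wsum_def by (auto intro!: sum.cong)

lemma wsum_mono:
  assumes "S \<subseteq> V" "T \<subseteq> V" "\<And>x y. x \<in> S \<Longrightarrow> y \<in> T \<Longrightarrow> f x y \<le> g x y"
  shows "wsum f S T \<le> wsum g S T"
  unfolding wsum_def using assms
  by (intro sum_mono mult_left_mono mult_nonneg_nonneg) (auto intro: w_nonneg)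

lemma wsum_nonneg:
  assumes "S \<subseteq> V" "T \<subseteq> V" "\<And>x y. x \<in> S \<Longrightarrow> y \<in> T \<Longrightarrow> 0 \<le> f x y"
  shows "0 \<le> wsum f S T"
  unfolding wsum_def using assms
  by (intro sum_nonneg mult_nonneg_nonneg) (auto intro: w_nonneg)

lemma wsum_add: "wsum (\<lambda>x y. f x y + g x y) S T = wsum f S T + wsum g S T"
  by (simp add: wsum_def sum.distrib distrib_left)

lemma wsum_diff: "wsum (\<lambda>x y. f x y - g x y) S T = wsum f S T - wsum g S T"
  by (simp add: wsum_def sum_subtractf right_diff_distrib)

lemma wsum_cmult: "wsum (\<lambda>x y. c * f x y) S T = c * wsum f S T"
  by (simp add: wsum_def sum_distrib_left mult_ac)

lemma wsum_const: "wsum (\<lambda>x y. c) S T = c * (sum w S * sum w T)"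
  unfolding wsum_def sum_product by (simp add: sum_distrib_left mult_ac)

lemma wsum_abs: "S \<subseteq> V \<Longrightarrow> T \<subseteq> V \<Longrightarrow> \<bar>wsum f S T\<bar> \<le> wsum (\<lambda>x y. \<bar>f x y\<bar>) S T"
  unfolding wsum_def
  by (rule order_trans[OF sum_abs], rule sum_mono, rule order_trans[OF sum_abs], rule sum_mono)
     (auto simp: abs_mult subset_iff w_nonneg)

lemma wsum_mono_set:
  assumes "S \<subseteq> S'" "T \<subseteq> T'" "S' \<subseteq> V" "T' \<subseteq> V" "\<And>x y. 0 \<le> f x y"
  shows "wsum f S T \<le> wsum f S' T'"
proof -
  have fin: "finite S'" "finite T'" using assms finite_subset[OF _ finite_V] by auto
  have w: "0 \<le> w x" if "x \<in> S' \<or> x \<in> T'" for x using assms that by (auto intro: w_nonneg)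
  have "wsum f S T \<le> (\<Sum>x\<in>S. \<Sum>y\<in>T'. w x * w y * f x y)"
    unfolding wsum_def using assms fin
    by (intro sum_mono sum_mono2) (auto intro!: mult_nonneg_nonneg w)
  also have "\<dots> \<le> wsum f S' T'"
    unfolding wsum_def using assms fin
    by (intro sum_mono2 sum_nonneg) (auto intro!: mult_nonneg_nonneg w)
  finally show ?thesis .
qed

lemma wsum_zero: "S \<subseteq> V \<Longrightarrow> T \<subseteq> V \<Longrightarrow> sum w S * sum w T = 0 \<Longrightarrow> wsum f S T = 0"
proof -
  assume *: "S \<subseteq> V" "T \<subseteq> V" "sum w S * sum w T = 0"
  have "(\<forall>x\<in>S. w x = 0) \<or> (\<forall>x\<in>T. w x = 0)"
    using * finite_subset[OF _ finite_V] sum_nonneg_eq_0_iff[of S w] sum_nonneg_eq_0_iff[of T w]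
    by (auto simp: subset_iff w_nonneg)
  then show ?thesis by (auto simp: wsum_def)
qed

text \<open>Positivity is not assumed: if one set has weight \<open>0\<close>, then both sides
  vanish.\<close>

lemma average_mult: "S \<subseteq> V \<Longrightarrow> T \<subseteq> V \<Longrightarrow> average f S T * (sum w S * sum w T) = wsum f S T"
  using wsum_zero[of S T f] by (cases "sum w S * sum w T = 0") (auto simp: average_def)

lemma average_nonneg:
  assumes "S \<subseteq> V" "T \<subseteq> V" "\<And>x y. x \<in> S \<Longrightarrow> y \<in> T \<Longrightarrow> 0 \<le> f x y"
  shows "0 \<le> average f S T"
  using assms by (auto simp: average_def intro!: divide_nonneg_nonneg wsum_nonneg mult_nonneg_nonneg sum_w_nonneg)

lemma average_A_le_1: "S \<subseteq> V \<Longrightarrow> T \<subseteq> V \<Longrightarrow> average A S T \<le> 1"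
proof -
  assume *: "S \<subseteq> V" "T \<subseteq> V"
  have "wsum A S T \<le> wsum (\<lambda>_ _. 1) S T"
    using * by (intro wsum_mono) (use A_range in \<open>auto, smt (verit) insertE singletonD\<close>)
  then show ?thesis using * sum_w_nonneg[of S] sum_w_nonneg[of T]
    by (auto simp: average_def wsum_const divide_le_eq_1)
qed

lemma A_nonneg: "0 \<le> A x y" using A_range[of x y] by auto

lemma wsum_A_sym: "wsum A S T = wsum A T S"
  unfolding wsum_def by (subst sum.swap) (simp add: A_sym mult_ac)

lemma average_A_sym: "average A S T = average A T S"
  by (simp add: average_def wsum_A_sym[of S T] mult.commute)

lemma wsum_classes: "wsum f V V = (\<Sum>i\<in>p ` V. \<Sum>j\<in>p ` V. wsum f (cls p i) (cls p j))"
proof -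
  have g: "(\<Sum>x\<in>V. h x) = (\<Sum>i\<in>p ` V. \<Sum>x\<in>cls p i. h x)" for h :: "'a \<Rightarrow> real"
    unfolding cls_def by (rule sum.image_gen) simp
  have "wsum f V V = (\<Sum>i\<in>p ` V. \<Sum>x\<in>cls p i. \<Sum>j\<in>p ` V. \<Sum>y\<in>cls p j. w x * w y * f x y)"
    unfolding wsum_def by (simp add: g)
  also have "\<dots> = (\<Sum>i\<in>p ` V. \<Sum>j\<in>p ` V. wsum f (cls p i) (cls p j))"
    unfolding wsum_def by (rule sum.cong[OF refl], rule sum.swap)
  finally show ?thesis .
qed

text \<open>\<open>step f p\<close> is the orthogonal projection of \<open>f\<close> onto the
  functions that are constant on the blocks of \<open>p\<close>, so it has the same inner product
  with such a \<open>g\<close> as \<open>f\<close> has.\<close>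

lemma wsum_step_mult:
  assumes "\<And>x y x' y'. x \<in> V \<Longrightarrow> y \<in> V \<Longrightarrow> x' \<in> V \<Longrightarrow> y' \<in> V \<Longrightarrow> p x = p x' \<Longrightarrow> p y = p y' \<Longrightarrow> g x y = g x' y'"
  shows "wsum (\<lambda>x y. step f p x y * g x y) V V = wsum (\<lambda>x y. f x y * g x y) V V"
  unfolding wsum_classes[of _ p]
proof (intro sum.cong refl)
  fix i j assume "i \<in> p ` V" "j \<in> p ` V"
  then obtain x0 y0 where x0: "x0 \<in> V" "y0 \<in> V" "i = p x0" "j = p y0" by auto
  have g: "g x y = g x0 y0" if "x \<in> cls p i" "y \<in> cls p j" for x y
    using that x0 by (intro assms) (auto simp: cls_def)
  have s: "step f p x y = average f (cls p i) (cls p j)" if "x \<in> cls p i" "y \<in> cls p j" for x y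
    using that by (auto simp: step_def cls_def)
  have "wsum (\<lambda>x y. step f p x y * g x y) (cls p i) (cls p j)
      = wsum (\<lambda>x y. average f (cls p i) (cls p j) * g x0 y0) (cls p i) (cls p j)"
    by (intro wsum_cong refl) (simp add: g s)
  also have "\<dots> = g x0 y0 * (average f (cls p i) (cls p j) * (sum w (cls p i) * sum w (cls p j)))"
    by (simp add: wsum_const)
  also have "\<dots> = g x0 y0 * wsum f (cls p i) (cls p j)"
    by (simp add: average_mult cls_subset)
  also have "\<dots> = wsum (\<lambda>x y. g x0 y0 * f x y) (cls p i) (cls p j)"
    by (simp add: wsum_cmult)
  also have "\<dots> = wsum (\<lambda>x y. f x y * g x y) (cls p i) (cls p j)"
    by (intro wsum_cong refl) (simp add: g)
  finally show "wsum (\<lambda>x y. step f p x y * g x y) (cls p i) (cls p j) =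
      wsum (\<lambda>x y. f x y * g x y) (cls p i) (cls p j)" .
qed

lemma step_cong: "p x = p x' \<Longrightarrow> p y = p y' \<Longrightarrow> step f p x y = step f p x' y'"
  by (simp add: step_def)

lemma refinesD: "refines q p \<Longrightarrow> x \<in> V \<Longrightarrow> y \<in> V \<Longrightarrow> q x = q y \<Longrightarrow> p x = p y"
  unfolding refines_def by blast

lemma refines_refl: "refines p p" by (simp add: refines_def)

lemma refines_trans: "refines r q \<Longrightarrow> refines q p \<Longrightarrow> refines r p"
  unfolding refines_def by blast

text \<open>Pythagoras: \<open>step A p\<close> is constant on the blocks of \<open>q\<close>, so
  projecting \<open>A\<close> first to \<open>q\<close> and then to \<open>p\<close> gives the inner
  products \<open><A_q, A_p> = <A, A_p> = <A_p, A_p>\<close>.\<close>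

lemma energy_diff:
  assumes "refines q p"
  shows "wsum (\<lambda>x y. (step A q x y - step A p x y)\<^sup>2) V V = energy q - energy p"
proof -
  have c: "step A p x y = step A p x' y'"
    if "x \<in> V" "y \<in> V" "x' \<in> V" "y' \<in> V" "q x = q x'" "q y = q y'" for x y x' y'
  proof (rule step_cong)
    show "p x = p x'" using refinesD[OF assms] that by blast
    show "p y = p y'" using refinesD[OF assms] that by blast
  qed
  have "wsum (\<lambda>x y. step A q x y * step A p x y) V V = wsum (\<lambda>x y. A x y * step A p x y) V V"
    by (rule wsum_step_mult[where g = "step A p" and f = A and p = q]) (use c in metis)
  also have "\<dots> = wsum (\<lambda>x y. step A p x y * step A p x y) V V"
    by (rule wsum_step_mult[where g = "step A p" and f = A and p = p, symmetric]) (metis step_cong)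
  finally have e: "wsum (\<lambda>x y. step A q x y * step A p x y) V V = energy p"
    by (simp add: energy_def power2_eq_square)
  have "wsum (\<lambda>x y. (step A q x y - step A p x y)\<^sup>2) V V
      = wsum (\<lambda>x y. (step A q x y)\<^sup>2 - 2 * (step A q x y * step A p x y) + (step A p x y)\<^sup>2) V V"
    by (intro wsum_cong refl) (simp add: power2_eq_square algebra_simps)
  also have "\<dots> = energy q - 2 * energy p + energy p"
    by (simp add: wsum_add wsum_diff wsum_cmult e) (simp add: energy_def)
  finally show ?thesis by simp
qed

lemma wsum_one_le: "wsum (\<lambda>_ _. 1) V V \<le> 1"
  using w_total sum_w_nonneg[of V] by (simp add: wsum_const mult_le_one)

lemma energy_le_1: "energy p \<le> 1"
proof -
  have "(step A p x y)\<^sup>2 \<le> 1" for x y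
    unfolding step_def
    by (intro power_le_one average_nonneg average_A_le_1 cls_subset A_nonneg)
  then have "energy p \<le> wsum (\<lambda>_ _. 1) V V"
    unfolding energy_def by (intro wsum_mono) auto
  with wsum_one_le show ?thesis by simp
qed

lemma energy_nonneg: "0 \<le> energy p"
  unfolding energy_def by (rule wsum_nonneg) auto

text \<open>Expands the second moment of \<open>\<bar>f\<bar>\<close> around its integral
  \<open>c\<close>. As the total mass is at most \<open>1\<close>, the term \<open>c\<^sup>2\<close>
  is counted at most once and \<open>- 2 * c * c\<close> wins.\<close>

lemma cauchy_schwarz: "(wsum (\<lambda>x y. \<bar>f x y\<bar>) V V)\<^sup>2 \<le> wsum (\<lambda>x y. (f x y)\<^sup>2) V V"
proof -
  define c where "c = wsum (\<lambda>x y. \<bar>f x y\<bar>) V V"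
  have "0 \<le> wsum (\<lambda>x y. (\<bar>f x y\<bar> - c)\<^sup>2) V V" by (rule wsum_nonneg) auto
  also have "\<dots> = wsum (\<lambda>x y. (f x y)\<^sup>2 - (2 * c) * \<bar>f x y\<bar> + c\<^sup>2 * 1) V V"
    by (intro wsum_cong refl) (simp add: power2_eq_square algebra_simps)
  also have "\<dots> = wsum (\<lambda>x y. (f x y)\<^sup>2) V V - 2 * c * c + c\<^sup>2 * wsum (\<lambda>_ _. 1) V V"
    by (simp only: wsum_add wsum_diff wsum_cmult c_def)
  also have "\<dots> \<le> wsum (\<lambda>x y. (f x y)\<^sup>2) V V - 2 * c * c + c\<^sup>2 * 1"
    using wsum_one_le by (intro add_left_mono mult_left_mono) auto
  finally show ?thesis by (simp add: c_def power2_eq_square)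
qed

lemma L1_le_sqrt_energy_diff:
  assumes "refines q p" "energy q - energy p \<le> d\<^sup>2" "0 \<le> d"
  shows "wsum (\<lambda>x y. \<bar>step A q x y - step A p x y\<bar>) V V \<le> d"
proof (rule power2_le_imp_le)
  show "(wsum (\<lambda>x y. \<bar>step A q x y - step A p x y\<bar>) V V)\<^sup>2 \<le> d\<^sup>2"
    using cauchy_schwarz[of "\<lambda>x y. step A q x y - step A p x y"] energy_diff[OF assms(1)] assms(2)
    by linarith
qed (rule assms)

text \<open>Splitting every class by the witnesses \<open>S\<close> and \<open>T\<close> makes the
  indicator of \<open>S \<times> T\<close> constant on blocks. Tested against it, \<open>A\<close>
  can then be replaced by \<open>step A q\<close>, so \<open>step A q\<close> and
  \<open>step A p\<close> differ by more than \<open>\<gamma>\<close> in L1, hence in L2.\<close>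

lemma energy_increment:
  assumes "\<not> cut_regular p \<gamma>" "0 < \<gamma>" "p ` V \<subseteq> {..<n}"
  obtains q where "refines q p" "q ` V \<subseteq> {..<4 * n}" "energy p + \<gamma>\<^sup>2 \<le> energy q"
proof -
  obtain S T where ST: "S \<subseteq> V" "T \<subseteq> V" "\<gamma> < \<bar>wsum (\<lambda>x y. A x y - step A p x y) S T\<bar>"
    using assms(1) by (auto simp: cut_regular_def not_le)
  \<comment> \<open>The last base 4 digit records membership in \<open>S\<close> and
    \<open>T\<close>; division by 4 recovers the old class.\<close>
  define q where "q x = 4 * p x + (2 * of_bool (x \<in> S) + of_bool (x \<in> T))" for x
  have q: "q x = q y \<Longrightarrow> p x = p y \<and> (x \<in> S \<longleftrightarrow> y \<in> S) \<and> (x \<in> T \<longleftrightarrow> y \<in> T)" for x y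
  proof -
    define b where "b z = 2 * of_bool (z \<in> S) + (of_bool (z \<in> T) :: nat)" for z
    have b: "b z < 4" for z by (simp add: b_def)
    have qz: "q z div 4 = p z" "q z mod 4 = b z" for z using b[of z] by (simp_all add: q_def b_def[symmetric])
    assume "q x = q y"
    then have "p x = p y" "b x = b y" using qz by metis+
    then show ?thesis by (auto simp: b_def of_bool_def split: if_splits)
  qed
  have ref: "refines q p" unfolding refines_def using q by blast
  define g :: "'a \<Rightarrow> 'a \<Rightarrow> real" where "g x y = of_bool (x \<in> S \<and> y \<in> T)" for x y
  have restr: "wsum f S T = wsum (\<lambda>x y. f x y * g x y) V V" for f
  proof -
    have inner: "(\<Sum>y\<in>T. w x * w y * f x y) = (\<Sum>y\<in>V. w x * w y * (f x y * g x y))" if "x \<in> S" for x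
    proof (rule sum.mono_neutral_cong_left)
      show "\<forall>y\<in>V - T. w x * w y * (f x y * g x y) = 0" by (simp add: g_def)
      show "w x * w y * f x y = w x * w y * (f x y * g x y)" if "y \<in> T" for y
        using that \<open>x \<in> S\<close> by (simp add: g_def)
    qed (rule finite_V, rule ST(2))
    show ?thesis
      unfolding wsum_def
    proof (rule sum.mono_neutral_cong_left)
      show "\<forall>x\<in>V - S. (\<Sum>y\<in>V. w x * w y * (f x y * g x y)) = 0" by (simp add: g_def)
    qed (rule finite_V, rule ST(1), rule inner)
  qed
  have "wsum (\<lambda>x y. A x y - step A p x y) S T = wsum (\<lambda>x y. (step A q x y - step A p x y) * g x y) V V"
  proof -
    have "wsum (\<lambda>x y. step A q x y * g x y) V V = wsum (\<lambda>x y. A x y * g x y) V V"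
    proof (rule wsum_step_mult)
      fix x y x' y' assume "q x = q x'" "q y = q y'"
      from q[OF this(1)] q[OF this(2)] show "g x y = g x' y'" by (simp add: g_def)
    qed
    then show ?thesis by (simp add: restr left_diff_distrib wsum_diff)
  qed
  also have "\<bar>\<dots>\<bar> \<le> wsum (\<lambda>x y. \<bar>(step A q x y - step A p x y) * g x y\<bar>) V V"
    by (rule wsum_abs) auto
  also have "\<dots> \<le> wsum (\<lambda>x y. \<bar>step A q x y - step A p x y\<bar>) V V"
    by (intro wsum_mono) (auto simp: g_def)
  finally have "\<gamma> < wsum (\<lambda>x y. \<bar>step A q x y - step A p x y\<bar>) V V" using ST(3) by linarith
  then have "\<gamma>\<^sup>2 \<le> (wsum (\<lambda>x y. \<bar>step A q x y - step A p x y\<bar>) V V)\<^sup>2"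
    using assms(2) by (intro power_mono) auto
  also have "\<dots> \<le> energy q - energy p"
    using cauchy_schwarz[of "\<lambda>x y. step A q x y - step A p x y"] energy_diff[OF ref] by linarith
  finally have e: "energy p + \<gamma>\<^sup>2 \<le> energy q" by simp
  have "q ` V \<subseteq> {..<4 * n}"
  proof
    fix i assume "i \<in> q ` V"
    then obtain x where "x \<in> V" "i = q x" by auto
    moreover have "p x < n" using \<open>x \<in> V\<close> assms(3) by auto
    ultimately show "i \<in> {..<4 * n}" by (auto simp: q_def)
  qed
  with ref e show ?thesis using that by blast
qed

text \<open>Each failure of regularity raises the energy by \<open>\<gamma>\<^sup>2\<close> and
  multiplies the colour bound by 4; the energy stays in \<open>[0, 1]\<close>.\<close>

lemma cut_regular_refinement:
  assumes "0 < \<gamma>" "p ` V \<subseteq> {..<n}"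
  shows "\<exists>q. refines q p \<and> q ` V \<subseteq> {..<4 ^ nat \<lceil>1 / \<gamma>\<^sup>2\<rceil> * n} \<and> cut_regular q \<gamma>"
proof -
  \<comment> \<open>Here \<open>k\<close> is a budget of remaining increments. With
    \<open>k = 0\<close> the energy is already \<open>1\<close>, so no further increment is
    possible.\<close>
  have "\<exists>q. refines q p \<and> q ` V \<subseteq> {..<4 ^ k * n} \<and> cut_regular q \<gamma>"
    if "1 - real k * \<gamma>\<^sup>2 \<le> energy p" "p ` V \<subseteq> {..<n}" for k n p
    using that
  proof (induction k arbitrary: n p)
    case 0
    have "cut_regular p \<gamma>"
    proof (rule ccontr)
      assume "\<not> cut_regular p \<gamma>"
      then obtain q where "energy p + \<gamma>\<^sup>2 \<le> energy q"
        by (rule energy_increment[OF _ assms(1) 0(2)])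
      moreover have "0 < \<gamma>\<^sup>2" using assms(1) by simp
      ultimately show False using 0(1) energy_le_1[of q] by simp
    qed
    with 0(2) refines_refl[of p] show ?case by (intro exI[of _ p]) simp
  next
    case (Suc k)
    show ?case
    proof (cases "cut_regular p \<gamma>")
      case True
      have "n \<le> 4 ^ Suc k * n" by simp
      then have "{..<n} \<subseteq> {..<4 ^ Suc k * n}" by (rule lessThan_subset_iff[THEN iffD2])
      then have "p ` V \<subseteq> {..<4 ^ Suc k * n}" using Suc.prems(2) by (rule order_trans[rotated])
      with True show ?thesis using refines_refl[of p] by blast
    next
      case False
      then obtain q where q: "refines q p" "q ` V \<subseteq> {..<4 * n}" "energy p + \<gamma>\<^sup>2 \<le> energy q"
        by (rule energy_increment[OF _ assms(1) Suc.prems(2)])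
      have "1 - real k * \<gamma>\<^sup>2 \<le> energy q" using q(3) Suc.prems(1) by (simp add: algebra_simps)
      from Suc.IH[OF this q(2)] obtain r where
        "refines r q" "r ` V \<subseteq> {..<4 ^ k * (4 * n)}" "cut_regular r \<gamma>" by blast
      with refines_trans[of r q p] q(1) show ?thesis
        by (intro exI[of _ r]) (simp add: mult.assoc mult.left_commute)
    qed
  qed
  moreover have "1 - real (nat \<lceil>1 / \<gamma>\<^sup>2\<rceil>) * \<gamma>\<^sup>2 \<le> energy p"
  proof -
    have "1 / \<gamma>\<^sup>2 \<le> real (nat \<lceil>1 / \<gamma>\<^sup>2\<rceil>)" by linarith
    then have "1 \<le> real (nat \<lceil>1 / \<gamma>\<^sup>2\<rceil>) * \<gamma>\<^sup>2" using assms(1) by (metis pos_divide_le_eq zero_less_power)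
    then show ?thesis using energy_nonneg[of p] by linarith
  qed
  ultimately show ?thesis using assms(2) by blast
qed

end

text \<open>Bounds the number of classes after at most \<open>k\<close> refinements, each taking \<open>n\<close> classes to \<open>g n\<close>.\<close>

primrec iter_bound :: "(nat \<Rightarrow> nat) \<Rightarrow> nat \<Rightarrow> nat \<Rightarrow> nat" where
  "iter_bound g 0 n = n"
| "iter_bound g (Suc k) n = max n (iter_bound g k (g n))"

text \<open>Apply the given refinement until one application gains at most \<open>\<delta>\<close>
  energy. The relation \<open>\<Phi>\<close> carries along what that last application guarantees,
  relative to the colour bound at that moment. It serves twice: with cut regularity, and with the
  result of that first use.\<close>

lemma (in weighted_relation) energy_pigeonhole:
  assumes refinement: "\<And>n p. p ` V \<subseteq> {..<n} \<Longrightarrow> \<exists>q. refines q p \<and> q ` V \<subseteq> {..<g n} \<and> \<Phi> n p q"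
    and "0 < \<delta>" "p ` V \<subseteq> {..<n}"
  shows "\<exists>m p' q. m \<le> iter_bound g (nat \<lceil>1 / \<delta>\<rceil>) n \<and> refines p' p \<and> p' ` V \<subseteq> {..<m} \<and>
     refines q p' \<and> \<Phi> m p' q \<and> energy q - energy p' \<le> \<delta>"
proof -
  have "\<exists>m p' q. m \<le> iter_bound g k n \<and> refines p' p \<and> p' ` V \<subseteq> {..<m} \<and>
     refines q p' \<and> \<Phi> m p' q \<and> energy q - energy p' \<le> \<delta>"
    if "1 - real k * \<delta> \<le> energy p" "p ` V \<subseteq> {..<n}" for k n p
    using that
  proof (induction k arbitrary: n p)
    case 0
    obtain q where q: "refines q p" "q ` V \<subseteq> {..<g n}" "\<Phi> n p q" using refinement 0 by blast
    have "energy q - energy p \<le> \<delta>" using energy_le_1[of q] 0(1) assms(2) by auto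
    with q 0(2) refines_refl[of p] show ?case
      by (intro exI[of _ n] exI[of _ p] exI[of _ q]) simp
  next
    case (Suc k)
    obtain q where q: "refines q p" "q ` V \<subseteq> {..<g n}" "\<Phi> n p q" using refinement Suc.prems by blast
    show ?case
    proof (cases "energy q - energy p \<le> \<delta>")
      case True
      with q Suc.prems(2) refines_refl[of p] show ?thesis
        by (intro exI[of _ n] exI[of _ p] exI[of _ q]) simp
    next
      case False
      then have "1 - real k * \<delta> \<le> energy q" using Suc.prems(1) by (simp add: algebra_simps)
      from Suc.IH[OF this q(2)] obtain m p' r where
        "m \<le> iter_bound g k (g n)" "refines p' q" "p' ` V \<subseteq> {..<m}"
        "refines r p'" "\<Phi> m p' r" "energy r - energy p' \<le> \<delta>" by blast
      with refines_trans[of p' q p] q(1) show ?thesis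
        by (intro exI[of _ m] exI[of _ p'] exI[of _ r]) simp
    qed
  qed
  moreover have "1 - real (nat \<lceil>1 / \<delta>\<rceil>) * \<delta> \<le> energy p"
  proof -
    have "1 / \<delta> \<le> real (nat \<lceil>1 / \<delta>\<rceil>)" by linarith
    then have "1 \<le> real (nat \<lceil>1 / \<delta>\<rceil>) * \<delta>" using assms(2) by (metis pos_divide_le_eq)
    then show ?thesis using energy_nonneg[of p] by linarith
  qed
  ultimately show ?thesis using assms(3) by blast
qed

subsection \<open>Strong regularity\<close>

lemma le_weighted_average:
  fixes u F :: "'a \<Rightarrow> real"
  assumes "finite C" "\<And>x. x \<in> C \<Longrightarrow> 0 \<le> u x" "sum u C = 1"
  shows "\<exists>x\<in>C. F x \<le> (\<Sum>y\<in>C. u y * F y)"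
proof (rule ccontr)
  let ?E = "\<Sum>y\<in>C. u y * F y"
  assume "\<not> ?thesis"
  then have *: "?E < F x" if "x \<in> C" for x using that by (meson not_le)
  obtain x where x: "x \<in> C" "0 < u x"
    by (metis assms(2,3) less_eq_real_def sum_nonpos zero_less_one not_less)
  have "(\<Sum>y\<in>C. u y * ?E) < (\<Sum>y\<in>C. u y * F y)"
  proof (rule sum_strict_mono_ex1)
    show "\<forall>y\<in>C. u y * ?E \<le> u y * F y"
      using * assms(2) by (meson less_imp_le mult_left_mono)
    show "\<exists>y\<in>C. u y * ?E < u y * F y"
      using x * by (meson mult_strict_left_mono)
  qed (rule assms)
  then show False using assms(3) by (simp flip: sum_distrib_right)
qed

lemma sum_pairs_insert:
  fixes h :: "'i \<Rightarrow> 'i \<Rightarrow> real"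
  assumes "finite I" "a \<notin> I"
  shows "(\<Sum>i\<in>insert a I. \<Sum>j\<in>insert a I - {i}. h i j) =
    (\<Sum>i\<in>I. h a i + h i a) + (\<Sum>i\<in>I. \<Sum>j\<in>I - {i}. h i j)"
proof -
  have "(\<Sum>j\<in>insert a I - {i}. h i j) = h i a + (\<Sum>j\<in>I - {i}. h i j)" if "i \<in> I" for i
  proof -
    have "insert a I - {i} = insert a (I - {i})" using that assms by auto
    then show ?thesis using assms by simp
  qed
  moreover have "insert a I - {a} = I" using assms by auto
  ultimately show ?thesis using assms by (simp add: sum.distrib)
qed

text \<open>
  The method of conditional expectations: the right-hand side is the expected value of the left-hand
  side when the \<open>z i\<close> are drawn independently from the distributions \<open>u i\<close>.
\<close>

lemma pairwise_selection:
  fixes u :: "'i \<Rightarrow> 'a \<Rightarrow> real"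
  assumes "finite I" "\<And>i. i \<in> I \<Longrightarrow> finite (C i)"
    and "\<And>i x. i \<in> I \<Longrightarrow> x \<in> C i \<Longrightarrow> 0 \<le> u i x" "\<And>i. i \<in> I \<Longrightarrow> sum (u i) (C i) = 1"
  shows "\<exists>z. (\<forall>i\<in>I. z i \<in> C i) \<and>
    (\<Sum>i\<in>I. f i (z i)) + (\<Sum>i\<in>I. \<Sum>j\<in>I - {i}. g i j (z i) (z j)) \<le>
    (\<Sum>i\<in>I. \<Sum>x\<in>C i. u i x * f i x) +
    (\<Sum>i\<in>I. \<Sum>j\<in>I - {i}. \<Sum>x\<in>C i. \<Sum>y\<in>C j. u i x * u j y * g i j x y)"
  using assms
proof (induction I arbitrary: f rule: finite_induct)
  case empty
  then show ?case by simp
next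
  case (insert a I)
  define E where "E i j = (\<Sum>x\<in>C i. \<Sum>y\<in>C j. u i x * u j y * g i j x y)" for i j
  \<comment> \<open>The cost of choosing \<open>x\<close> for \<open>i\<close>, with its expected
    interaction with the still random choice for \<open>a\<close> absorbed. This is why
    \<open>f\<close> is generalised in the induction.\<close>
  define f' where "f' i x = f i x + (\<Sum>y\<in>C a. u a y * (g a i y x + g i a x y))" for i x
  have "\<exists>z. (\<forall>i\<in>I. z i \<in> C i) \<and>
     (\<Sum>i\<in>I. f' i (z i)) + (\<Sum>i\<in>I. \<Sum>j\<in>I - {i}. g i j (z i) (z j)) \<le>
     (\<Sum>i\<in>I. \<Sum>x\<in>C i. u i x * f' i x) + (\<Sum>i\<in>I. \<Sum>j\<in>I - {i}. E i j)"
    unfolding E_def by (rule insert.IH) (use insert.prems in auto)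
  then obtain z where z: "\<And>i. i \<in> I \<Longrightarrow> z i \<in> C i"
    "(\<Sum>i\<in>I. f' i (z i)) + (\<Sum>i\<in>I. \<Sum>j\<in>I - {i}. g i j (z i) (z j)) \<le>
     (\<Sum>i\<in>I. \<Sum>x\<in>C i. u i x * f' i x) + (\<Sum>i\<in>I. \<Sum>j\<in>I - {i}. E i j)"
    by blast
  \<comment> \<open>The part of the cost that depends on the choice \<open>y\<close> for
    \<open>a\<close>, once all other choices are fixed to \<open>z\<close>.\<close>
  define F where "F y = f a y + (\<Sum>i\<in>I. g a i y (z i) + g i a (z i) y)" for y
  obtain y where y: "y \<in> C a" "F y \<le> (\<Sum>y\<in>C a. u a y * F y)"
    using le_weighted_average[of "C a" "u a" F] insert.prems by auto
  have EF: "(\<Sum>y\<in>C a. u a y * F y) + (\<Sum>i\<in>I. f i (z i)) =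
      (\<Sum>y\<in>C a. u a y * f a y) + (\<Sum>i\<in>I. f' i (z i))"
  proof -
    have "(\<Sum>y\<in>C a. u a y * (\<Sum>i\<in>I. g a i y (z i) + g i a (z i) y)) =
        (\<Sum>i\<in>I. \<Sum>y\<in>C a. u a y * (g a i y (z i) + g i a (z i) y))"
      unfolding sum_distrib_left by (rule sum.swap)
    then show ?thesis by (simp add: F_def f'_def distrib_left sum.distrib)
  qed
  have Ef': "(\<Sum>x\<in>C i. u i x * f' i x) = (\<Sum>x\<in>C i. u i x * f i x) + (E a i + E i a)" for i
  proof -
    have "(\<Sum>x\<in>C i. u i x * (\<Sum>y\<in>C a. u a y * (g a i y x + g i a x y))) =
      (\<Sum>x\<in>C i. \<Sum>y\<in>C a. u a y * u i x * g a i y x) + E i a"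
      unfolding E_def sum.distrib[symmetric] sum_distrib_left
      by (intro sum.cong refl) (simp add: algebra_simps)
    also have "(\<Sum>x\<in>C i. \<Sum>y\<in>C a. u a y * u i x * g a i y x) = E a i"
      unfolding E_def by (rule sum.swap)
    finally show ?thesis by (simp add: f'_def distrib_left sum.distrib)
  qed
  define z' where "z' = z(a := y)"
  have z': "z' a = y" "\<And>i. i \<in> I \<Longrightarrow> z' i = z i" using insert.hyps by (auto simp: z'_def)
  have pairs: "(\<Sum>i\<in>insert a I. \<Sum>j\<in>insert a I - {i}. g i j (z' i) (z' j)) =
      (\<Sum>i\<in>I. g a i y (z i) + g i a (z i) y) + (\<Sum>i\<in>I. \<Sum>j\<in>I - {i}. g i j (z i) (z j))"
    using insert.hyps by (subst sum_pairs_insert) (auto simp: z' intro!: sum.cong arg_cong2[where f="(+)"])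
  have "(\<Sum>i\<in>insert a I. f i (z' i)) + (\<Sum>i\<in>insert a I. \<Sum>j\<in>insert a I - {i}. g i j (z' i) (z' j))
      = F y + (\<Sum>i\<in>I. f i (z i)) + (\<Sum>i\<in>I. \<Sum>j\<in>I - {i}. g i j (z i) (z j))"
    unfolding pairs F_def using insert.hyps by (simp add: z')
  also have "\<dots> \<le> (\<Sum>y\<in>C a. u a y * f a y) + (\<Sum>i\<in>I. f' i (z i)) + (\<Sum>i\<in>I. \<Sum>j\<in>I - {i}. g i j (z i) (z j))"
    using y(2) EF by linarith
  also have "\<dots> \<le> (\<Sum>y\<in>C a. u a y * f a y) + (\<Sum>i\<in>I. \<Sum>x\<in>C i. u i x * f' i x) + (\<Sum>i\<in>I. \<Sum>j\<in>I - {i}. E i j)"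
    using z(2) by linarith
  also have "\<dots> = (\<Sum>i\<in>insert a I. \<Sum>x\<in>C i. u i x * f i x) +
      (\<Sum>i\<in>insert a I. \<Sum>j\<in>insert a I - {i}. E i j)"
    using insert.hyps by (subst sum_pairs_insert) (auto simp: Ef' sum.distrib)
  finally have "(\<Sum>i\<in>insert a I. f i (z' i)) + (\<Sum>i\<in>insert a I. \<Sum>j\<in>insert a I - {i}. g i j (z' i) (z' j))
    \<le> \<dots>" .
  moreover have "\<forall>i\<in>insert a I. z' i \<in> C i" using z(1) y(1) z' by auto
  ultimately show ?case unfolding E_def by blast
qed

text \<open>Bounds the colours of \<open>p\<close> when \<open>q\<close> has \<open>m\<close>
  colours. The inner tolerance is half of \<open>\<gamma> m\<close> times the squared least weight
  of a representative, and depends on the current bound \<open>k\<close>. The size of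
  \<open>r\<close> is left unbounded.\<close>

definition level_bound :: "(nat \<Rightarrow> real) \<Rightarrow> (nat \<Rightarrow> real) \<Rightarrow> nat \<Rightarrow> nat" where
  "level_bound \<tau> \<gamma> m =
     iter_bound (\<lambda>k. 4 ^ nat \<lceil>1 / (\<gamma> m / 2 * (\<tau> m / (4 * (real m + 1) * (real k + 1)))\<^sup>2)\<^sup>2\<rceil> * k)
       (nat \<lceil>1 / ((\<tau> m)\<^sup>2 * \<gamma> m / 8)\<^sup>2\<rceil>) m"

text \<open>\<open>B\<close> bounds the colours of \<open>q\<close>. The maximum over all smaller
  values avoids a proof that \<open>level_bound\<close> is monotone.\<close>

definition strong_bound :: "(nat \<Rightarrow> real) \<Rightarrow> (nat \<Rightarrow> real) \<Rightarrow> real \<Rightarrow> nat \<Rightarrow> nat" where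
  "strong_bound \<tau> \<gamma> \<delta> n =
     (let B = iter_bound (level_bound \<tau> \<gamma>) (nat \<lceil>1 / (\<delta> / 4)\<^sup>2\<rceil>) n
      in Max (insert B (level_bound \<tau> \<gamma> ` {..B})))"

context weighted_relation
begin

text \<open>Regularity in cut norm form: all subsets are allowed, and the error is measured against
  the weight of the whole pair.\<close>

definition regular_pair :: "'a set \<Rightarrow> 'a set \<Rightarrow> real \<Rightarrow> bool" where
  "regular_pair S T \<gamma> \<longleftrightarrow>
     (\<forall>S' T'. S' \<subseteq> S \<longrightarrow> T' \<subseteq> T \<longrightarrow>
        \<bar>wsum A S' T' - average A S T * (sum w S' * sum w T')\<bar> \<le> \<gamma> * (sum w S * sum w T))"

lemma small_classes:
  assumes "p ` V \<subseteq> {..<k}" "0 \<le> c"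
  shows "(\<Sum>x\<in>V. w x * of_bool (sum w (cls p (p x)) < c)) \<le> real k * c"
proof -
  have "(\<Sum>x\<in>V. w x * of_bool (sum w (cls p (p x)) < c))
      = (\<Sum>j\<in>p ` V. \<Sum>x\<in>cls p j. w x * of_bool (sum w (cls p (p x)) < c))"
    unfolding cls_def by (rule sum.image_gen) simp
  also have "\<dots> = (\<Sum>j\<in>p ` V. sum w (cls p j) * of_bool (sum w (cls p j) < c))"
    unfolding sum_distrib_right by (intro sum.cong refl) (auto simp: cls_def)
  also have "\<dots> \<le> (\<Sum>j\<in>p ` V. c)" using assms by (intro sum_mono) auto
  also have "\<dots> \<le> real k * c"
    using card_mono[OF _ assms(1)] assms(2) by (simp add: mult_right_mono)
  finally show ?thesis .
qed

lemma wsum_classes_le: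
  assumes "I \<subseteq> p ` V" "\<And>x y. 0 \<le> f x y"
  shows "(\<Sum>i\<in>I. \<Sum>j\<in>I - {i}. wsum f (cls p i) (cls p j)) \<le> wsum f V V"
proof -
  have nn: "0 \<le> wsum f (cls p i) (cls p j)" for i j
    using assms by (intro wsum_nonneg cls_subset)
  have "(\<Sum>i\<in>I. \<Sum>j\<in>I - {i}. wsum f (cls p i) (cls p j)) \<le>
      (\<Sum>i\<in>I. \<Sum>j\<in>p ` V. wsum f (cls p i) (cls p j))"
    using assms nn by (intro sum_mono sum_mono2) auto
  also have "\<dots> \<le> (\<Sum>i\<in>p ` V. \<Sum>j\<in>p ` V. wsum f (cls p i) (cls p j))"
    using assms nn by (intro sum_mono2 sum_nonneg) auto
  finally show ?thesis by (simp add: wsum_classes[of f p])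
qed

text \<open>Choose a random point \<open>z i\<close> of each class with probability proportional to
  weight, and let \<open>b i\<close> be its \<open>p\<close>-class. Too light sets, irregular pairs
  and deviating densities are each priced so that their expected cost is at most
  \<open>1 / 4\<close>. Some choice therefore costs less than \<open>1\<close>, and the prices are
  such that this excludes all three defects.\<close>

lemma select_representatives:
  assumes pq: "refines p q" "q ` V \<subseteq> {..<m}" "p ` V \<subseteq> {..<k}"
    and pr: "refines r p" "cut_regular r (\<gamma> / 2 * (\<tau> / (4 * (real m + 1) * (real k + 1)))\<^sup>2)"
    and en: "energy p - energy q \<le> (\<delta> / 4)\<^sup>2" "energy r - energy p \<le> (\<tau>\<^sup>2 * \<gamma> / 8)\<^sup>2"
    and pos: "0 < \<tau>" "0 < \<gamma>" "0 < \<delta>"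
  defines "I \<equiv> {i \<in> {..<m}. \<tau> \<le> sum w (cls q i)}"
  shows "\<exists>b. (\<forall>i\<in>I. b i \<subseteq> cls q i \<and> \<tau> / (4 * (real m + 1) * (real k + 1)) \<le> sum w (b i)) \<and>
    (\<forall>i\<in>I. \<forall>j\<in>I. i \<noteq> j \<longrightarrow> regular_pair (b i) (b j) \<gamma>) \<and>
    (\<Sum>i\<in>I. \<Sum>j\<in>I - {i}. sum w (cls q i) * sum w (cls q j) *
       \<bar>average A (b i) (b j) - average A (cls q i) (cls q j)\<bar>) \<le> \<delta>"
proof -
  \<comment> \<open>A class of weight at least \<open>\<tau>\<close> meets at most \<open>k\<close>
    classes of \<open>p\<close>, so a random one is lighter than \<open>c\<close> with probability
    at most \<open>k * c / \<tau>\<close>. Over at most \<open>m\<close> classes these add up to at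
    most \<open>1 / 4\<close>.\<close>
  define c where "c = \<tau> / (4 * (real m + 1) * (real k + 1))"
  have c: "0 < c" using pos by (simp add: c_def)
  define \<mu> where "\<mu> i = sum w (cls q i)" for i
  have \<mu>: "\<tau> \<le> \<mu> i" "0 < \<mu> i" if "i \<in> I" for i using that pos by (auto simp: I_def \<mu>_def)
  define h where "h x y = \<bar>step A r x y - step A p x y\<bar>" for x y
  define h' where "h' x y = \<bar>step A p x y - step A q x y\<bar>" for x y
  define b where "b x = cls p (p x)" for x
  define f where "f x = (of_bool (sum w (b x) < c) :: real)" for x
  \<comment> \<open>A first summand below \<open>1\<close> forces the mean of \<open>h\<close> on
    the block to be at most \<open>\<gamma> / 2\<close>; the second summands, summed over all pairs,
    bound the density deviation by \<open>\<delta>\<close>. The factor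
    \<open>\<mu> i * \<mu> j\<close> turns the random choice back into an integral over the
    classes.\<close>
  define g where "g i j x y = 2 / \<gamma> * step h p x y + 1 / \<delta> * (\<mu> i * \<mu> j * h' x y)" for i j x y
  have step_nn: "0 \<le> step h p x y" for x y
    unfolding step_def by (intro average_nonneg cls_subset) (simp add: h_def)
  have h'_nn: "0 \<le> h' x y" for x y by (simp add: h'_def)
  have finI: "finite I" by (simp add: I_def)
  have IV: "I \<subseteq> q ` V"
  proof
    fix i assume "i \<in> I"
    then have "cls q i \<noteq> {}" using \<mu>[of i] by (auto simp: \<mu>_def)
    then show "i \<in> q ` V" by (auto simp: cls_def)
  qed
  have "\<exists>z. (\<forall>i\<in>I. z i \<in> cls q i) \<and>
    (\<Sum>i\<in>I. f (z i)) + (\<Sum>i\<in>I. \<Sum>j\<in>I - {i}. g i j (z i) (z j)) \<le>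
    (\<Sum>i\<in>I. \<Sum>x\<in>cls q i. w x / \<mu> i * f x) +
    (\<Sum>i\<in>I. \<Sum>j\<in>I - {i}. \<Sum>x\<in>cls q i. \<Sum>y\<in>cls q j. w x / \<mu> i * (w y / \<mu> j) * g i j x y)"
  proof (rule pairwise_selection)
    show "0 \<le> w x / \<mu> i" if "i \<in> I" "x \<in> cls q i" for i x
      using that \<mu>[of i] w_nonneg[of x] by (auto simp: cls_def)
    show "(\<Sum>x\<in>cls q i. w x / \<mu> i) = 1" if "i \<in> I" for i
      using \<mu>[OF that] by (simp add: \<mu>_def flip: sum_divide_distrib)
  qed (simp_all add: finI)
  then obtain z where z: "\<And>i. i \<in> I \<Longrightarrow> z i \<in> cls q i" and zle:
    "(\<Sum>i\<in>I. f (z i)) + (\<Sum>i\<in>I. \<Sum>j\<in>I - {i}. g i j (z i) (z j)) \<le>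
    (\<Sum>i\<in>I. \<Sum>x\<in>cls q i. w x / \<mu> i * f x) +
    (\<Sum>i\<in>I. \<Sum>j\<in>I - {i}. \<Sum>x\<in>cls q i. \<Sum>y\<in>cls q j. w x / \<mu> i * (w y / \<mu> j) * g i j x y)"
    by blast
  have Ef: "(\<Sum>i\<in>I. \<Sum>x\<in>cls q i. w x / \<mu> i * f x) \<le> 1 / 4"
  proof -
    have "(\<Sum>x\<in>cls q i. w x / \<mu> i * f x) \<le> real k * c / \<tau>" if "i \<in> I" for i
    proof -
      have "(\<Sum>x\<in>cls q i. w x * f x) \<le> (\<Sum>x\<in>V. w x * f x)"
        using cls_subset by (intro sum_mono2) (auto simp: f_def w_nonneg)
      also have "\<dots> \<le> real k * c"
        unfolding f_def b_def using c by (intro small_classes pq) auto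
      finally have 1: "(\<Sum>x\<in>cls q i. w x * f x) \<le> real k * c" .
      have "(\<Sum>x\<in>cls q i. w x / \<mu> i * f x) = (\<Sum>x\<in>cls q i. w x * f x) / \<mu> i"
        by (simp add: sum_divide_distrib)
      also have "\<dots> \<le> real k * c / \<tau>"
        using \<mu>[OF that] pos c 1 by (intro frac_le) auto
      finally show ?thesis .
    qed
    then have "(\<Sum>i\<in>I. \<Sum>x\<in>cls q i. w x / \<mu> i * f x) \<le> real (card I) * (real k * c / \<tau>)"
      by (rule sum_bounded_above)
    also have "\<dots> \<le> real m * (real k * c / \<tau>)"
      using card_mono[of "{..<m}" I] c pos by (intro mult_right_mono) (auto simp: I_def)
    also have "\<dots> = real m * real k / ((real m + 1) * (real k + 1)) / 4"
    proof -
      have "c / \<tau> = 1 / (4 * ((real m + 1) * (real k + 1)))"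
        using pos by (simp add: c_def mult.assoc)
      then have "real m * real k * (c / \<tau>) = real m * real k / (4 * ((real m + 1) * (real k + 1)))"
        by simp
      then show ?thesis by (simp add: mult_ac)
    qed
    also have "\<dots> \<le> 1 / 4"
    proof -
      have "real m * real k \<le> (real m + 1) * (real k + 1)" by (intro mult_mono) auto
      then have "real m * real k / ((real m + 1) * (real k + 1)) \<le> 1" by (subst divide_le_eq_1) (auto intro: add_nonneg_pos)
      then show ?thesis by (rule divide_right_mono) simp
    qed
    finally show ?thesis .
  qed
  have norm: "(\<Sum>x\<in>cls q i. \<Sum>y\<in>cls q j. w x / \<mu> i * (w y / \<mu> j) * F x y)
      = wsum F (cls q i) (cls q j) / (\<mu> i * \<mu> j)" for i j F
    unfolding wsum_def sum_divide_distrib by (intro sum.cong refl) simp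
  have g1: "(\<Sum>x\<in>cls q i. \<Sum>y\<in>cls q j. w x / \<mu> i * (w y / \<mu> j) * g i j x y) \<le>
     2 / \<gamma> / \<tau>\<^sup>2 * wsum (step h p) (cls q i) (cls q j) + 1 / \<delta> * wsum h' (cls q i) (cls q j)"
    if "i \<in> I" "j \<in> I" for i j
  proof -
    have p: "0 < \<mu> i * \<mu> j" "\<tau>\<^sup>2 \<le> \<mu> i * \<mu> j"
      using \<mu>[OF that(1)] \<mu>[OF that(2)] pos by (auto simp: power2_eq_square intro: mult_mono)
    have nn: "0 \<le> wsum (step h p) (cls q i) (cls q j)"
      using step_nn by (intro wsum_nonneg cls_subset)
    have "(\<Sum>x\<in>cls q i. \<Sum>y\<in>cls q j. w x / \<mu> i * (w y / \<mu> j) * g i j x y) =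
       2 / \<gamma> * wsum (step h p) (cls q i) (cls q j) / (\<mu> i * \<mu> j) + 1 / \<delta> * wsum h' (cls q i) (cls q j)"
      unfolding norm g_def wsum_add wsum_cmult using \<mu>(2)[OF that(1)] \<mu>(2)[OF that(2)]
      by (simp add: add_divide_distrib)
    moreover have "2 / \<gamma> * wsum (step h p) (cls q i) (cls q j) / (\<mu> i * \<mu> j) \<le>
       2 / \<gamma> * wsum (step h p) (cls q i) (cls q j) / \<tau>\<^sup>2"
      using p nn pos \<mu>(2)[OF that(1)] \<mu>(2)[OF that(2)]
      by (intro divide_left_mono mult_nonneg_nonneg mult_pos_pos) auto
    ultimately show ?thesis by simp
  qed
  \<comment> \<open>Averaging over blocks preserves the total, so the L1 bound on \<open>h\<close>
    passes to its block means.\<close>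
  have "wsum (step h p) V V = wsum h V V"
    using wsum_step_mult[of p "\<lambda>_ _. 1" h] by simp
  also have "\<dots> \<le> \<tau>\<^sup>2 * \<gamma> / 8"
    unfolding h_def using L1_le_sqrt_energy_diff[OF pr(1) en(2)] pos by simp
  finally have L1: "wsum (step h p) V V \<le> \<tau>\<^sup>2 * \<gamma> / 8" .
  have L2: "wsum h' V V \<le> \<delta> / 4"
    unfolding h'_def using L1_le_sqrt_energy_diff[OF pq(1) en(1)] pos by simp
  have "(\<Sum>i\<in>I. \<Sum>j\<in>I - {i}. \<Sum>x\<in>cls q i. \<Sum>y\<in>cls q j. w x / \<mu> i * (w y / \<mu> j) * g i j x y) \<le>
     (\<Sum>i\<in>I. \<Sum>j\<in>I - {i}. 2 / \<gamma> / \<tau>\<^sup>2 * wsum (step h p) (cls q i) (cls q j) + 1 / \<delta> * wsum h' (cls q i) (cls q j))"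
    by (intro sum_mono g1) auto
  also have "\<dots> = 2 / \<gamma> / \<tau>\<^sup>2 * (\<Sum>i\<in>I. \<Sum>j\<in>I - {i}. wsum (step h p) (cls q i) (cls q j)) +
     1 / \<delta> * (\<Sum>i\<in>I. \<Sum>j\<in>I - {i}. wsum h' (cls q i) (cls q j))"
    by (simp only: sum.distrib sum_distrib_left)
  also have "\<dots> \<le> 2 / \<gamma> / \<tau>\<^sup>2 * (\<tau>\<^sup>2 * \<gamma> / 8) + 1 / \<delta> * (\<delta> / 4)"
    using pos order_trans[OF wsum_classes_le[OF IV step_nn] L1] order_trans[OF wsum_classes_le[OF IV h'_nn] L2]
    by (intro add_mono mult_left_mono) auto
  also have "\<dots> = 1 / 2" using pos by (simp add: field_simps)
  finally have Eg: "(\<Sum>i\<in>I. \<Sum>j\<in>I - {i}. \<Sum>x\<in>cls q i. \<Sum>y\<in>cls q j. w x / \<mu> i * (w y / \<mu> j) * g i j x y) \<le> 1 / 2" .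
  have f_nn: "0 \<le> f x" for x by (simp add: f_def)
  have g_nn: "0 \<le> g i j x y" if "i \<in> I" "j \<in> I" for i j x y
    using \<mu>[OF that(1)] \<mu>[OF that(2)] pos step_nn h'_nn by (simp add: g_def)
  have sg_nn: "0 \<le> (\<Sum>j\<in>I - {i}. g i j (z i) (z j))" if "i \<in> I" for i
    using that g_nn by (intro sum_nonneg) auto
  have tot: "(\<Sum>i\<in>I. f (z i)) + (\<Sum>i\<in>I. \<Sum>j\<in>I - {i}. g i j (z i) (z j)) < 1"
    using zle Ef Eg by linarith
  have "0 \<le> (\<Sum>i\<in>I. f (z i))" by (intro sum_nonneg f_nn)
  with tot have gtot: "(\<Sum>i\<in>I. \<Sum>j\<in>I - {i}. g i j (z i) (z j)) < 1" by linarith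
  have "0 \<le> (\<Sum>i\<in>I. \<Sum>j\<in>I - {i}. g i j (z i) (z j))" by (intro sum_nonneg sg_nn)
  with tot have ftot: "(\<Sum>i\<in>I. f (z i)) < 1" by linarith
  have size: "c \<le> sum w (b (z i))" if "i \<in> I" for i
  proof (rule ccontr)
    assume "\<not> ?thesis"
    then have "f (z i) = 1" by (simp add: f_def)
    moreover have "f (z i) \<le> (\<Sum>i\<in>I. f (z i))" using that finI f_nn by (intro member_le_sum) auto
    ultimately show False using ftot by simp
  qed
  have bq: "b (z i) \<subseteq> cls q i" if "i \<in> I" for i
  proof
    fix x assume "x \<in> b (z i)"
    then have x: "x \<in> V" "p x = p (z i)" by (auto simp: b_def cls_def)
    have "z i \<in> V" "q (z i) = i" using z[OF that] by (auto simp: cls_def)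
    then show "x \<in> cls q i" using refinesD[OF pq(1) x(1) _ x(2)] x(1) by (simp add: cls_def)
  qed
  have bV: "b x \<subseteq> V" for x by (simp add: b_def cls_subset)
  \<comment> \<open>Split \<open>A - step A p\<close> at \<open>step A r\<close>. The first
    difference is small by cut regularity of \<open>r\<close>, whose tolerance was set relative to
    \<open>c\<^sup>2\<close>; the second is at most the integral of \<open>h\<close> over the chosen
    block.\<close>
  have reg: "regular_pair (b (z i)) (b (z j)) \<gamma>" if ij: "i \<in> I" "j \<in> I" "i \<noteq> j" for i j
    unfolding regular_pair_def
  proof (intro allI impI)
    fix S T assume ST: "S \<subseteq> b (z i)" "T \<subseteq> b (z j)"
    have "g i j (z i) (z j) \<le> (\<Sum>j\<in>I - {i}. g i j (z i) (z j))"
      using ij finI g_nn by (intro member_le_sum) auto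
    also have "\<dots> \<le> (\<Sum>i\<in>I. \<Sum>j\<in>I - {i}. g i j (z i) (z j))"
      using ij finI sg_nn by (intro member_le_sum[of i]) auto
    finally have "g i j (z i) (z j) < 1" using gtot by linarith
    moreover have "0 \<le> 1 / \<delta> * (\<mu> i * \<mu> j * h' (z i) (z j))"
      using \<mu> ij pos h'_nn by (intro mult_nonneg_nonneg) (auto intro: less_imp_le)
    ultimately have "2 / \<gamma> * step h p (z i) (z j) < 1" unfolding g_def by linarith
    then have "step h p (z i) (z j) \<le> \<gamma> / 2" using pos by (simp add: field_simps)
    then have "step h p (z i) (z j) * (sum w (b (z i)) * sum w (b (z j))) \<le> \<gamma> / 2 * (sum w (b (z i)) * sum w (b (z j)))"
      using bV by (intro mult_right_mono mult_nonneg_nonneg sum_w_nonneg)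
    then have hb: "wsum h (b (z i)) (b (z j)) \<le> \<gamma> / 2 * (sum w (b (z i)) * sum w (b (z j)))"
      by (simp add: step_def average_mult cls_subset b_def)
    have "\<bar>wsum (\<lambda>x y. step A r x y - step A p x y) S T\<bar> \<le> wsum h S T"
      unfolding h_def using ST bV by (intro wsum_abs) blast+
    also have "\<dots> \<le> wsum h (b (z i)) (b (z j))"
      using ST bV by (intro wsum_mono_set) (auto simp: h_def)
    finally have 1: "\<bar>wsum (\<lambda>x y. step A r x y - step A p x y) S T\<bar> \<le> \<gamma> / 2 * (sum w (b (z i)) * sum w (b (z j)))"
      using hb by linarith
    have "S \<subseteq> V" "T \<subseteq> V" using ST bV by blast+
    then have "\<bar>wsum (\<lambda>x y. A x y - step A r x y) S T\<bar> \<le> \<gamma> / 2 * c\<^sup>2"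
      using pr(2) by (simp add: cut_regular_def c_def)
    also have "\<dots> \<le> \<gamma> / 2 * (sum w (b (z i)) * sum w (b (z j)))"
      using size[OF ij(1)] size[OF ij(2)] pos c
      by (intro mult_left_mono) (auto simp: power2_eq_square intro!: mult_mono)
    finally have 2: "\<bar>wsum (\<lambda>x y. A x y - step A r x y) S T\<bar> \<le> \<gamma> / 2 * (sum w (b (z i)) * sum w (b (z j)))" .
    have "wsum (\<lambda>x y. step A p x y) S T = wsum (\<lambda>x y. average A (b (z i)) (b (z j))) S T"
      using ST by (intro wsum_cong refl) (auto simp: step_def b_def cls_def subset_iff)
    then have "wsum A S T - average A (b (z i)) (b (z j)) * (sum w S * sum w T)
      = wsum (\<lambda>x y. A x y - step A r x y) S T + wsum (\<lambda>x y. step A r x y - step A p x y) S T"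
      by (simp add: wsum_diff wsum_const)
    then show "\<bar>wsum A S T - average A (b (z i)) (b (z j)) * (sum w S * sum w T)\<bar>
        \<le> \<gamma> * (sum w (b (z i)) * sum w (b (z j)))"
      using 1 2 by linarith
  qed
  have "(\<Sum>i\<in>I. \<Sum>j\<in>I - {i}. 1 / \<delta> * (\<mu> i * \<mu> j * h' (z i) (z j))) \<le> (\<Sum>i\<in>I. \<Sum>j\<in>I - {i}. g i j (z i) (z j))"
    using pos step_nn by (intro sum_mono) (simp add: g_def)
  with gtot have "1 / \<delta> * (\<Sum>i\<in>I. \<Sum>j\<in>I - {i}. \<mu> i * \<mu> j * h' (z i) (z j)) \<le> 1"
    by (simp only: sum_distrib_left)
  then have "(\<Sum>i\<in>I. \<Sum>j\<in>I - {i}. \<mu> i * \<mu> j * h' (z i) (z j)) \<le> \<delta>" (is "?s \<le> _")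
    using pos by (simp add: field_simps)
  moreover have "?s = (\<Sum>i\<in>I. \<Sum>j\<in>I - {i}. sum w (cls q i) * sum w (cls q j) *
       \<bar>average A (b (z i)) (b (z j)) - average A (cls q i) (cls q j)\<bar>)"
  proof (intro sum.cong refl)
    fix i j assume "i \<in> I" "j \<in> I - {i}"
    then have "q (z i) = i" "q (z j) = j" using z by (auto simp: cls_def)
    then show "\<mu> i * \<mu> j * h' (z i) (z j) = sum w (cls q i) * sum w (cls q j) *
       \<bar>average A (b (z i)) (b (z j)) - average A (cls q i) (cls q j)\<bar>"
      by (simp add: h'_def step_def b_def \<mu>_def)
  qed
  ultimately have dens: "(\<Sum>i\<in>I. \<Sum>j\<in>I - {i}. sum w (cls q i) * sum w (cls q j) *
       \<bar>average A (b (z i)) (b (z j)) - average A (cls q i) (cls q j)\<bar>) \<le> \<delta>"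
    by simp
  show ?thesis
    using size bq reg dens unfolding c_def by (intro exI[of _ "\<lambda>i. b (z i)"]) auto
qed

text \<open>The outer pigeonhole finds \<open>q\<close> and \<open>p\<close>, the inner one, run at
  every level of the outer, finds \<open>p\<close> and \<open>r\<close>. \<open>\<tau>\<close> and
  \<open>\<gamma>\<close> are evaluated at the bound \<open>m\<close> for the partition that is
  finally found, which is not known in advance.\<close>

lemma strong_regularity:
  fixes \<tau> \<gamma> :: "nat \<Rightarrow> real"
  assumes pos: "\<And>n. 0 < \<tau> n" "\<And>n. 0 < \<gamma> n" "0 < \<delta>" and p: "p ` V \<subseteq> {..<n}"
  shows "\<exists>m k q b. m \<le> strong_bound \<tau> \<gamma> \<delta> n \<and> k \<le> strong_bound \<tau> \<gamma> \<delta> n \<and>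
    refines q p \<and> q ` V \<subseteq> {..<m} \<and>
    (let I = {i \<in> {..<m}. \<tau> m \<le> sum w (cls q i)} in
      (\<forall>i\<in>I. b i \<subseteq> cls q i \<and> \<tau> m / (4 * (real m + 1) * (real k + 1)) \<le> sum w (b i)) \<and>
      (\<forall>i\<in>I. \<forall>j\<in>I. i \<noteq> j \<longrightarrow> regular_pair (b i) (b j) (\<gamma> m)) \<and>
      (\<Sum>i\<in>I. \<Sum>j\<in>I - {i}. sum w (cls q i) * sum w (cls q j) *
         \<bar>average A (b i) (b j) - average A (cls q i) (cls q j)\<bar>) \<le> \<delta>)"
proof -
  define c where "c m k = \<gamma> m / 2 * (\<tau> m / (4 * (real m + 1) * (real k + 1)))\<^sup>2" for m k
  define d where "d m = ((\<tau> m)\<^sup>2 * \<gamma> m / 8)\<^sup>2" for m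
  have c: "0 < c m k" for m k :: nat
    unfolding c_def using pos(1)[of m] pos(2)[of m] by (intro mult_pos_pos zero_less_power divide_pos_pos) auto
  have d: "0 < d m" for m
    unfolding d_def using pos(1)[of m] pos(2)[of m] by (intro mult_pos_pos zero_less_power divide_pos_pos) auto
  define L where "L = level_bound \<tau> \<gamma>"
  \<comment> \<open>Packs the whole outcome of the inner pigeonhole into the relation that the outer
    one carries along.\<close>
  define \<Phi> where "\<Phi> m q p \<longleftrightarrow> (\<exists>k\<le>L m. p ` V \<subseteq> {..<k} \<and>
     (\<exists>r. refines r p \<and> cut_regular r (c m k) \<and> energy r - energy p \<le> d m))"
    for m and q p :: "'a \<Rightarrow> nat"
  have step: "\<exists>p. refines p q \<and> p ` V \<subseteq> {..<L m} \<and> \<Phi> m q p" if q: "q ` V \<subseteq> {..<m}" for m q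
  proof -
    have "\<exists>k p r. k \<le> iter_bound (\<lambda>k. 4 ^ nat \<lceil>1 / (c m k)\<^sup>2\<rceil> * k) (nat \<lceil>1 / d m\<rceil>) m \<and> refines p q \<and>
       p ` V \<subseteq> {..<k} \<and> refines r p \<and> cut_regular r (c m k) \<and> energy r - energy p \<le> d m"
      by (rule energy_pigeonhole[where \<Phi> = "\<lambda>k p r. cut_regular r (c m k)"])
         (use cut_regular_refinement c d q in auto)
    moreover have "iter_bound (\<lambda>k. 4 ^ nat \<lceil>1 / (c m k)\<^sup>2\<rceil> * k) (nat \<lceil>1 / d m\<rceil>) m = L m"
      by (simp add: L_def level_bound_def c_def d_def)
    ultimately obtain k p r where k: "k \<le> L m" "refines p q"
       "p ` V \<subseteq> {..<k}" "refines r p" "cut_regular r (c m k)" "energy r - energy p \<le> d m"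
      by metis
    have "p ` V \<subseteq> {..<L m}" using k(1,3) by auto
    with k show ?thesis unfolding \<Phi>_def by blast
  qed
  define B where "B = iter_bound L (nat \<lceil>1 / (\<delta> / 4)\<^sup>2\<rceil>) n"
  have "0 < (\<delta> / 4)\<^sup>2" using pos by simp
  from energy_pigeonhole[where g = L and \<Phi> = \<Phi>, OF step this p]
  obtain m q p' where m: "m \<le> B" "refines q p" "q ` V \<subseteq> {..<m}" "refines p' q" "\<Phi> m q p'"
    "energy p' - energy q \<le> (\<delta> / 4)\<^sup>2"
    unfolding B_def by blast
  obtain k r where k: "k \<le> L m" "p' ` V \<subseteq> {..<k}" "refines r p'" "cut_regular r (c m k)"
    "energy r - energy p' \<le> d m"
    using m(5) unfolding \<Phi>_def by blast
  have SB: "strong_bound \<tau> \<gamma> \<delta> n = Max (insert B (L ` {..B}))"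
    by (simp add: strong_bound_def B_def L_def Let_def)
  have "B \<le> strong_bound \<tau> \<gamma> \<delta> n" "L m \<le> strong_bound \<tau> \<gamma> \<delta> n"
    unfolding SB using m(1) by (intro Max_ge; auto)+
  with m(1) k(1) have le: "m \<le> strong_bound \<tau> \<gamma> \<delta> n" "k \<le> strong_bound \<tau> \<gamma> \<delta> n" by linarith+
  from select_representatives[OF m(4,3) k(2,3) k(4)[unfolded c_def] m(6) k(5)[unfolded d_def] pos(1) pos(2) pos(3)]
  show ?thesis unfolding Let_def using le m(2,3) by blast
qed

end

subsection \<open>Counting homogeneous and regular configurations\<close>

context weighted_relation
begin

text \<open>The total weight of ordered \<open>k\<close>-tuples of distinct elements of
  \<open>S\<close> in which each entry is \<open>R\<close>-related to all later ones.\<close>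

primrec hom_weight :: "('a \<Rightarrow> 'a \<Rightarrow> bool) \<Rightarrow> nat \<Rightarrow> 'a set \<Rightarrow> real" where
  "hom_weight R 0 S = 1"
| "hom_weight R (Suc k) S = (\<Sum>x\<in>S. w x * hom_weight R k {y \<in> S. y \<noteq> x \<and> R x y})"

lemma hom_weight_nonneg: "S \<subseteq> V \<Longrightarrow> 0 \<le> hom_weight R k S"
proof (induction k arbitrary: S)
  case (Suc k)
  have "{y \<in> S. y \<noteq> x \<and> R x y} \<subseteq> V" for x using Suc.prems by auto
  with Suc show ?case by (auto intro!: sum_nonneg mult_nonneg_nonneg w_nonneg)
qed simp

lemma hom_weight_mono: "S \<subseteq> T \<Longrightarrow> T \<subseteq> V \<Longrightarrow> hom_weight R k S \<le> hom_weight R k T"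
proof (induction k arbitrary: S T)
  case (Suc k)
  have T: "{y \<in> T. y \<noteq> x \<and> R x y} \<subseteq> V" for x using Suc.prems by auto
  have "finite T" using Suc.prems finite_subset[OF _ finite_V] by blast
  have "hom_weight R (Suc k) S \<le> (\<Sum>x\<in>S. w x * hom_weight R k {y \<in> T. y \<noteq> x \<and> R x y})"
    unfolding hom_weight.simps
  proof (intro sum_mono mult_left_mono)
    fix x assume "x \<in> S"
    show "hom_weight R k {y \<in> S. y \<noteq> x \<and> R x y} \<le> hom_weight R k {y \<in> T. y \<noteq> x \<and> R x y}"
      using Suc.prems by (intro Suc.IH T) auto
    show "0 \<le> w x" using \<open>x \<in> S\<close> Suc.prems by (auto intro: w_nonneg)
  qed
  also have "\<dots> \<le> hom_weight R (Suc k) T"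
    unfolding hom_weight.simps using Suc.prems \<open>finite T\<close> T
    by (intro sum_mono2 mult_nonneg_nonneg hom_weight_nonneg) (auto intro: w_nonneg)
  finally show ?case .
qed simp

lemma hom_weight_Suc_le: "S \<subseteq> V \<Longrightarrow> hom_weight R (Suc k) S \<le> sum w S * hom_weight R k S"
  unfolding hom_weight.simps sum_distrib_right
  by (intro sum_mono mult_left_mono hom_weight_mono) (auto intro: w_nonneg)

text \<open>Dropping a vertex from a homogeneous tuple costs at most a factor
  \<open>sum w S\<close>, so a density bound for \<open>m\<close>-tuples persists for shorter
  tuples. A forbidden graph may put any number of vertices up to the bound into a class.\<close>

lemma hom_weight_lower:
  assumes "S \<subseteq> V" "0 < sum w S" "\<rho> * sum w S ^ m \<le> hom_weight R m S" "k \<le> m"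
  shows "\<rho> * sum w S ^ k \<le> hom_weight R k S"
  using assms(4,3)
proof (induction rule: inc_induct)
  case (step n)
  have "sum w S * (\<rho> * sum w S ^ n) \<le> sum w S * hom_weight R n S"
    using order_trans[OF step.IH[OF step.prems] hom_weight_Suc_le[OF assms(1)]] by (simp add: mult_ac)
  then show ?case using assms(2) by simp
qed

text \<open>The recursion of Erdos and Szekeres, with weights in place of cardinalities.\<close>

lemma ramsey_density_step:
  assumes "S \<subseteq> V" "X \<subseteq> S" "sum w S / 2 \<le> sum w X" "0 \<le> \<sigma>"
    and T: "\<And>x. x \<in> X \<Longrightarrow> sum w S / 4 \<le> sum w {y \<in> S. y \<noteq> x \<and> R x y}"
    and IH: "\<And>x. x \<in> X \<Longrightarrow>
      \<sigma> * sum w {y \<in> S. y \<noteq> x \<and> R x y} ^ a \<le> hom_weight R a {y \<in> S. y \<noteq> x \<and> R x y} \<or>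
      \<sigma> * sum w {y \<in> S. y \<noteq> x \<and> R x y} ^ b \<le> hom_weight Q b {y \<in> S. y \<noteq> x \<and> R x y}"
    and "\<rho> \<le> \<sigma> / 4 ^ Suc a" "\<rho> \<le> \<sigma> / 4 ^ b"
  shows "\<rho> * sum w S ^ Suc a \<le> hom_weight R (Suc a) S \<or> \<rho> * sum w S ^ b \<le> hom_weight Q b S"
proof -
  define N where "N x = {y \<in> S. y \<noteq> x \<and> R x y}" for x
  define \<mu> where "\<mu> = sum w S"
  have \<mu>: "0 \<le> \<mu>" using assms(1) by (simp add: \<mu>_def sum_w_nonneg)
  have NV: "N x \<subseteq> V" "N x \<subseteq> S" for x using assms(1) by (auto simp: N_def)
  have pow: "\<sigma> * (\<mu> / 4) ^ k \<le> \<sigma> * sum w (N x) ^ k" if "x \<in> X" for x k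
    using T[OF that] \<mu> assms(4) by (intro mult_left_mono power_mono) (auto simp: N_def \<mu>_def)
  show ?thesis
  \<comment> \<open>Either one neighbourhood already contains enough \<open>Q\<close>-homogeneous
    tuples, or every \<open>x\<close> in \<open>X\<close> can be prepended to the
    \<open>R\<close>-homogeneous tuples of its neighbourhood.\<close>
  proof (cases "\<exists>x\<in>X. \<sigma> * sum w (N x) ^ b \<le> hom_weight Q b (N x)")
    case True
    then obtain x where x: "x \<in> X" "\<sigma> * sum w (N x) ^ b \<le> hom_weight Q b (N x)" by blast
    have "\<rho> * \<mu> ^ b \<le> \<sigma> / 4 ^ b * \<mu> ^ b" using assms(8) \<mu> by (intro mult_right_mono) auto
    also have "\<dots> = \<sigma> * (\<mu> / 4) ^ b" by (simp add: power_divide)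
    also have "\<dots> \<le> hom_weight Q b S"
      using order_trans[OF pow[OF x(1)] order_trans[OF x(2) hom_weight_mono[OF NV(2) assms(1)]]] .
    finally show ?thesis by (simp add: \<mu>_def)
  next
    case False
    then have *: "\<sigma> * sum w (N x) ^ a \<le> hom_weight R a (N x)" if "x \<in> X" for x
      using IH[OF that] that by (auto simp: N_def)
    have "\<rho> * \<mu> ^ Suc a \<le> \<sigma> / 4 ^ Suc a * \<mu> ^ Suc a"
      using assms(7) \<mu> by (intro mult_right_mono) auto
    also have "\<dots> = (\<mu> / 4) * (\<sigma> * (\<mu> / 4) ^ a)" by (simp add: power_divide)
    also have "\<dots> \<le> sum w X * (\<sigma> * (\<mu> / 4) ^ a)"
      using assms(3,4) \<mu> by (intro mult_right_mono mult_nonneg_nonneg) (auto simp: \<mu>_def)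
    also have "\<dots> \<le> (\<Sum>x\<in>X. w x * hom_weight R a (N x))"
      unfolding sum_distrib_right using assms(1,2)
      by (intro sum_mono mult_left_mono order_trans[OF pow *]) (auto intro: w_nonneg)
    also have "\<dots> \<le> (\<Sum>x\<in>S. w x * hom_weight R a (N x))"
      using assms(1,2) finite_subset[OF assms(1) finite_V]
      by (intro sum_mono2 mult_nonneg_nonneg hom_weight_nonneg NV) (auto intro: w_nonneg)
    finally show ?thesis by (simp add: \<mu>_def N_def)
  qed
qed

text \<open>As no vertex has more than half the weight, each vertex keeps a quarter of the weight in
  its \<open>R\<close>- or in its non-\<open>R\<close>-neighbourhood. The lightness hypothesis loses
  a factor 4 per level, matched by \<open>4 ^ s\<close>; the density loses at most
  \<open>4 ^ (s + 1)\<close> from \<open>s\<close> to \<open>s + 1\<close>, which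
  \<open>(s + 1)\<^sup>2 \<ge> s\<^sup>2 + s + 1\<close> covers.\<close>

lemma ramsey_density:
  assumes "S \<subseteq> V" "\<And>x. x \<in> S \<Longrightarrow> w x \<le> sum w S / (2 * 4 ^ s)" "a + b = s"
  shows "(1 / 4) ^ (s * s) * sum w S ^ a \<le> hom_weight R a S \<or>
    (1 / 4) ^ (s * s) * sum w S ^ b \<le> hom_weight (\<lambda>x y. \<not> R x y) b S"
  using assms
proof (induction s arbitrary: a b S)
  case 0
  then show ?case by simp
next
  case (Suc s)
  consider "a = 0 \<or> b = 0" | a' b' where "a = Suc a'" "b = Suc b'"
    by (cases a; cases b) auto
  then show ?case
  proof cases
    case 1
    have "(1 / 4 :: real) ^ (Suc s * Suc s) \<le> 1" by (rule power_le_one) auto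
    with 1 show ?thesis by (auto simp del: mult_Suc mult_Suc_right)
  next
    case 2
    define \<mu> where "\<mu> = sum w S"
    define N where "N x = {y \<in> S. y \<noteq> x \<and> R x y}" for x
    define N' where "N' x = {y \<in> S. y \<noteq> x \<and> \<not> R x y}" for x
    define X where "X = {x \<in> S. \<mu> / 4 \<le> sum w (N x)}"
    have finS: "finite S" using Suc.prems(1) finite_subset[OF _ finite_V] by blast
    have \<mu>: "0 \<le> \<mu>" using Suc.prems(1) by (simp add: \<mu>_def sum_w_nonneg)
    have split: "sum w X + sum w (S - X) = \<mu>"
      unfolding \<mu>_def X_def using finS by (simp add: sum.subset_diff[of X S])
         (metis (no_types, lifting) X_def add.commute finS mem_Collect_eq subsetI sum.subset_diff)
    have N'X: "\<mu> / 4 \<le> sum w (N' x)" if "x \<in> S - X" for x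
    proof -
      have "S = insert x (N x \<union> N' x)" using that by (auto simp: N_def N'_def)
      moreover have "sum w (insert x (N x \<union> N' x)) = w x + (sum w (N x) + sum w (N' x))"
        using finS by (subst sum.insert) (auto simp: N_def N'_def intro!: sum.union_disjoint)
      ultimately have "\<mu> = w x + (sum w (N x) + sum w (N' x))" by (simp add: \<mu>_def)
      moreover have "w x \<le> \<mu> / 2"
      proof -
        have "w x \<le> \<mu> / (2 * 4 ^ Suc s)" using Suc.prems(2) that by (simp add: \<mu>_def)
        also have "\<dots> \<le> \<mu> / 2"
          using \<mu> one_le_power[of "4 :: real" "Suc s"] by (intro divide_left_mono) (simp_all del: power_Suc)
        finally show ?thesis .
      qed
      moreover have "sum w (N x) < \<mu> / 4" using that by (auto simp: X_def)
      ultimately show ?thesis by linarith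
    qed
    have small: "w y \<le> sum w T / (2 * 4 ^ s)" if "\<mu> / 4 \<le> sum w T" "y \<in> S" for y T
    proof -
      have "w y \<le> (\<mu> / 4) / (2 * 4 ^ s)" using Suc.prems(2)[OF that(2)] by (simp add: \<mu>_def)
      also have "\<dots> \<le> sum w T / (2 * 4 ^ s)" using that(1) by (intro divide_right_mono) auto
      finally show ?thesis .
    qed
    have le: "(1 / 4 :: real) ^ (Suc s * Suc s) \<le> (1 / 4) ^ (s * s) / 4 ^ k" if "k \<le> Suc s" for k
    proof -
      have "(1 / 4 :: real) ^ (Suc s * Suc s) \<le> (1 / 4) ^ (s * s + k)"
        using that by (intro power_decreasing) auto
      then show ?thesis by (simp add: power_add power_divide)
    qed
    have NV: "N x \<subseteq> V" "N x \<subseteq> S" "N' x \<subseteq> V" "N' x \<subseteq> S" for x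
      using Suc.prems(1) by (auto simp: N_def N'_def)
    show ?thesis
    proof (cases "\<mu> / 2 \<le> sum w X")
      case True
      show ?thesis unfolding \<open>a = Suc a'\<close>
      proof (rule ramsey_density_step[where X = X and \<sigma> = "(1 / 4) ^ (s * s)"])
        fix x assume x: "x \<in> X"
        have "(1 / 4) ^ (s * s) * sum w (N x) ^ a' \<le> hom_weight R a' (N x) \<or>
          (1 / 4) ^ (s * s) * sum w (N x) ^ b \<le> hom_weight (\<lambda>x y. \<not> R x y) b (N x)"
          using x Suc.prems(3) \<open>a = Suc a'\<close> NV[of x]
          by (intro Suc.IH small) (auto simp: X_def)
        then show "(1 / 4) ^ (s * s) * sum w {y \<in> S. y \<noteq> x \<and> R x y} ^ a' \<le> hom_weight R a' {y \<in> S. y \<noteq> x \<and> R x y} \<or>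
          (1 / 4) ^ (s * s) * sum w {y \<in> S. y \<noteq> x \<and> R x y} ^ b \<le> hom_weight (\<lambda>x y. \<not> R x y) b {y \<in> S. y \<noteq> x \<and> R x y}"
          by (simp add: N_def)
        show "sum w S / 4 \<le> sum w {y \<in> S. y \<noteq> x \<and> R x y}"
          using x by (simp add: X_def N_def \<mu>_def)
      next
        show "S \<subseteq> V" "X \<subseteq> S" using Suc.prems(1) by (auto simp: X_def)
        show "sum w S / 2 \<le> sum w X" using True by (simp add: \<mu>_def)
        show "(1 / 4 :: real) ^ (Suc s * Suc s) \<le> (1 / 4) ^ (s * s) / 4 ^ Suc a'"
          "(1 / 4 :: real) ^ (Suc s * Suc s) \<le> (1 / 4) ^ (s * s) / 4 ^ b"
          by (rule le, use Suc.prems(3) 2 in simp)+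
      qed simp
    next
      case False
      \<comment> \<open>The same step with \<open>R\<close> and its negation exchanged.\<close>
      have "(1 / 4) ^ (Suc s * Suc s) * sum w S ^ Suc b' \<le> hom_weight (\<lambda>x y. \<not> R x y) (Suc b') S \<or>
        (1 / 4) ^ (Suc s * Suc s) * sum w S ^ a \<le> hom_weight R a S"
      proof (rule ramsey_density_step[where X = "S - X" and \<sigma> = "(1 / 4) ^ (s * s)"])
        fix x assume x: "x \<in> S - X"
        have "(1 / 4) ^ (s * s) * sum w (N' x) ^ a \<le> hom_weight R a (N' x) \<or>
          (1 / 4) ^ (s * s) * sum w (N' x) ^ b' \<le> hom_weight (\<lambda>x y. \<not> R x y) b' (N' x)"
          using N'X[OF x] x Suc.prems(3) \<open>b = Suc b'\<close> NV[of x]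
          by (intro Suc.IH small) auto
        then show "(1 / 4) ^ (s * s) * sum w {y \<in> S. y \<noteq> x \<and> \<not> R x y} ^ b' \<le> hom_weight (\<lambda>x y. \<not> R x y) b' {y \<in> S. y \<noteq> x \<and> \<not> R x y} \<or>
          (1 / 4) ^ (s * s) * sum w {y \<in> S. y \<noteq> x \<and> \<not> R x y} ^ a \<le> hom_weight R a {y \<in> S. y \<noteq> x \<and> \<not> R x y}"
          by (auto simp: N'_def)
        show "sum w S / 4 \<le> sum w {y \<in> S. y \<noteq> x \<and> \<not> R x y}"
          using N'X[OF x] by (simp add: N'_def \<mu>_def)
      next
        show "S \<subseteq> V" "S - X \<subseteq> S" using Suc.prems(1) by auto
        show "sum w S / 2 \<le> sum w (S - X)" using False split by (simp add: \<mu>_def)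
        show "(1 / 4 :: real) ^ (Suc s * Suc s) \<le> (1 / 4) ^ (s * s) / 4 ^ Suc b'"
          "(1 / 4 :: real) ^ (Suc s * Suc s) \<le> (1 / 4) ^ (s * s) / 4 ^ a"
          by (rule le, use Suc.prems(3) 2 in simp)+
      qed simp
      then show ?thesis using 2 by auto
    qed
  qed
qed

text \<open>An unnormalised expectation of \<open>F\<close> over independent choices
  \<open>z v\<close> from \<open>B v\<close>. The extensional function space makes each tuple occur
  once.\<close>

definition tuple_sum :: "nat set \<Rightarrow> (nat \<Rightarrow> 'a set) \<Rightarrow> ((nat \<Rightarrow> 'a) \<Rightarrow> real) \<Rightarrow> real" where
  "tuple_sum X B F = (\<Sum>z\<in>PiE X B. (\<Prod>v\<in>X. w (z v)) * F z)"

lemma tuple_sum_empty: "tuple_sum {} B F = F (\<lambda>_. undefined)"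
  by (simp add: tuple_sum_def)

lemma tuple_sum_cong:
  "X = X' \<Longrightarrow> (\<And>v. v \<in> X' \<Longrightarrow> B v = B' v) \<Longrightarrow> (\<And>z. z \<in> PiE X' B' \<Longrightarrow> F z = G z) \<Longrightarrow>
    tuple_sum X B F = tuple_sum X' B' G"
  unfolding tuple_sum_def by (intro sum.cong) (auto cong: PiE_cong)

lemma tuple_sum_insert:
  assumes "finite X" "v \<notin> X"
  shows "tuple_sum (insert v X) B F = (\<Sum>x\<in>B v. w x * tuple_sum X B (\<lambda>z. F (z(v := x))))"
proof -
  have "tuple_sum (insert v X) B F
      = (\<Sum>(x, z)\<in>B v \<times> PiE X B. (\<Prod>u\<in>insert v X. w ((z(v := x)) u)) * F (z(v := x)))"
    unfolding tuple_sum_def PiE_insert_eq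
    by (subst sum.reindex) (use inj_combinator[OF assms(2)] in \<open>auto simp: case_prod_unfold\<close>)
  also have "\<dots> = (\<Sum>(x, z)\<in>B v \<times> PiE X B. w x * ((\<Prod>u\<in>X. w (z u)) * F (z(v := x))))"
  proof (rule sum.cong[OF refl])
    fix xz assume "xz \<in> B v \<times> PiE X B"
    obtain x z where xz: "xz = (x, z)" by fastforce
    have "(\<Prod>u\<in>X. w ((z(v := x)) u)) = (\<Prod>u\<in>X. w (z u))"
      using assms by (intro prod.cong) auto
    then show "(case xz of (x, z) \<Rightarrow> (\<Prod>u\<in>insert v X. w ((z(v := x)) u)) * F (z(v := x))) =
       (case xz of (x, z) \<Rightarrow> w x * ((\<Prod>u\<in>X. w (z u)) * F (z(v := x))))"
      using assms by (simp add: xz)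
  qed
  finally show ?thesis
    by (simp add: tuple_sum_def sum.cartesian_product sum_distrib_left)
qed

lemma tuple_sum_filter:
  assumes "finite X" "\<And>v. v \<in> X \<Longrightarrow> finite (B v)"
  shows "tuple_sum X B (\<lambda>z. of_bool (P z \<and> (\<forall>v\<in>X. Q v (z v)))) =
    tuple_sum X (\<lambda>v. {y \<in> B v. Q v y}) (\<lambda>z. of_bool (P z))"
  unfolding tuple_sum_def
proof (rule sum.mono_neutral_cong_right)
  show "finite (PiE X B)" using assms by (rule finite_PiE)
  show "(\<Pi>\<^sub>E v\<in>X. {y \<in> B v. Q v y}) \<subseteq> PiE X B" by (auto simp: PiE_iff)
  show "\<forall>z\<in>PiE X B - (\<Pi>\<^sub>E v\<in>X. {y \<in> B v. Q v y}).
    (\<Prod>v\<in>X. w (z v)) * of_bool (P z \<and> (\<forall>v\<in>X. Q v (z v))) = 0" by (auto simp: PiE_iff)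
  fix z assume "z \<in> (\<Pi>\<^sub>E v\<in>X. {y \<in> B v. Q v y})"
  then have "\<forall>v\<in>X. Q v (z v)" by (auto simp: PiE_iff)
  then show "(\<Prod>v\<in>X. w (z v)) * of_bool (P z \<and> (\<forall>v\<in>X. Q v (z v))) = (\<Prod>v\<in>X. w (z v)) * of_bool (P z)"
    by simp
qed

text \<open>Constraints only link coordinates with the same \<open>\<phi>\<close>, so the sum
  factors over the classes. Fixing one coordinate just shrinks the set of its own class, which is
  the recursion of \<open>hom_weight\<close>; hence \<open>C\<close> is generalised.\<close>

lemma tuple_sum_homogeneous:
  assumes "finite X" "finite I" "\<phi> ` X \<subseteq> I" "\<And>i. C i \<subseteq> V" "\<And>i x y. R i x y \<longleftrightarrow> R i y x"
  shows "tuple_sum X (\<lambda>v. C (\<phi> v))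
      (\<lambda>z. of_bool (\<forall>u\<in>X. \<forall>v\<in>X. u \<noteq> v \<and> \<phi> u = \<phi> v \<longrightarrow> z u \<noteq> z v \<and> R (\<phi> u) (z u) (z v))) =
    (\<Prod>i\<in>I. hom_weight (R i) (card {v \<in> X. \<phi> v = i}) (C i))"
  using assms(1,3,4)
proof (induction X arbitrary: C rule: finite_induct)
  case empty
  then show ?case by (simp add: tuple_sum_empty)
next
  case (insert v X)
  define ok where "ok X z \<longleftrightarrow> (\<forall>u\<in>X. \<forall>v\<in>X. u \<noteq> v \<and> \<phi> u = \<phi> v \<longrightarrow> z u \<noteq> z v \<and> R (\<phi> u) (z u) (z v))"
    for X and z :: "nat \<Rightarrow> 'a"
  define C' where "C' x = C(\<phi> v := {y \<in> C (\<phi> v). y \<noteq> x \<and> R (\<phi> v) x y})" for x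
  define n where "n i = card {u \<in> X. \<phi> u = i}" for i
  have C'V: "C' x i \<subseteq> V" for x i using insert.prems(2) by (auto simp: C'_def)
  have okI: "ok (insert v X) (z(v := x)) \<longleftrightarrow>
      ok X z \<and> (\<forall>u\<in>X. \<phi> u = \<phi> v \<longrightarrow> z u \<noteq> x \<and> R (\<phi> v) x (z u))" for z x
  proof -
    have "ok X (z(v := x)) \<longleftrightarrow> ok X z"
      unfolding ok_def using insert.hyps(2) by (intro ball_cong refl) (metis fun_upd_other)
    moreover have "ok (insert v X) (z(v := x)) \<longleftrightarrow> ok X (z(v := x)) \<and>
        (\<forall>u\<in>X. \<phi> u = \<phi> v \<longrightarrow> z u \<noteq> x \<and> R (\<phi> v) x (z u))"
      unfolding ok_def using insert.hyps(2) assms(5)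
      by auto
    ultimately show ?thesis by blast
  qed
  have "tuple_sum (insert v X) (\<lambda>u. C (\<phi> u)) (\<lambda>z. of_bool (ok (insert v X) z)) =
      (\<Sum>x\<in>C (\<phi> v). w x * (\<Prod>i\<in>I. hom_weight (R i) (n i) (C' x i)))"
    unfolding tuple_sum_insert[OF insert.hyps]
  proof (intro sum.cong refl arg_cong2[where f = "(*)"])
    fix x
    have "tuple_sum X (\<lambda>u. C (\<phi> u)) (\<lambda>z. of_bool (ok (insert v X) (z(v := x)))) =
       tuple_sum X (\<lambda>u. {y \<in> C (\<phi> u). \<phi> u = \<phi> v \<longrightarrow> y \<noteq> x \<and> R (\<phi> v) x y}) (\<lambda>z. of_bool (ok X z))"
      unfolding okI using insert.hyps insert.prems(2) finite_subset[OF _ finite_V]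
      by (intro tuple_sum_filter) auto
    also have "\<dots> = tuple_sum X (\<lambda>u. C' x (\<phi> u)) (\<lambda>z. of_bool (ok X z))"
      by (intro tuple_sum_cong refl) (auto simp: C'_def)
    also have "\<dots> = (\<Prod>i\<in>I. hom_weight (R i) (n i) (C' x i))"
      unfolding ok_def n_def using insert.prems(1) C'V by (intro insert.IH) auto
    finally show "tuple_sum X (\<lambda>u. C (\<phi> u)) (\<lambda>z. of_bool (ok (insert v X) (z(v := x)))) = \<dots>" .
  qed
  also have "\<dots> = (\<Sum>x\<in>C (\<phi> v). w x * hom_weight (R (\<phi> v)) (n (\<phi> v)) {y \<in> C (\<phi> v). y \<noteq> x \<and> R (\<phi> v) x y}) *
      (\<Prod>i\<in>I - {\<phi> v}. hom_weight (R i) (n i) (C i))"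
  proof -
    have "(\<Prod>i\<in>I. hom_weight (R i) (n i) (C' x i)) =
      hom_weight (R (\<phi> v)) (n (\<phi> v)) {y \<in> C (\<phi> v). y \<noteq> x \<and> R (\<phi> v) x y} *
      (\<Prod>i\<in>I - {\<phi> v}. hom_weight (R i) (n i) (C i))" for x
      using insert.prems(1) assms(2) by (subst prod.remove[of I "\<phi> v"]) (auto simp: C'_def)
    then show ?thesis by (simp add: sum_distrib_right mult.assoc)
  qed
  also have "\<dots> = hom_weight (R (\<phi> v)) (Suc (n (\<phi> v))) (C (\<phi> v)) *
      (\<Prod>i\<in>I - {\<phi> v}. hom_weight (R i) (n i) (C i))" by simp
  also have "\<dots> = (\<Prod>i\<in>I. hom_weight (R i) (card {u \<in> insert v X. \<phi> u = i}) (C i))"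
  proof -
    have 1: "card {u \<in> insert v X. \<phi> u = \<phi> v} = Suc (n (\<phi> v))"
    proof -
      have "{u \<in> insert v X. \<phi> u = \<phi> v} = insert v {u \<in> X. \<phi> u = \<phi> v}" by auto
      then show ?thesis using insert.hyps by (simp add: n_def)
    qed
    have 2: "{u \<in> insert v X. \<phi> u = i} = {u \<in> X. \<phi> u = i}" if "i \<noteq> \<phi> v" for i using that by auto
    have "(\<Prod>i\<in>I. hom_weight (R i) (card {u \<in> insert v X. \<phi> u = i}) (C i)) =
        hom_weight (R (\<phi> v)) (card {u \<in> insert v X. \<phi> u = \<phi> v}) (C (\<phi> v)) *
        (\<Prod>i\<in>I - {\<phi> v}. hom_weight (R i) (card {u \<in> insert v X. \<phi> u = i}) (C i))"
      using insert.prems(1) by (intro prod.remove assms) auto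
    also have "(\<Prod>i\<in>I - {\<phi> v}. hom_weight (R i) (card {u \<in> insert v X. \<phi> u = i}) (C i)) =
        (\<Prod>i\<in>I - {\<phi> v}. hom_weight (R i) (n i) (C i))"
      by (intro prod.cong refl) (use 2 in \<open>simp add: n_def\<close>)
    finally show ?thesis unfolding 1 by simp
  qed
  finally show ?case unfolding ok_def .
qed

lemma tuple_sum_add: "tuple_sum X B (\<lambda>z. F z + G z) = tuple_sum X B F + tuple_sum X B G"
  by (simp add: tuple_sum_def distrib_left sum.distrib)

lemma tuple_sum_cmult: "tuple_sum X B (\<lambda>z. c * F z) = c * tuple_sum X B F"
  by (simp add: tuple_sum_def sum_distrib_left mult_ac)

lemma tuple_sum_sum: "tuple_sum X B (\<lambda>z. \<Sum>x\<in>S. F x z) = (\<Sum>x\<in>S. tuple_sum X B (F x))"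
  unfolding tuple_sum_def sum_distrib_left by (rule sum.swap)

lemma tuple_weight_nonneg:
  "(\<And>v. v \<in> X \<Longrightarrow> B v \<subseteq> V) \<Longrightarrow> z \<in> PiE X B \<Longrightarrow> 0 \<le> (\<Prod>v\<in>X. w (z v))"
  by (intro prod_nonneg) (auto simp: PiE_iff subset_iff intro: w_nonneg)

lemma tuple_sum_const:
  assumes "finite X" "\<And>v. v \<in> X \<Longrightarrow> B v \<subseteq> V"
  shows "tuple_sum X B (\<lambda>_. 1) = (\<Prod>v\<in>X. sum w (B v))"
proof -
  have "finite (B v)" if "v \<in> X" for v using assms(2)[OF that] finite_subset[OF _ finite_V] by blast
  then show ?thesis unfolding tuple_sum_def using prod_sum_PiE[of X B "\<lambda>_. w"] assms(1) by simp
qed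

lemma tuple_sum_abs_le:
  assumes "finite X" "\<And>v. v \<in> X \<Longrightarrow> B v \<subseteq> V" "\<And>z. z \<in> PiE X B \<Longrightarrow> \<bar>F z\<bar> \<le> c"
  shows "\<bar>tuple_sum X B F\<bar> \<le> c * (\<Prod>v\<in>X. sum w (B v))"
proof -
  have "\<bar>tuple_sum X B F\<bar> \<le> (\<Sum>z\<in>PiE X B. \<bar>(\<Prod>v\<in>X. w (z v)) * F z\<bar>)"
    unfolding tuple_sum_def by (rule sum_abs)
  also have "\<dots> \<le> (\<Sum>z\<in>PiE X B. (\<Prod>v\<in>X. w (z v)) * c)"
    using tuple_weight_nonneg[OF assms(2)] assms(3)
    by (intro sum_mono) (auto simp: abs_mult intro!: mult_mono)
  also have "\<dots> = c * tuple_sum X B (\<lambda>_. 1)" by (simp add: tuple_sum_def sum_distrib_left mult_ac)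
  finally show ?thesis by (simp add: tuple_sum_const assms)
qed

text \<open>
  Fixing all other coordinates, the constraints in \<open>E\<close> restrict \<open>z u\<close> and \<open>z v\<close> independently of each
  other, so that regularity of \<open>f\<close> applies to a rectangle \<open>S \<times> T\<close>.
\<close>

lemma tuple_sum_swap_pair:
  assumes X: "finite X" "\<And>t. t \<in> X \<Longrightarrow> B t \<subseteq> V" and uv: "u \<in> X" "v \<in> X" "u \<noteq> v"
    and E: "\<And>s t. (s, t) \<in> E \<Longrightarrow> \<not> {u, v} \<subseteq> {s, t}"
    and reg: "\<And>S T. S \<subseteq> B u \<Longrightarrow> T \<subseteq> B v \<Longrightarrow>
      \<bar>wsum (\<lambda>x y. f x y - d) S T\<bar> \<le> \<gamma> * (sum w (B u) * sum w (B v))"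
  shows "\<bar>tuple_sum X B (\<lambda>z. of_bool (\<forall>(s, t)\<in>E. P s t (z s) (z t)) * (f (z u) (z v) - d))\<bar>
    \<le> \<gamma> * (\<Prod>t\<in>X. sum w (B t))"
proof -
  define Y where "Y = X - {u, v}"
  have XY: "X = insert u (insert v Y)" and Y: "finite Y" "u \<notin> insert v Y" "v \<notin> Y"
    using X(1) uv by (auto simp: Y_def)
  define F where "F z = of_bool (\<forall>(s, t)\<in>E. P s t (z s) (z t)) * (f (z u) (z v) - d)" for z
  define G where "G z = (\<Sum>x\<in>B u. \<Sum>y\<in>B v. w x * w y * F (z(v := y, u := x)))" for z
  have "tuple_sum X B F = (\<Sum>x\<in>B u. w x * (\<Sum>y\<in>B v. w y * tuple_sum Y B (\<lambda>z. F (z(v := y, u := x)))))"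
    unfolding XY using Y by (simp add: tuple_sum_insert fun_upd_twist)
  also have "\<dots> = tuple_sum Y B G"
    unfolding G_def tuple_sum_sum tuple_sum_cmult by (simp add: sum_distrib_left mult.assoc)
  finally have eq: "tuple_sum X B F = tuple_sum Y B G" .
  have G: "\<bar>G z\<bar> \<le> \<gamma> * (sum w (B u) * sum w (B v))" for z
  proof -
    \<comment> \<open>No constraint involves both \<open>u\<close> and \<open>v\<close>. Those
      involving neither enter both \<open>S\<close> and \<open>T\<close>, and empty both if
      violated.\<close>
    define S where "S = {x \<in> B u. \<forall>(s, t)\<in>E. v \<notin> {s, t} \<longrightarrow> P s t ((z(u := x)) s) ((z(u := x)) t)}"
    define T where "T = {y \<in> B v. \<forall>(s, t)\<in>E. u \<notin> {s, t} \<longrightarrow> P s t ((z(v := y)) s) ((z(v := y)) t)}"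
    have ok: "(\<forall>(s, t)\<in>E. P s t ((z(v := y, u := x)) s) ((z(v := y, u := x)) t)) \<longleftrightarrow> x \<in> S \<and> y \<in> T"
      if "x \<in> B u" "y \<in> B v" for x y
    proof -
      have "P s t ((z(v := y, u := x)) s) ((z(v := y, u := x)) t) \<longleftrightarrow>
         (v \<notin> {s, t} \<longrightarrow> P s t ((z(u := x)) s) ((z(u := x)) t)) \<and>
         (u \<notin> {s, t} \<longrightarrow> P s t ((z(v := y)) s) ((z(v := y)) t))" if "(s, t) \<in> E" for s t
        using E[OF that] uv(3) by auto
      then show ?thesis unfolding S_def T_def using that by fastforce
    qed
    have "G z = (\<Sum>x\<in>B u. \<Sum>y\<in>B v. if x \<in> S \<and> y \<in> T then w x * w y * (f x y - d) else 0)"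
      unfolding G_def
    proof (intro sum.cong refl)
      fix x y assume "x \<in> B u" "y \<in> B v"
      then show "w x * w y * F (z(v := y, u := x)) = (if x \<in> S \<and> y \<in> T then w x * w y * (f x y - d) else 0)"
        unfolding F_def ok[OF \<open>x \<in> B u\<close> \<open>y \<in> B v\<close>] using uv(3) by simp
    qed
    also have "\<dots> = (\<Sum>x\<in>B u. if x \<in> S then \<Sum>y\<in>B v. if y \<in> T then w x * w y * (f x y - d) else 0 else 0)"
      by (intro sum.cong refl) auto
    also have "\<dots> = wsum (\<lambda>x y. f x y - d) S T"
    proof -
      have fin: "finite (B u)" "finite (B v)"
        using X(2) uv finite_subset[OF _ finite_V] by blast+
      have "B u \<inter> S = S" "B v \<inter> T = T" by (auto simp: S_def T_def)
      then show ?thesis unfolding wsum_def using fin by (simp add: sum.inter_restrict[symmetric])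
    qed
    finally show ?thesis using reg[of S T] by (auto simp: S_def T_def)
  qed
  have "\<bar>tuple_sum Y B G\<bar> \<le> \<gamma> * (sum w (B u) * sum w (B v)) * (\<Prod>t\<in>Y. sum w (B t))"
    using Y X(2) G by (intro tuple_sum_abs_le) (auto simp: XY)
  also have "\<dots> = \<gamma> * (\<Prod>t\<in>X. sum w (B t))"
    unfolding XY using Y by (simp add: mult_ac)
  finally show ?thesis unfolding F_def[symmetric] eq .
qed

text \<open>Impose the pairs of \<open>E\<close> one by one on tuples already satisfying
  \<open>E'\<close>. Replacing an indicator by its density \<open>d'\<close> costs
  \<open>\<gamma>\<close> times the total mass; since \<open>d \<le> 1\<close>, later factors do not
  enlarge earlier errors. Each unordered pair occurs only once, as
  \<open>tuple_sum_swap_pair\<close> requires.\<close>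

lemma tuple_sum_cross_pairs:
  assumes X: "finite X" "\<And>t. t \<in> X \<Longrightarrow> B t \<subseteq> V" and "finite E" and d: "0 \<le> d" "d \<le> 1" "0 \<le> \<gamma>"
    and E: "\<And>u v. (u, v) \<in> E \<Longrightarrow> u \<in> X \<and> v \<in> X \<and> u \<noteq> v"
       "\<And>u v. (u, v) \<in> E \<Longrightarrow> (v, u) \<notin> E" "\<And>u v. (u, v) \<in> E \<Longrightarrow> (u, v) \<notin> E' \<and> (v, u) \<notin> E'"
    and reg: "\<And>u v. (u, v) \<in> E \<Longrightarrow> \<exists>d'\<ge>d. \<forall>S T. S \<subseteq> B u \<longrightarrow> T \<subseteq> B v \<longrightarrow>
      \<bar>wsum (\<lambda>x y. of_bool (P u v x y) - d') S T\<bar> \<le> \<gamma> * (sum w (B u) * sum w (B v))"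
  shows "d ^ card E * tuple_sum X B (\<lambda>z. of_bool (\<forall>(s, t)\<in>E'. P s t (z s) (z t))) -
      real (card E) * \<gamma> * (\<Prod>t\<in>X. sum w (B t))
    \<le> tuple_sum X B (\<lambda>z. of_bool (\<forall>(s, t)\<in>E \<union> E'. P s t (z s) (z t)))"
  using \<open>finite E\<close> E reg
proof (induction E rule: finite_induct)
  case empty
  then show ?case by simp
next
  case (insert e E)
  obtain u v where e: "e = (u, v)" by fastforce
  define H where "H E z = (\<forall>(s, t)\<in>E \<union> E'. P s t (z s) (z t))" for E z
  define t where "t E = tuple_sum X B (\<lambda>z. of_bool (H E z))" for E
  define M where "M = (\<Prod>t\<in>X. sum w (B t))"
  have M: "0 \<le> M" unfolding M_def using X(2) by (intro prod_nonneg sum_w_nonneg)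
  have tn: "0 \<le> t E" for E
    unfolding t_def tuple_sum_def using tuple_weight_nonneg[of X B, OF X(2)] by (intro sum_nonneg mult_nonneg_nonneg) auto
  obtain d' where d': "d \<le> d'" "\<forall>S T. S \<subseteq> B u \<longrightarrow> T \<subseteq> B v \<longrightarrow>
      \<bar>wsum (\<lambda>x y. of_bool (P u v x y) - d') S T\<bar> \<le> \<gamma> * (sum w (B u) * sum w (B v))"
    using insert.prems(4)[of u v] e by auto
  have uv: "u \<in> X" "v \<in> X" "u \<noteq> v" using insert.prems(1)[of u v] e by auto
  have "\<bar>tuple_sum X B (\<lambda>z. of_bool (\<forall>(s, t)\<in>E \<union> E'. P s t (z s) (z t)) * (of_bool (P u v (z u) (z v)) - d'))\<bar> \<le> \<gamma> * M"
    unfolding M_def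
  proof (rule tuple_sum_swap_pair[OF X uv])
    show "\<bar>wsum (\<lambda>x y. of_bool (P u v x y) - d') S T\<bar> \<le> \<gamma> * (sum w (B u) * sum w (B v))"
      if "S \<subseteq> B u" "T \<subseteq> B v" for S T using d'(2) that by simp
    fix a b assume ab: "(a, b) \<in> E \<union> E'"
    show "\<not> {u, v} \<subseteq> {a, b}"
      using ab insert.prems(2)[of u v] insert.prems(3)[of u v] insert.hyps(2) uv(3) e by auto
  qed
  moreover have "t (insert e E) = d' * t E +
      tuple_sum X B (\<lambda>z. of_bool (\<forall>(s, t)\<in>E \<union> E'. P s t (z s) (z t)) * (of_bool (P u v (z u) (z v)) - d'))"
    unfolding t_def tuple_sum_cmult[symmetric] tuple_sum_add[symmetric] H_def[symmetric]
  proof (intro tuple_sum_cong refl)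
    fix z
    have "H (insert e E) z \<longleftrightarrow> H E z \<and> P u v (z u) (z v)" by (auto simp: H_def e)
    then show "of_bool (H (insert e E) z) =
      d' * of_bool (H E z) + of_bool (H E z) * (of_bool (P u v (z u) (z v)) - d')"
      by (simp add: algebra_simps)
  qed
  ultimately have 1: "d' * t E - \<gamma> * M \<le> t (insert e E)" by linarith
  have IH: "d ^ card E * t {} - real (card E) * \<gamma> * M \<le> t E"
    unfolding t_def H_def M_def Un_empty_left
  proof (rule insert.IH)
    fix a b assume "(a, b) \<in> E"
    then have ab: "(a, b) \<in> insert e E" by simp
    show "a \<in> X \<and> b \<in> X \<and> a \<noteq> b" by (rule insert.prems(1)[OF ab])
    show "(b, a) \<notin> E" using insert.prems(2)[OF ab] by simp
    show "(a, b) \<notin> E' \<and> (b, a) \<notin> E'" by (rule insert.prems(3)[OF ab])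
    show "\<exists>d'\<ge>d. \<forall>S T. S \<subseteq> B a \<longrightarrow> T \<subseteq> B b \<longrightarrow>
      \<bar>wsum (\<lambda>x y. of_bool (P a b x y) - d') S T\<bar> \<le> \<gamma> * (sum w (B a) * sum w (B b))"
      by (rule insert.prems(4)[OF ab])
  qed
  have "0 \<le> real (card E) * \<gamma> * M" using d(3) M by (intro mult_nonneg_nonneg) auto
  then have Kd: "d * (real (card E) * \<gamma> * M) \<le> 1 * (real (card E) * \<gamma> * M)"
    using d(2) by (intro mult_right_mono)
  have "d ^ card (insert e E) * t {} - real (card (insert e E)) * \<gamma> * M
      = d * (d ^ card E * t {}) - real (card E) * \<gamma> * M - \<gamma> * M"
    using insert.hyps by (simp add: algebra_simps)
  also have "\<dots> \<le> d * (d ^ card E * t {}) - d * (real (card E) * \<gamma> * M) - \<gamma> * M"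
    using Kd by linarith
  also have "\<dots> = d * (d ^ card E * t {} - real (card E) * \<gamma> * M) - \<gamma> * M"
    by (simp only: right_diff_distrib)
  also have "\<dots> \<le> d * t E - \<gamma> * M" using mult_left_mono[OF IH d(1)] by linarith
  also have "\<dots> \<le> d' * t E - \<gamma> * M" using mult_right_mono[OF d'(1) tn[of E]] by linarith
  also have "\<dots> \<le> t (insert e E)" by (rule 1)
  finally show ?case unfolding t_def H_def M_def Un_empty_left .
qed

end

subsection \<open>Finite graphs\<close>

lemma simple_graph_finite_edges: "simple_graph G \<Longrightarrow> finite (edges G)"
  by (rule finite_subset[of _ "Pow (verts G)"]) (auto simp: simple_graph_def)

lemma simple_graph_no_loop: "simple_graph G \<Longrightarrow> {x} \<notin> edges G"
  by (auto simp: simple_graph_def)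

lemma simple_graph_edgeE:
  assumes "simple_graph G" "e \<in> edges G"
  obtains x y where "e = {x, y}" "x \<noteq> y" "x \<in> verts G" "y \<in> verts G"
proof -
  have "e \<subseteq> verts G" "card e = 2" using assms unfolding simple_graph_def by blast+
  then show ?thesis using that by (auto simp: card_2_iff)
qed

lemma isomorphic_sym: "isomorphic G H \<Longrightarrow> isomorphic H G"
proof -
  assume "isomorphic G H"
  then obtain f where f: "bij_betw f (verts G) (verts H)"
    "\<And>x y. x \<in> verts G \<Longrightarrow> y \<in> verts G \<Longrightarrow> {x, y} \<in> edges G \<longleftrightarrow> {f x, f y} \<in> edges H"
    unfolding isomorphic_def by blast
  define g where "g = inv_into (verts G) f"
  have g: "bij_betw g (verts H) (verts G)" unfolding g_def using f(1) by (rule bij_betw_inv_into)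
  have "f (g y) = y" "g y \<in> verts G" if "y \<in> verts H" for y
    using that f(1) bij_betwE[OF g] by (auto simp: g_def bij_betw_inv_into_right)
  with f(2) g show ?thesis unfolding isomorphic_def by (intro exI[of _ g]) auto
qed

lemma graph_property_iso_iff:
  "graph_property P \<Longrightarrow> simple_graph G \<Longrightarrow> simple_graph H \<Longrightarrow> isomorphic G H \<Longrightarrow> G \<in> P \<longleftrightarrow> H \<in> P"
  using isomorphic_sym unfolding graph_property_def by blast

lemma simple_induced_subgraph:
  "simple_graph G \<Longrightarrow> U \<subseteq> verts G \<Longrightarrow> U \<noteq> {} \<Longrightarrow> simple_graph (induced_subgraph G U)"
  by (auto simp: simple_graph_def induced_subgraph_def finite_subset)

lemma induced_subgraph_hereditary:
  assumes "hereditary P" "G \<in> P" "U \<subseteq> verts G" "U \<noteq> {}"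
  shows "induced_subgraph G U \<in> P"
proof -
  have "verts G - U \<subset> verts G" "verts G - (verts G - U) = U" using assms by auto
  then show ?thesis using assms(1,2) unfolding hereditary_def by metis
qed

lemma induced_subgraph_induced:
  "S \<subseteq> T \<Longrightarrow> induced_subgraph (induced_subgraph G T) S = induced_subgraph G S"
  by (auto simp: induced_subgraph_def)

lemma induced_subgraph_antimono:
  assumes "hereditary P" "induced_subgraph G T \<in> P" "S \<subseteq> T" "S \<noteq> {}"
  shows "induced_subgraph G S \<in> P"
  using induced_subgraph_hereditary[OF assms(1,2), of S] assms(3,4)
  by (simp add: induced_subgraph_induced) (simp add: induced_subgraph_def)

lemma graph_distance_ge:
  assumes "simple_graph G" "simple_graph H" "e \<in> (edges G - edges H) \<union> (edges H - edges G)"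
  shows "(\<Prod>x\<in>e. pmf D x) \<le> graph_distance D G H"
  unfolding graph_distance_def
  using assms(3) simple_graph_finite_edges[OF assms(1)] simple_graph_finite_edges[OF assms(2)]
  by (intro member_le_sum prod_nonneg) auto

text \<open>The right-hand side runs over ordered pairs and so counts each differing edge twice; the
  constants later absorb this. The injection sends an edge to its minimum and maximum.\<close>

lemma graph_distance_le:
  assumes "simple_graph G" "simple_graph H" "verts H = verts G"
  shows "graph_distance D G H \<le>
    (\<Sum>x\<in>verts G. \<Sum>y\<in>verts G. pmf D x * pmf D y * of_bool (({x, y} \<in> edges G) \<noteq> ({x, y} \<in> edges H)))"
proof -
  let ?V = "verts G"
  define S where "S = (edges G - edges H) \<union> (edges H - edges G)"
  define h :: "nat set \<Rightarrow> nat \<times> nat" where "h e = (Min e, Max e)" for e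
  define F where "F = (\<lambda>(x, y). pmf D x * pmf D y * of_bool (({x, y} \<in> edges G) \<noteq> ({x, y} \<in> edges H)))"
  have h: "{fst (h e), snd (h e)} = e \<and> fst (h e) \<noteq> snd (h e) \<and> h e \<in> ?V \<times> ?V" if "e \<in> S" for e
  proof -
    have "\<exists>x y. e = {x, y} \<and> x \<noteq> y \<and> x \<in> ?V \<and> y \<in> ?V"
    proof -
      have "e \<in> edges G \<or> e \<in> edges H" using that by (auto simp: S_def)
      then show ?thesis
      proof
        assume "e \<in> edges G"
        from simple_graph_edgeE[OF assms(1) this] show ?thesis by metis
      next
        assume "e \<in> edges H"
        from simple_graph_edgeE[OF assms(2) this] show ?thesis unfolding assms(3) by metis
      qed
    qed
    then obtain x y where "e = {x, y}" "x \<noteq> y" "x \<in> ?V" "y \<in> ?V" by blast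
    then show ?thesis by (cases "x < y") (auto simp: h_def)
  qed
  have "inj_on h S" by (rule inj_onI) (metis h)
  have "graph_distance D G H = (\<Sum>e\<in>S. F (h e))"
    unfolding graph_distance_def S_def[symmetric]
  proof (rule sum.cong[OF refl])
    fix e assume e: "e \<in> S"
    obtain x y where xy: "h e = (x, y)" by fastforce
    with h[OF e] have exy: "{x, y} = e" "x \<noteq> y" by auto
    have "(\<Prod>x\<in>e. pmf D x) = pmf D x * pmf D y" unfolding exy(1)[symmetric] using exy(2) by simp
    moreover have "(e \<in> edges G) \<noteq> (e \<in> edges H)" using e unfolding S_def by blast
    ultimately show "(\<Prod>x\<in>e. pmf D x) = F (h e)" unfolding xy F_def prod.case exy(1) by simp
  qed
  also have "\<dots> = sum F (h ` S)" using \<open>inj_on h S\<close> by (simp add: sum.reindex)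
  also have "\<dots> \<le> sum F (?V \<times> ?V)"
  proof (rule sum_mono2)
    show "finite (?V \<times> ?V)" using assms(1) by (simp add: simple_graph_def)
    show "h ` S \<subseteq> ?V \<times> ?V" using h by blast
  qed (simp add: F_def case_prod_unfold)
  finally show ?thesis by (simp add: F_def sum.cartesian_product)
qed

subsection \<open>Testable properties are hereditary and extendable\<close>

text \<open>All samples lie in \<open>U\<close>, so every query gets the same answer in both
  graphs.\<close>

lemma run_cong:
  assumes "set_pmf D \<subseteq> U" "\<And>x y. x \<in> U \<Longrightarrow> y \<in> U \<Longrightarrow> {x, y} \<in> edges G \<longleftrightarrow> {x, y} \<in> edges H"
  shows "set xs \<subseteq> U \<Longrightarrow> run A G D xs n = run A H D xs n"
proof (induction A arbitrary: xs n)
  case (Sample k)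
  then show ?case using assms(1) by (auto intro!: bind_pmf_cong)
next
  case (Query i j k)
  have "{xs ! i, xs ! j} \<in> edges G \<longleftrightarrow> {xs ! i, xs ! j} \<in> edges H"
    if "i < length xs" "j < length xs" using that Query.prems by (intro assms(2)) auto
  then have "(i < length xs \<and> j < length xs \<and> {xs ! i, xs ! j} \<in> edges G) =
     (i < length xs \<and> j < length xs \<and> {xs ! i, xs ! j} \<in> edges H)" by blast
  then show ?case using Query by (simp del: conj_assoc)
qed (auto intro!: bind_pmf_cong)

lemma reject_prob_eq: "reject_prob A G D = 1 - accept_prob A G D"
proof -
  have "{r. \<not> fst r} = UNIV - {r :: bool \<times> nat. fst r}" by auto
  then show ?thesis
    unfolding reject_prob_def accept_prob_def
    using measure_pmf.prob_compl[of "{r. fst r}" "execution A G D"] by simp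
qed

lemma testable_completion:
  assumes "graph_property P" "vdf_testable P" "G \<in> P" "simple_graph H" "U \<noteq> {}"
    "U \<subseteq> verts G" "U \<subseteq> verts H"
    "\<And>x y. x \<in> U \<Longrightarrow> y \<in> U \<Longrightarrow> {x, y} \<in> edges G \<longleftrightarrow> {x, y} \<in> edges H"
  shows "\<exists>H'\<in>P. verts H' = verts H \<and> (\<forall>e\<subseteq>U. e \<in> edges H' \<longleftrightarrow> e \<in> edges H)"
proof -
  obtain T where T: "tester P T" using assms(2) unfolding vdf_testable_def by blast
  define D where "D = pmf_of_set U"
  \<comment> \<open>The \<open>+ 1\<close> keeps \<open>\<epsilon>\<close> below \<open>1\<close>
    also when \<open>U\<close> is a single vertex.\<close>
  define \<epsilon> :: real where "\<epsilon> = 1 / (real (card U) + 1)\<^sup>2"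
  have G: "simple_graph G" using assms(1,3) by (auto simp: graph_property_def)
  then have fin: "finite U" using assms(6) finite_subset by (auto simp: simple_graph_def)
  then have card: "0 < card U" using assms(5) by (simp add: card_gt_0_iff)
  have "1 < (real (card U) + 1)\<^sup>2" using card by (intro one_less_power) auto
  then have \<epsilon>: "\<epsilon> \<in> {0<..<1}" unfolding \<epsilon>_def greaterThanLessThan_iff by (intro conjI) (simp, subst divide_less_eq_1, linarith)
  have D: "set_pmf D = U" using fin assms(5) by (simp add: D_def)
  have wG: "weighted_graph G D" "weighted_graph H D"
    using G assms(4,6,7) by (auto simp: weighted_graph_def D)
  have "execution (T \<epsilon>) G D = execution (T \<epsilon>) H D"
    unfolding execution_def by (rule run_cong[of _ U]) (use assms D in auto)
  then have "accept_prob (T \<epsilon>) G D = accept_prob (T \<epsilon>) H D" by (simp add: accept_prob_def)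
  moreover have "2 / 3 \<le> accept_prob (T \<epsilon>) G D"
    using T \<epsilon> wG(1) assms(3) unfolding tester_def by blast
  ultimately have "\<not> 2 / 3 \<le> reject_prob (T \<epsilon>) H D" by (simp add: reject_prob_eq)
  then have "\<not> far \<epsilon> H D P" using T \<epsilon> wG(2) unfolding tester_def by blast
  then obtain H' where H': "H' \<in> P" "verts H' = verts H" "graph_distance D H H' < \<epsilon>"
    unfolding far_def by auto
  have sH': "simple_graph H'" using assms(1) H'(1) by (auto simp: graph_property_def)
  \<comment> \<open>A single disagreement inside \<open>U\<close> would already cost
    \<open>1 / (card U)\<^sup>2\<close>, which is not below \<open>\<epsilon>\<close>.\<close>
  have "e \<in> edges H' \<longleftrightarrow> e \<in> edges H" if e: "e \<subseteq> U" for e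
  proof (rule ccontr)
    assume *: "\<not> ?thesis"
    then have "e \<in> (edges H - edges H') \<union> (edges H' - edges H)" by auto
    from graph_distance_ge[OF assms(4) sH' this, of D] H'(3)
    have "(\<Prod>x\<in>e. pmf D x) < \<epsilon>" by linarith
    moreover have "card e = 2" using * sH' assms(4) by (auto simp: simple_graph_def)
    moreover have "(\<Prod>x\<in>e. pmf D x) = (\<Prod>x\<in>e. 1 / real (card U))"
      using e fin assms(5) by (intro prod.cong) (auto simp: D_def)
    ultimately have "1 / (real (card U))\<^sup>2 < 1 / (real (card U) + 1)\<^sup>2"
      by (simp add: \<epsilon>_def power_divide)
    moreover have "1 / (real (card U) + 1)\<^sup>2 \<le> 1 / (real (card U))\<^sup>2"
      using card by (intro divide_left_mono power_mono) auto
    ultimately show False by linarith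
  qed
  with H' show ?thesis by blast
qed

lemma testable_imp_hereditary:
  assumes "graph_property P" "vdf_testable P"
  shows "hereditary P"
  unfolding hereditary_def
proof (intro ballI allI impI)
  fix G S assume G: "G \<in> P" "S \<subset> verts G"
  define U where "U = verts G - S"
  have sG: "simple_graph G" using assms(1) G(1) by (auto simp: graph_property_def)
  have U: "U \<subseteq> verts G" "U \<noteq> {}" using G(2) by (auto simp: U_def)
  let ?H = "induced_subgraph G U"
  have sH: "simple_graph ?H" by (rule simple_induced_subgraph[OF sG U])
  have vH: "verts ?H = U" by (simp add: induced_subgraph_def)
  have "\<exists>H'\<in>P. verts H' = verts ?H \<and> (\<forall>e\<subseteq>U. e \<in> edges H' \<longleftrightarrow> e \<in> edges ?H)"
    using testable_completion[OF assms G(1) sH U(2,1)] vH by (auto simp: induced_subgraph_def)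
  then obtain H' where H': "H' \<in> P" "verts H' = U" "\<And>e. e \<subseteq> U \<Longrightarrow> e \<in> edges H' \<longleftrightarrow> e \<in> edges ?H"
    using vH by auto
  have "simple_graph H'" using assms(1) H'(1) by (auto simp: graph_property_def)
  then have "e \<subseteq> U" if "e \<in> edges H' \<or> e \<in> edges ?H" for e
    using that sH unfolding simple_graph_def H'(2) vH by auto
  then have "edges H' = edges ?H" using H'(3) by blast
  with H'(1,2) vH have "?H = H'" by (metis (full_types) graph.equality old.unit.exhaust)
  with H'(1) show "induced_subgraph G (verts G - S) \<in> P" by (simp add: U_def)
qed

lemma testable_imp_extendable:
  assumes "graph_property P" "vdf_testable P"
  shows "extendable P"
  unfolding extendable_def
proof (intro ballI)
  fix G assume G: "G \<in> P"
  have sG: "simple_graph G" using assms(1) G by (auto simp: graph_property_def)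
  obtain v where v: "v \<notin> verts G" using sG ex_new_if_finite[of "verts G"] by (auto simp: simple_graph_def)
  let ?H = "\<lparr>verts = insert v (verts G), edges = edges G\<rparr>"
  have "simple_graph ?H" using sG by (auto simp: simple_graph_def)
  from testable_completion[OF assms G this, of "verts G"]
  obtain H' where H': "H' \<in> P" "verts H' = insert v (verts G)"
    "\<And>e. e \<subseteq> verts G \<Longrightarrow> e \<in> edges H' \<longleftrightarrow> e \<in> edges G"
    using sG by (auto simp: simple_graph_def)
  have "card (verts H') = card (verts G) + 1" using H'(2) v sG by (simp add: simple_graph_def)
  moreover have "isomorphic G (induced_subgraph H' (verts G))"
    unfolding isomorphic_def by (intro exI[of _ id]) (auto simp: induced_subgraph_def H'(3))
  ultimately show "\<exists>H\<in>P. card (verts H) = card (verts G) + 1 \<and>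
      (\<exists>U\<subseteq>verts H. isomorphic G (induced_subgraph H U))"
    using H'(1,2) by (intro bexI[of _ H']) auto
qed

subsection \<open>Extending a graph to a prescribed vertex set\<close>

text \<open>\<open>extendable\<close> provides a larger member only up to isomorphism and on
  arbitrary vertices. Pulling it back along \<open>g\<close>, which sends \<open>v\<close> to the
  one vertex outside the copy of \<open>G\<close>, gives an extension of \<open>G\<close>
  itself.\<close>

lemma extendable_insert:
  assumes "graph_property P" "extendable P" "G \<in> P" "v \<notin> verts G"
  shows "\<exists>H\<in>P. verts H = insert v (verts G) \<and>
    (\<forall>x\<in>verts G. \<forall>y\<in>verts G. {x, y} \<in> edges H \<longleftrightarrow> {x, y} \<in> edges G)"
proof -
  have sG: "simple_graph G" using assms(1,3) by (auto simp: graph_property_def)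
  obtain H0 U where H0: "H0 \<in> P" "card (verts H0) = card (verts G) + 1" "U \<subseteq> verts H0"
    "isomorphic G (induced_subgraph H0 U)"
    using assms(2,3) unfolding extendable_def by blast
  have sH0: "simple_graph H0" using assms(1) H0(1) by (auto simp: graph_property_def)
  obtain f where f: "bij_betw f (verts G) U"
    "\<And>x y. x \<in> verts G \<Longrightarrow> y \<in> verts G \<Longrightarrow> {x, y} \<in> edges G \<longleftrightarrow> {f x, f y} \<in> edges (induced_subgraph H0 U)"
    using H0(4) unfolding isomorphic_def by (auto simp: induced_subgraph_def)
  have fU: "f x \<in> U" if "x \<in> verts G" for x using f(1) that by (rule bij_betwE[rule_format])
  have "card (verts H0 - U) = 1"
    using bij_betw_same_card[OF f(1)] H0(2,3) sH0
    by (subst card_Diff_subset) (auto simp: simple_graph_def finite_subset)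
  then obtain a where a: "verts H0 - U = {a}" by (auto simp: card_1_singleton_iff)
  define W where "W = insert v (verts G)"
  define g where "g = f(v := a)"
  have gf: "g x = f x" if "x \<in> verts G" for x using that assms(4) by (auto simp: g_def)
  have "bij_betw g (verts G) U" using f(1) gf by (subst bij_betw_cong[of _ _ f]) auto
  then have "bij_betw g (verts G \<union> {v}) (U \<union> {a})"
    using assms(4) a by (intro bij_betw_combine) (auto simp: g_def)
  moreover have "U \<union> {a} = verts H0" using a H0(3) by auto
  ultimately have g: "bij_betw g W (verts H0)" by (simp add: W_def)
  then have inj: "g x = g y \<longleftrightarrow> x = y" if "x \<in> W" "y \<in> W" for x y
    using that by (auto simp: bij_betw_def inj_on_def)
  define H where "H = \<lparr>verts = W, edges = {e. \<exists>x\<in>W. \<exists>y\<in>W. e = {x, y} \<and> {g x, g y} \<in> edges H0}\<rparr>"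
  have eH: "{x, y} \<in> edges H \<longleftrightarrow> {g x, g y} \<in> edges H0" if "x \<in> W" "y \<in> W" for x y
    using that by (auto simp: H_def doubleton_eq_iff insert_commute)
  have "simple_graph H"
  proof -
    have "e \<subseteq> W \<and> card e = 2" if e: "e \<in> edges H" for e
    proof -
      obtain x y where xy: "x \<in> W" "y \<in> W" "e = {x, y}" "{g x, g y} \<in> edges H0"
        using e by (auto simp: H_def)
      moreover have "x \<noteq> y" using xy(4) simple_graph_no_loop[OF sH0, of "g x"] by auto
      ultimately show ?thesis by simp
    qed
    then show ?thesis using sG by (simp add: simple_graph_def) (simp add: H_def W_def)
  qed
  moreover have "isomorphic H H0"
    unfolding isomorphic_def using g eH by (intro exI[of _ g]) (auto simp: H_def)
  ultimately have "H \<in> P" using graph_property_iso_iff[OF assms(1) _ sH0] H0(1) by blast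
  moreover have "{x, y} \<in> edges H \<longleftrightarrow> {x, y} \<in> edges G" if "x \<in> verts G" "y \<in> verts G" for x y
    using that fU eH[of x y] f(2)[OF that] by (auto simp: gf induced_subgraph_def W_def)
  ultimately show ?thesis by (intro bexI[of _ H]) (auto simp: H_def W_def)
qed

lemma extendable_superset:
  assumes "graph_property P" "extendable P" "finite W" "G \<in> P"
  shows "\<exists>H\<in>P. verts H = verts G \<union> W \<and>
    (\<forall>x\<in>verts G. \<forall>y\<in>verts G. {x, y} \<in> edges H \<longleftrightarrow> {x, y} \<in> edges G)"
  using assms(3)
proof (induction W rule: finite_induct)
  case empty
  then show ?case using assms(4) by auto
next
  case (insert v W)
  then obtain H where H: "H \<in> P" "verts H = verts G \<union> W"
    "\<forall>x\<in>verts G. \<forall>y\<in>verts G. {x, y} \<in> edges H \<longleftrightarrow> {x, y} \<in> edges G" by blast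
  show ?case
  proof (cases "v \<in> verts H")
    case True
    then have "verts H = verts G \<union> insert v W" using H(2) by auto
    with H show ?thesis by blast
  next
    case False
    from extendable_insert[OF assms(1,2) H(1) this]
    obtain H' where H': "H' \<in> P" "verts H' = insert v (verts H)"
      "\<forall>x\<in>verts H. \<forall>y\<in>verts H. {x, y} \<in> edges H' \<longleftrightarrow> {x, y} \<in> edges H" by blast
    have "verts H' = verts G \<union> insert v W" using H'(2) H(2) by auto
    moreover have "\<forall>x\<in>verts G. \<forall>y\<in>verts G. {x, y} \<in> edges H' \<longleftrightarrow> {x, y} \<in> edges G"
      using H'(3) H(2,3) by blast
    ultimately show ?thesis using H'(1) by blast
  qed
qed

subsection \<open>The tester that inspects the subgraph induced by a sample\<close>

primrec sample_all :: "nat \<Rightarrow> nat list \<Rightarrow> (nat list \<Rightarrow> algorithm) \<Rightarrow> algorithm" where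
  "sample_all 0 ps k = k ps"
| "sample_all (Suc m) ps k = Sample (\<lambda>p. sample_all m (ps @ [p]) k)"

primrec query_all :: "(nat \<times> nat) list \<Rightarrow> (nat \<times> nat) set \<Rightarrow> ((nat \<times> nat) set \<Rightarrow> algorithm) \<Rightarrow> algorithm" where
  "query_all [] E k = k E"
| "query_all (q # qs) E k = Query (fst q) (snd q) (\<lambda>b. query_all qs (if b then insert q E else E) k)"

text \<open>Positions of first occurrences stand for the unseen vertex names, so repeated samples
  are merged.\<close>

definition position_graph :: "nat list \<Rightarrow> (nat \<times> nat) set \<Rightarrow> graph" where
  "position_graph ps E = \<lparr>verts = set ps, edges = {{i, j} | i j. i \<in> set ps \<and> j \<in> set ps \<and> (i, j) \<in> E}\<rparr>"

definition induced_tester :: "graph set \<Rightarrow> nat \<Rightarrow> algorithm" where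
  "induced_tester P m = sample_all m [] (\<lambda>ps.
     query_all (List.product [0..<m] [0..<m]) {} (\<lambda>E. Output (position_graph ps E \<in> P)))"

lemma first_position_append_Cons: "first_position (xs @ x # ys) x = first_position xs x"
  unfolding first_position_def by (induction xs) auto

lemma first_position_append: "x \<in> set xs \<Longrightarrow> first_position (xs @ ys) x = first_position xs x"
  by (auto simp: first_position_def takeWhile_append)

lemma first_position_nth:
  assumes "x \<in> set xs"
  shows "first_position xs x < length xs" "xs ! first_position xs x = x"
proof -
  show "first_position xs x < length xs"
    unfolding first_position_def using assms by (induction xs) auto
  then show "xs ! first_position xs x = x"
    unfolding first_position_def using nth_length_takeWhile by blast
qed

text \<open>Appending samples does not change the first position of an earlier one, so the reports
  collected so far are those of the full list.\<close>

lemma run_sample_all: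
  "run (sample_all m (map (first_position xs) xs) k) G D xs n =
    replicate_pmf m D \<bind> (\<lambda>ys. run (k (map (first_position (xs @ ys)) (xs @ ys))) G D (xs @ ys) (n + m))"
proof (induction m arbitrary: xs n)
  case 0
  then show ?case by (simp add: bind_return_pmf)
next
  case (Suc m)
  have "map (first_position xs) xs @ [first_position xs x] = map (first_position (xs @ [x])) (xs @ [x])" for x
    by (simp add: first_position_append first_position_append_Cons)
  then show ?case
    by (simp add: Suc.IH bind_assoc_pmf bind_return_pmf del: map_append)
qed

lemma run_query_all:
  "run (query_all qs E k) G D xs n =
    run (k (E \<union> {(i, j) \<in> set qs. i < length xs \<and> j < length xs \<and> {xs ! i, xs ! j} \<in> edges G})) G D xs
      (n + length qs)"
proof (induction qs arbitrary: E n)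
  case Nil
  then show ?case by simp
next
  case (Cons q qs)
  let ?b = "fst q < length xs \<and> snd q < length xs \<and> {xs ! fst q, xs ! snd q} \<in> edges G"
  have "(if ?b then insert q E else E) \<union> {(i, j) \<in> set qs. i < length xs \<and> j < length xs \<and> {xs ! i, xs ! j} \<in> edges G}
    = E \<union> {(i, j) \<in> set (q # qs). i < length xs \<and> j < length xs \<and> {xs ! i, xs ! j} \<in> edges G}"
    by (cases q) auto
  then show ?case by (simp add: Cons.IH del: set_simps)
qed

text \<open>On sampled vertices \<open>first_position xs\<close> is injective, with lookup in
  \<open>xs\<close> as inverse, and is an isomorphism onto the position graph.\<close>

lemma position_graph_iff:
  assumes "graph_property P" "simple_graph G" "set xs \<subseteq> verts G" "xs \<noteq> []"
  shows "position_graph (map (first_position xs) xs)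
      {(i, j) \<in> set (List.product [0..<length xs] [0..<length xs]).
         i < length xs \<and> j < length xs \<and> {xs ! i, xs ! j} \<in> edges G} \<in> P \<longleftrightarrow>
    induced_subgraph G (set xs) \<in> P" (is "?H \<in> P \<longleftrightarrow> ?I \<in> P")
proof -
  let ?f = "first_position xs"
  have f: "?f x < length xs" "xs ! ?f x = x" if "x \<in> set xs" for x
    using first_position_nth[OF that] by auto
  have vH: "verts ?H = ?f ` set xs" by (simp add: position_graph_def)
  have eH: "edges ?H = {{?f x, ?f y} | x y. x \<in> set xs \<and> y \<in> set xs \<and> {x, y} \<in> edges G}"
  proof (intro set_eqI iffI)
    fix e assume "e \<in> edges ?H"
    then obtain i j where e: "e = {i, j}" "i \<in> ?f ` set xs" "j \<in> ?f ` set xs" "{xs ! i, xs ! j} \<in> edges G"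
      unfolding position_graph_def by auto
    then obtain x y where "i = ?f x" "x \<in> set xs" "j = ?f y" "y \<in> set xs" by blast
    with e(1,4) show "e \<in> {{?f x, ?f y} | x y. x \<in> set xs \<and> y \<in> set xs \<and> {x, y} \<in> edges G}"
      by (auto simp: f)
  next
    fix e assume "e \<in> {{?f x, ?f y} | x y. x \<in> set xs \<and> y \<in> set xs \<and> {x, y} \<in> edges G}"
    then obtain x y where "e = {?f x, ?f y}" "x \<in> set xs" "y \<in> set xs" "{x, y} \<in> edges G" by blast
    then show "e \<in> edges ?H"
      unfolding position_graph_def
      by (simp, intro exI[of _ "?f x"] exI[of _ "?f y"]) (simp add: f)
  qed
  have inj: "inj_on ?f (set xs)" by (rule inj_onI) (metis f(2))
  have sI: "simple_graph ?I" using assms by (intro simple_induced_subgraph) auto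
  have "simple_graph ?H"
  proof -
    have "card {?f x, ?f y} = 2" if "x \<in> set xs" "y \<in> set xs" "{x, y} \<in> edges G" for x y
    proof -
      have "x \<noteq> y" using that(3) simple_graph_no_loop[OF assms(2), of x] by auto
      then have "?f x \<noteq> ?f y" using inj that by (auto dest: inj_onD)
      then show ?thesis by simp
    qed
    then show ?thesis unfolding simple_graph_def vH eH using assms(4) by auto
  qed
  moreover have "isomorphic ?I ?H"
    unfolding isomorphic_def
  proof (intro exI[of _ ?f] conjI ballI)
    show "bij_betw ?f (verts ?I) (verts ?H)"
      unfolding vH using inj by (simp add: bij_betw_def induced_subgraph_def)
    fix x y assume "x \<in> verts ?I" "y \<in> verts ?I"
    then have xy: "x \<in> set xs" "y \<in> set xs" by (auto simp: induced_subgraph_def)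
    show "{x, y} \<in> edges ?I \<longleftrightarrow> {?f x, ?f y} \<in> edges ?H"
    proof
      assume "{x, y} \<in> edges ?I"
      then show "{?f x, ?f y} \<in> edges ?H" using xy unfolding eH by (auto simp: induced_subgraph_def)
    next
      assume "{?f x, ?f y} \<in> edges ?H"
      then obtain x' y' where "x' \<in> set xs" "y' \<in> set xs" "{x', y'} \<in> edges G" "{?f x, ?f y} = {?f x', ?f y'}"
        unfolding eH by auto
      then have "{x, y} = {x', y'}" using xy inj unfolding doubleton_eq_iff inj_on_def by metis
      with \<open>{x', y'} \<in> edges G\<close> have "{x, y} \<in> edges G" by simp
      with xy show "{x, y} \<in> edges ?I" by (simp add: induced_subgraph_def)
    qed
  qed
  ultimately show ?thesis using graph_property_iso_iff[OF assms(1) sI] by blast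
qed

lemma execution_induced_tester:
  assumes "graph_property P" "weighted_graph G D" "0 < m"
  shows "execution (induced_tester P m) G D =
    map_pmf (\<lambda>xs. (induced_subgraph G (set xs) \<in> P, m + m * m)) (replicate_pmf m D)"
proof -
  have "execution (induced_tester P m) G D =
    replicate_pmf m D \<bind> (\<lambda>ys. return_pmf (position_graph (map (first_position ys) ys)
      {(i, j) \<in> set (List.product [0..<m] [0..<m]).
         i < length ys \<and> j < length ys \<and> {ys ! i, ys ! j} \<in> edges G} \<in> P, m + m * m))"
    unfolding execution_def induced_tester_def
    using run_sample_all[of m "[]" _ G D 0] by (simp add: run_query_all)
  also have "\<dots> = replicate_pmf m D \<bind> (\<lambda>ys. return_pmf (induced_subgraph G (set ys) \<in> P, m + m * m))"
  proof (rule bind_pmf_cong[OF refl])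
    fix ys assume "ys \<in> set_pmf (replicate_pmf m D)"
    then have "length ys = m" "set ys \<subseteq> verts G"
      using assms(2) by (auto simp: set_replicate_pmf weighted_graph_def)
    moreover from this assms(3) have "ys \<noteq> []" by auto
    ultimately show "return_pmf (position_graph (map (first_position ys) ys)
      {(i, j) \<in> set (List.product [0..<m] [0..<m]).
         i < length ys \<and> j < length ys \<and> {ys ! i, ys ! j} \<in> edges G} \<in> P, m + m * m) =
      return_pmf (induced_subgraph G (set ys) \<in> P, m + m * m)"
      using position_graph_iff[OF assms(1), of G ys] assms(2) by (simp add: weighted_graph_def)
  qed
  finally show ?thesis by (simp add: map_pmf_def)
qed

definition sample_ok :: "graph set \<Rightarrow> nat \<Rightarrow> graph \<Rightarrow> nat pmf \<Rightarrow> real" where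
  "sample_ok P m G D = measure_pmf.prob (replicate_pmf m D) {xs. induced_subgraph G (set xs) \<in> P}"

lemma accept_induced_tester:
  assumes "graph_property P" "weighted_graph G D" "0 < m"
  shows "accept_prob (induced_tester P m) G D = sample_ok P m G D"
  unfolding accept_prob_def execution_induced_tester[OF assms] sample_ok_def
  by (simp add: vimage_def)

lemma replicate_pmf_add:
  "replicate_pmf (m + n) D = map_pmf (\<lambda>(xs, ys). xs @ ys) (pair_pmf (replicate_pmf m D) (replicate_pmf n D))"
  by (simp add: replicate_pmf_distrib pair_pmf_def map_pmf_def bind_assoc_pmf bind_return_pmf)

text \<open>The first \<open>m\<close> samples of a longer run are themselves a sample, and heredity
  passes to the subgraph they induce.\<close>

lemma sample_ok_antimono:
  assumes "hereditary P" "0 < m" "m \<le> n"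
  shows "sample_ok P n G D \<le> sample_ok P m G D"
proof -
  obtain k where n: "n = m + k" using assms(3) le_Suc_ex by blast
  let ?Q = "pair_pmf (replicate_pmf m D) (replicate_pmf k D)"
  have "sample_ok P n G D = measure_pmf.prob ?Q {(xs, ys). induced_subgraph G (set xs \<union> set ys) \<in> P}"
    unfolding sample_ok_def n replicate_pmf_add by (simp add: vimage_def case_prod_unfold)
  also have "\<dots> \<le> measure_pmf.prob ?Q {p. induced_subgraph G (set (fst p)) \<in> P}"
  proof (rule measure_pmf.finite_measure_mono_AE[OF AE_pmfI[OF impI]])
    fix p assume "p \<in> set_pmf ?Q" "p \<in> {(xs, ys). induced_subgraph G (set xs \<union> set ys) \<in> P}"
    then have "induced_subgraph G (set (fst p) \<union> set (snd p)) \<in> P" "length (fst p) = m"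
      by (auto simp: set_replicate_pmf)
    then show "p \<in> {p. induced_subgraph G (set (fst p)) \<in> P}"
      using induced_subgraph_antimono[OF assms(1), of G _ "set (fst p)"] assms(2) by auto
  qed simp
  also have "\<dots> = measure_pmf.prob (map_pmf fst ?Q) {xs. induced_subgraph G (set xs) \<in> P}"
    by (simp add: vimage_def)
  also have "\<dots> = sample_ok P m G D" unfolding map_fst_pair_pmf sample_ok_def ..
  finally show ?thesis .
qed

lemma prob_pair_pmf_Times:
  "measure_pmf.prob (pair_pmf M N) (S \<times> T) = measure_pmf.prob M S * measure_pmf.prob N T"
proof -
  have "emeasure (pair_pmf M N) (S \<times> T) = (\<integral>\<^sup>+x. indicator (S \<times> T) x \<partial>pair_pmf M N)"
    by simp
  also have "\<dots> = (\<integral>\<^sup>+a. \<integral>\<^sup>+b. indicator S a * indicator T b \<partial>N \<partial>M)"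
    by (simp add: nn_integral_pair_pmf' indicator_times)
  also have "\<dots> = emeasure M S * emeasure N T"
    by (simp add: nn_integral_cmult nn_integral_multc)
  finally show ?thesis
    by (simp add: measure_pmf.emeasure_eq_measure ennreal_mult[symmetric])
qed

text \<open>A sample of size \<open>t * m\<close> consists of \<open>t\<close> independent blocks,
  all of which are good if the whole is. The case \<open>xs = []\<close> makes the claim true for
  \<open>t = 0\<close>.\<close>

lemma sample_ok_power:
  assumes "hereditary P" "0 < m"
  shows "measure_pmf.prob (replicate_pmf (t * m) D) {xs. xs = [] \<or> induced_subgraph G (set xs) \<in> P} \<le>
    sample_ok P m G D ^ t"
proof (induction t)
  case 0
  then show ?case by simp
next
  case (Suc t)
  let ?Q = "pair_pmf (replicate_pmf m D) (replicate_pmf (t * m) D)"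
  let ?S = "{xs. induced_subgraph G (set xs) \<in> P}"
  let ?T = "{xs. xs = [] \<or> induced_subgraph G (set xs) \<in> P}"
  have "measure_pmf.prob (replicate_pmf (Suc t * m) D) ?T =
      measure_pmf.prob ?Q {(xs, ys). xs @ ys = [] \<or> induced_subgraph G (set xs \<union> set ys) \<in> P}"
    unfolding mult_Suc replicate_pmf_add by (simp add: vimage_def case_prod_unfold)
  also have "\<dots> \<le> measure_pmf.prob ?Q (?S \<times> ?T)"
  proof (rule measure_pmf.finite_measure_mono_AE[OF AE_pmfI[OF impI]])
    fix p assume "p \<in> set_pmf ?Q"
      "p \<in> {(xs, ys). xs @ ys = [] \<or> induced_subgraph G (set xs \<union> set ys) \<in> P}"
    then obtain xs ys where p: "p = (xs, ys)" "xs @ ys = [] \<or> induced_subgraph G (set xs \<union> set ys) \<in> P"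
      "length xs = m" by (auto simp: set_replicate_pmf)
    then have "xs \<noteq> []" "induced_subgraph G (set xs \<union> set ys) \<in> P" using assms(2) by auto
    then show "p \<in> ?S \<times> ?T"
      using induced_subgraph_antimono[OF assms(1), of G _ "set xs"]
        induced_subgraph_antimono[OF assms(1), of G _ "set ys"] p(1) by auto
  qed simp
  also have "\<dots> = sample_ok P m G D * measure_pmf.prob (replicate_pmf (t * m) D) ?T"
    unfolding sample_ok_def by (rule prob_pair_pmf_Times)
  also have "\<dots> \<le> sample_ok P m G D * sample_ok P m G D ^ t"
    using Suc.IH by (intro mult_left_mono) (auto simp: sample_ok_def)
  finally show ?case by simp
qed

text \<open>By heredity members of \<open>P\<close> are always accepted. With one-sided error any
  positive rejection probability can be amplified by a larger sample.\<close>

lemma testable_if_sample_gap: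
  assumes P: "graph_property P" "hereditary P"
    and gap: "\<And>\<epsilon>. \<epsilon> \<in> {0<..<1} \<Longrightarrow> \<exists>m>0. \<exists>c>0. \<forall>G D. weighted_graph G D \<longrightarrow> far \<epsilon> G D P \<longrightarrow>
      sample_ok P m G D \<le> 1 - c"
  shows "vdf_testable P"
proof -
  have "\<exists>M>0. \<forall>G D. weighted_graph G D \<longrightarrow> far \<epsilon> G D P \<longrightarrow> sample_ok P M G D \<le> 1 / 3"
    if \<epsilon>: "\<epsilon> \<in> {0<..<1}" for \<epsilon>
  proof -
    obtain m c where m: "0 < m" "0 < c"
      "\<And>G D. weighted_graph G D \<Longrightarrow> far \<epsilon> G D P \<Longrightarrow> sample_ok P m G D \<le> 1 - c"
      using gap[OF \<epsilon>] by blast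
    \<comment> \<open>Keeps the base \<open>1 - c'\<close> nonnegative, so that powers are
      monotone.\<close>
    define c' where "c' = min c 1"
    obtain t where t: "(1 - c') ^ t < 1 / 3"
      using real_arch_pow_inv[of "1 / 3" "1 - c'"] m(2) by (auto simp: c'_def)
    have t0: "0 < t" using t by (cases t) auto
    have "sample_ok P (t * m) G D \<le> 1 / 3" if "weighted_graph G D" "far \<epsilon> G D P" for G D
    proof -
      have "sample_ok P (t * m) G D \<le> measure_pmf.prob (replicate_pmf (t * m) D) {xs. xs = [] \<or> induced_subgraph G (set xs) \<in> P}"
        unfolding sample_ok_def by (intro measure_pmf.finite_measure_mono) auto
      also have "\<dots> \<le> sample_ok P m G D ^ t" by (rule sample_ok_power[OF P(2) m(1)])
      also have "\<dots> \<le> (1 - c') ^ t"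
        using m(3)[OF that] by (intro power_mono) (auto simp: c'_def sample_ok_def)
      finally show ?thesis using t by linarith
    qed
    then show ?thesis using m(1) t0 by (intro exI[of _ "t * m"]) auto
  qed
  then obtain M where M: "\<And>\<epsilon>. \<epsilon> \<in> {0<..<1} \<Longrightarrow> 0 < M \<epsilon>"
    "\<And>\<epsilon> G D. \<epsilon> \<in> {0<..<1} \<Longrightarrow> weighted_graph G D \<Longrightarrow> far \<epsilon> G D P \<Longrightarrow> sample_ok P (M \<epsilon>) G D \<le> 1 / 3"
    by metis
  define T where "T \<epsilon> = induced_tester P (M \<epsilon>)" for \<epsilon>
  have "tester P T"
    unfolding tester_def
  proof (intro ballI allI impI conjI)
    fix \<epsilon> :: real and G D assume \<epsilon>: "\<epsilon> \<in> {0<..<1}" and w: "weighted_graph G D"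
    have acc: "accept_prob (T \<epsilon>) G D = sample_ok P (M \<epsilon>) G D"
      unfolding T_def by (rule accept_induced_tester[OF P(1) w M(1)[OF \<epsilon>]])
    show "2 / 3 \<le> accept_prob (T \<epsilon>) G D" if G: "G \<in> P"
    proof -
      have "sample_ok P (M \<epsilon>) G D = 1"
        unfolding sample_ok_def
      proof (rule iffD2[OF measure_pmf.prob_eq_1 AE_pmfI])
        fix xs assume "xs \<in> set_pmf (replicate_pmf (M \<epsilon>) D)"
        then have "set xs \<subseteq> verts G" "xs \<noteq> []"
          using w M(1)[OF \<epsilon>] by (auto simp: set_replicate_pmf weighted_graph_def)
        then show "xs \<in> {xs. induced_subgraph G (set xs) \<in> P}"
          using induced_subgraph_hereditary[OF P(2) G] by simp
      qed simp
      then show ?thesis by (simp add: acc)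
    qed
    show "2 / 3 \<le> reject_prob (T \<epsilon>) G D" if "far \<epsilon> G D P"
      using M(2)[OF \<epsilon> w that] by (simp add: reject_prob_eq acc)
  qed
  moreover have "snd r \<le> M \<epsilon> + M \<epsilon> * M \<epsilon>"
    if "\<epsilon> \<in> {0<..<1}" "weighted_graph G D" "r \<in> set_pmf (execution (T \<epsilon>) G D)" for \<epsilon> G D r
    using that(3) unfolding T_def execution_induced_tester[OF P(1) that(2) M(1)[OF that(1)]] by auto
  ultimately show ?thesis
    unfolding vdf_testable_def by (intro exI[of _ "\<lambda>\<epsilon>. M \<epsilon> + M \<epsilon> * M \<epsilon>"] exI[of _ T]) blast
qed

subsection \<open>Counting lemma and cleaning\<close>

context weighted_relation
begin

text \<open>Pairs within a class are settled by homogeneous tuples, whose density is at least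
  \<open>\<rho>\<close> per class; pairs across classes are then imposed by regularity, each with
  density at least \<open>d\<close>. Here \<open>m\<close> bounds the vertices and \<open>n\<close>
  the classes that are used.\<close>

lemma counting_lemma:
  fixes F :: "nat \<Rightarrow> nat \<Rightarrow> bool"
  assumes X: "finite X" "card X \<le> m" "card (\<phi> ` X) \<le> n"
    and b: "\<And>i. b i \<subseteq> V" "\<And>i j. i \<noteq> j \<Longrightarrow> b i \<inter> b j = {}"
    and num: "0 \<le> d" "d \<le> 1" "0 \<le> \<rho>" "\<rho> \<le> 1" "0 \<le> \<gamma>"
    and hom: "\<And>i. i \<in> \<phi> ` X \<Longrightarrow> \<rho> * sum w (b i) ^ card {v \<in> X. \<phi> v = i} \<le> hom_weight (R i) (card {v \<in> X. \<phi> v = i}) (b i)"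
    and R: "\<And>i x y. R i x y \<longleftrightarrow> R i y x"
    and same: "\<And>u v x y. u \<in> X \<Longrightarrow> v \<in> X \<Longrightarrow> u \<noteq> v \<Longrightarrow> \<phi> u = \<phi> v \<Longrightarrow> R (\<phi> u) x y \<Longrightarrow> A x y = 1 \<longleftrightarrow> F u v"
    and F: "\<And>u v. F u v \<longleftrightarrow> F v u"
    and cross: "\<And>u v. u \<in> X \<Longrightarrow> v \<in> X \<Longrightarrow> \<phi> u \<noteq> \<phi> v \<Longrightarrow> regular_pair (b (\<phi> u)) (b (\<phi> v)) \<gamma> \<and>
      (if F u v then d \<le> average A (b (\<phi> u)) (b (\<phi> v)) else average A (b (\<phi> u)) (b (\<phi> v)) \<le> 1 - d)"
  shows "(d ^ (m * m) * \<rho> ^ n - real (m * m) * \<gamma>) * (\<Prod>v\<in>X. sum w (b (\<phi> v))) \<le>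
    tuple_sum X (\<lambda>v. b (\<phi> v))
      (\<lambda>z. of_bool (inj_on z X \<and> (\<forall>u\<in>X. \<forall>v\<in>X. u \<noteq> v \<longrightarrow> (A (z u) (z v) = 1 \<longleftrightarrow> F u v))))"
proof -
  define B where "B v = b (\<phi> v)" for v
  \<comment> \<open>Cross pairs are oriented by \<open>u < v\<close> so that each is imposed once,
    whereas \<open>E'\<close> contains both orders, as in
    \<open>tuple_sum_homogeneous\<close>.\<close>
  define E where "E = {(u, v) \<in> X \<times> X. u < v \<and> \<phi> u \<noteq> \<phi> v}"
  define E' where "E' = {(u, v) \<in> X \<times> X. u \<noteq> v \<and> \<phi> u = \<phi> v}"
  define P where "P u v x y \<longleftrightarrow> (if \<phi> u = \<phi> v then x \<noteq> y \<and> R (\<phi> u) x y else (A x y = 1 \<longleftrightarrow> F u v))" for u v x y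
  define M where "M = (\<Prod>v\<in>X. sum w (B v))"
  define T0 where "T0 = tuple_sum X B (\<lambda>z. of_bool (\<forall>(s, t)\<in>E'. P s t (z s) (z t)))"
  have BV: "B v \<subseteq> V" for v by (simp add: B_def b)
  have M0: "0 \<le> M" unfolding M_def by (intro prod_nonneg sum_w_nonneg BV)
  have EX: "E \<subseteq> X \<times> X" by (auto simp: E_def)
  then have finE: "finite E" using X(1) by (meson finite_SigmaI finite_subset)
  have cardE: "card E \<le> m * m"
  proof -
    have "card E \<le> card (X \<times> X)" using X(1) EX by (intro card_mono) auto
    also have "\<dots> \<le> m * m" using X(2) by (simp add: card_cartesian_product mult_le_mono)
    finally show ?thesis .
  qed
  have reg: "\<exists>d'\<ge>d. \<forall>S T. S \<subseteq> B u \<longrightarrow> T \<subseteq> B v \<longrightarrow>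
      \<bar>wsum (\<lambda>x y. of_bool (P u v x y) - d') S T\<bar> \<le> \<gamma> * (sum w (B u) * sum w (B v))"
    if uv: "(u, v) \<in> E" for u v
  proof -
    define D where "D = average A (B u) (B v)"
    have r: "\<bar>wsum A S T - D * (sum w S * sum w T)\<bar> \<le> \<gamma> * (sum w (B u) * sum w (B v))"
      if "S \<subseteq> B u" "T \<subseteq> B v" for S T
      using cross[of u v] uv that by (auto simp: E_def regular_pair_def B_def D_def)
    have dif: "\<phi> u \<noteq> \<phi> v" using uv by (auto simp: E_def)
    show ?thesis
    proof (cases "F u v")
      case True
      have "of_bool (P u v x y) = A x y" for x y
        using A_range[of x y] dif True by (auto simp: P_def)
      moreover have "d \<le> D" using cross[of u v] uv True by (auto simp: E_def D_def B_def)
      ultimately show ?thesis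
        using r by (intro exI[of _ D]) (simp add: wsum_diff wsum_const)
    next
      case False
      \<comment> \<open>Nonadjacency has density \<open>1 - D\<close>, and the same regularity error
        up to sign.\<close>
      have P: "of_bool (P u v x y) = 1 - A x y" for x y
        using A_range[of x y] dif False by (auto simp: P_def)
      have "\<bar>wsum (\<lambda>x y. of_bool (P u v x y) - (1 - D)) S T\<bar> \<le> \<gamma> * (sum w (B u) * sum w (B v))"
        if "S \<subseteq> B u" "T \<subseteq> B v" for S T
      proof -
        have "wsum (\<lambda>x y. of_bool (P u v x y) - (1 - D)) S T = - (wsum A S T - D * (sum w S * sum w T))"
          unfolding P wsum_diff wsum_const by (simp add: algebra_simps)
        then show ?thesis using r[OF that] by simp
      qed
      moreover have "d \<le> 1 - D" using cross[of u v] uv False by (auto simp: E_def D_def B_def)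
      ultimately show ?thesis by blast
    qed
  qed
  have "d ^ card E * T0 - real (card E) * \<gamma> * M \<le>
      tuple_sum X B (\<lambda>z. of_bool (\<forall>(s, t)\<in>E \<union> E'. P s t (z s) (z t)))"
    unfolding T0_def M_def
    by (rule tuple_sum_cross_pairs[OF X(1) BV finE num(1,2,5) _ _ _ reg]) (auto simp: E_def E'_def)
  also have "\<dots> \<le> tuple_sum X B
      (\<lambda>z. of_bool (inj_on z X \<and> (\<forall>u\<in>X. \<forall>v\<in>X. u \<noteq> v \<longrightarrow> (A (z u) (z v) = 1 \<longleftrightarrow> F u v))))"
    unfolding tuple_sum_def
  proof (intro sum_mono mult_left_mono tuple_weight_nonneg[OF BV])
    fix z assume z: "z \<in> PiE X B"
    have "z u \<noteq> z v \<and> (A (z u) (z v) = 1 \<longleftrightarrow> F u v)"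
      if all: "\<forall>(s, t)\<in>E \<union> E'. P s t (z s) (z t)" and uv: "u \<in> X" "v \<in> X" "u \<noteq> v" for u v
    proof (cases "\<phi> u = \<phi> v")
      case True
      then have "(u, v) \<in> E'" using uv by (auto simp: E'_def)
      then have "P u v (z u) (z v)" using all by blast
      then show ?thesis using True same[OF uv True] by (simp add: P_def)
    next
      case False
      have "z u \<in> b (\<phi> u)" "z v \<in> b (\<phi> v)" using z uv by (auto simp: B_def PiE_iff)
      then have "z u \<noteq> z v" using b(2)[OF False] by auto
      moreover have "A (z u) (z v) = 1 \<longleftrightarrow> F u v"
      proof (cases "u < v")
        case True
        then have "(u, v) \<in> E" using uv False by (auto simp: E_def)
        then have "P u v (z u) (z v)" using all by blast
        then show ?thesis using False by (simp add: P_def)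
      next
        case lt: False
        then have "(v, u) \<in> E" using uv False by (auto simp: E_def)
        then have "P v u (z v) (z u)" using all by blast
        then show ?thesis using False F[of u v] A_sym[of "z u" "z v"] by (auto simp: P_def)
      qed
      ultimately show ?thesis by blast
    qed
    then have "(\<forall>(s, t)\<in>E \<union> E'. P s t (z s) (z t)) \<Longrightarrow>
      inj_on z X \<and> (\<forall>u\<in>X. \<forall>v\<in>X. u \<noteq> v \<longrightarrow> (A (z u) (z v) = 1 \<longleftrightarrow> F u v))"
      unfolding inj_on_def by blast
    then show "of_bool (\<forall>(s, t)\<in>E \<union> E'. P s t (z s) (z t)) \<le>
      (of_bool (inj_on z X \<and> (\<forall>u\<in>X. \<forall>v\<in>X. u \<noteq> v \<longrightarrow> (A (z u) (z v) = 1 \<longleftrightarrow> F u v))) :: real)"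
      unfolding of_bool_less_eq_iff by blast
  qed
  finally have le: "d ^ card E * T0 - real (card E) * \<gamma> * M \<le> \<dots>" .
  have "T0 = tuple_sum X (\<lambda>v. b (\<phi> v))
      (\<lambda>z. of_bool (\<forall>u\<in>X. \<forall>v\<in>X. u \<noteq> v \<and> \<phi> u = \<phi> v \<longrightarrow> z u \<noteq> z v \<and> R (\<phi> u) (z u) (z v)))"
    unfolding T0_def by (intro tuple_sum_cong refl) (auto simp: B_def E'_def P_def)
  also have "\<dots> = (\<Prod>i\<in>\<phi> ` X. hom_weight (R i) (card {v \<in> X. \<phi> v = i}) (b i))"
    using X(1) b(1) R by (intro tuple_sum_homogeneous) auto
  finally have T0: "T0 = (\<Prod>i\<in>\<phi> ` X. hom_weight (R i) (card {v \<in> X. \<phi> v = i}) (b i))" .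
  have "M = (\<Prod>i\<in>\<phi> ` X. \<Prod>v\<in>{v \<in> X. \<phi> v = i}. sum w (B v))"
    unfolding M_def using X(1) by (rule prod.image_gen)
  also have "\<dots> = (\<Prod>i\<in>\<phi> ` X. sum w (b i) ^ card {v \<in> X. \<phi> v = i})"
    by (intro prod.cong refl) (simp add: B_def)
  finally have M: "M = (\<Prod>i\<in>\<phi> ` X. sum w (b i) ^ card {v \<in> X. \<phi> v = i})" .
  have "\<rho> ^ n * M \<le> \<rho> ^ card (\<phi> ` X) * M"
    using X(3) num M0 by (intro mult_right_mono power_decreasing) auto
  also have "\<dots> = (\<Prod>i\<in>\<phi> ` X. \<rho> * sum w (b i) ^ card {v \<in> X. \<phi> v = i})"
    unfolding M by (simp add: prod.distrib)
  also have "\<dots> \<le> T0"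
    unfolding T0 using hom num(3) by (intro prod_mono conjI mult_nonneg_nonneg zero_le_power sum_w_nonneg b(1)) auto
  finally have T0_ge: "\<rho> ^ n * M \<le> T0" .
  have pM: "0 \<le> \<rho> ^ n * M" using num(3) M0 by simp
  have "(d ^ (m * m) * \<rho> ^ n - real (m * m) * \<gamma>) * M = d ^ (m * m) * (\<rho> ^ n * M) - real (m * m) * \<gamma> * M"
    by (simp add: left_diff_distrib mult.assoc)
  also have "\<dots> \<le> d ^ card E * T0 - real (card E) * \<gamma> * M"
  proof (rule diff_mono)
    show "d ^ (m * m) * (\<rho> ^ n * M) \<le> d ^ card E * T0"
      using cardE num T0_ge pM by (intro mult_mono power_decreasing) auto
    show "real (card E) * \<gamma> * M \<le> real (m * m) * \<gamma> * M"
      using num(5) M0 cardE by (intro mult_right_mono) (simp_all only: of_nat_le_iff)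
  qed
  finally show ?thesis using le unfolding M_def B_def by linarith
qed

text \<open>\<open>f\<close> marks the changed pairs. Changes inside classes cost at most
  \<open>\<kappa>\<close> times the total weight. Between classes, a changed pair of classes has
  density within \<open>\<delta>'\<close> of the new value on the representatives, and passing to
  the whole classes costs \<open>\<delta>\<close> in total.\<close>

lemma cleaning_cost:
  assumes I: "finite I" "U = {x \<in> V. q x \<in> I}" and num: "0 \<le> \<kappa>" "0 \<le> \<delta>'"
    and f: "\<And>x y. 0 \<le> f x y" "\<And>x y. f x y \<le> 1"
    and diag: "\<And>i. i \<in> I \<Longrightarrow> sum w (cls q i) \<le> \<kappa> \<or> (\<forall>x\<in>cls q i. \<forall>y\<in>cls q i. f x y = 0)"
    and off: "\<And>i j. i \<in> I \<Longrightarrow> j \<in> I \<Longrightarrow> i \<noteq> j \<Longrightarrow>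
      (\<forall>x\<in>cls q i. \<forall>y\<in>cls q j. f x y = 0) \<or>
      (\<forall>x\<in>cls q i. \<forall>y\<in>cls q j. f x y = A x y) \<and> average A (b i) (b j) \<le> \<delta>' \<or>
      (\<forall>x\<in>cls q i. \<forall>y\<in>cls q j. f x y = 1 - A x y) \<and> 1 - \<delta>' \<le> average A (b i) (b j)"
    and dens: "(\<Sum>i\<in>I. \<Sum>j\<in>I - {i}. sum w (cls q i) * sum w (cls q j) *
       \<bar>average A (b i) (b j) - average A (cls q i) (cls q j)\<bar>) \<le> \<delta>"
  shows "wsum f U U \<le> \<kappa> + \<delta>' + \<delta>"
proof -
  define \<mu> where "\<mu> i = sum w (cls q i)" for i
  have \<mu>: "0 \<le> \<mu> i" for i by (simp add: \<mu>_def sum_w_nonneg cls_subset)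
  have U: "finite U" "q ` U \<subseteq> I" using I by auto
  have cl: "{x \<in> U. q x = i} = cls q i" if "i \<in> I" for i using that by (auto simp: I cls_def)
  have g: "sum h U = (\<Sum>i\<in>I. sum h (cls q i))" for h :: "'a \<Rightarrow> real"
    using sum.group[OF U(1) I(1) U(2), of h] cl by simp
  have "wsum f U U = (\<Sum>i\<in>I. \<Sum>x\<in>cls q i. \<Sum>j\<in>I. \<Sum>y\<in>cls q j. w x * w y * f x y)"
    unfolding wsum_def by (simp add: g)
  also have "\<dots> = (\<Sum>i\<in>I. \<Sum>j\<in>I. wsum f (cls q i) (cls q j))"
    unfolding wsum_def by (rule sum.cong[OF refl], rule sum.swap)
  also have "\<dots> = (\<Sum>i\<in>I. wsum f (cls q i) (cls q i) + (\<Sum>j\<in>I - {i}. wsum f (cls q i) (cls q j)))"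
    using I(1) by (intro sum.cong refl sum.remove)
  finally have eq: "wsum f U U = (\<Sum>i\<in>I. wsum f (cls q i) (cls q i)) +
      (\<Sum>i\<in>I. \<Sum>j\<in>I - {i}. wsum f (cls q i) (cls q j))" by (simp add: sum.distrib)
  have tot: "(\<Sum>i\<in>I. \<mu> i) \<le> 1"
    unfolding \<mu>_def g[symmetric] by (rule sum_w_le_1) (auto simp: I)
  have d: "wsum f (cls q i) (cls q i) \<le> \<kappa> * \<mu> i" if "i \<in> I" for i
    using diag[OF that]
  proof
    assume *: "sum w (cls q i) \<le> \<kappa>"
    have "wsum f (cls q i) (cls q i) \<le> wsum (\<lambda>_ _. 1) (cls q i) (cls q i)"
      using f by (intro wsum_mono cls_subset)
    also have "\<dots> = \<mu> i * \<mu> i" by (simp add: wsum_const \<mu>_def)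
    also have "\<dots> \<le> \<kappa> * \<mu> i" using * \<mu> by (intro mult_right_mono) (auto simp: \<mu>_def)
    finally show ?thesis .
  next
    assume *: "\<forall>x\<in>cls q i. \<forall>y\<in>cls q i. f x y = 0"
    then have "wsum f (cls q i) (cls q i) = wsum (\<lambda>_ _. 0) (cls q i) (cls q i)"
      by (intro wsum_cong) auto
    then show ?thesis using num \<mu>[of i] by (simp add: wsum_const)
  qed
  have o: "wsum f (cls q i) (cls q j) \<le> \<delta>' * (\<mu> i * \<mu> j) +
      \<mu> i * \<mu> j * \<bar>average A (b i) (b j) - average A (cls q i) (cls q j)\<bar>"
    (is "_ \<le> _ + _ * ?e") if ij: "i \<in> I" "j \<in> I" "i \<noteq> j" for i j
  proof -
    have mm: "0 \<le> \<mu> i * \<mu> j" using \<mu> by simp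
    have av: "wsum A (cls q i) (cls q j) = average A (cls q i) (cls q j) * (\<mu> i * \<mu> j)"
      by (simp add: average_mult cls_subset \<mu>_def)
    have rhs: "\<delta>' * (\<mu> i * \<mu> j) + \<mu> i * \<mu> j * ?e = (\<delta>' + ?e) * (\<mu> i * \<mu> j)"
      by (simp add: algebra_simps)
    consider "\<forall>x\<in>cls q i. \<forall>y\<in>cls q j. f x y = 0"
      | "\<forall>x\<in>cls q i. \<forall>y\<in>cls q j. f x y = A x y" "average A (b i) (b j) \<le> \<delta>'"
      | "\<forall>x\<in>cls q i. \<forall>y\<in>cls q j. f x y = 1 - A x y" "1 - \<delta>' \<le> average A (b i) (b j)"
      using off[OF ij] by blast
    then show ?thesis
    proof cases
      case 1
      then have "wsum f (cls q i) (cls q j) = wsum (\<lambda>_ _. 0) (cls q i) (cls q j)"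
        by (intro wsum_cong) auto
      then show ?thesis unfolding rhs using num mm by (simp add: wsum_const)
    next
      case 2
      then have "wsum f (cls q i) (cls q j) = wsum A (cls q i) (cls q j)"
        by (intro wsum_cong) auto
      then show ?thesis unfolding rhs av using 2(2) mm by (simp only:) (intro mult_right_mono, linarith, simp)
    next
      case 3
      then have "wsum f (cls q i) (cls q j) = wsum (\<lambda>x y. 1 - A x y) (cls q i) (cls q j)"
        by (intro wsum_cong) auto
      also have "\<dots> = (1 - average A (cls q i) (cls q j)) * (\<mu> i * \<mu> j)"
        unfolding wsum_diff wsum_const av by (simp add: \<mu>_def left_diff_distrib)
      finally show ?thesis unfolding rhs using 3(2) mm by (simp only:) (intro mult_right_mono, linarith, simp)
    qed
  qed
  have "wsum f U U \<le> (\<Sum>i\<in>I. \<kappa> * \<mu> i) + (\<Sum>i\<in>I. \<Sum>j\<in>I - {i}. \<delta>' * (\<mu> i * \<mu> j) +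
      \<mu> i * \<mu> j * \<bar>average A (b i) (b j) - average A (cls q i) (cls q j)\<bar>)"
    unfolding eq using d o by (intro add_mono sum_mono) auto
  also have "\<dots> = \<kappa> * (\<Sum>i\<in>I. \<mu> i) + \<delta>' * (\<Sum>i\<in>I. \<Sum>j\<in>I - {i}. \<mu> i * \<mu> j) +
      (\<Sum>i\<in>I. \<Sum>j\<in>I - {i}. \<mu> i * \<mu> j * \<bar>average A (b i) (b j) - average A (cls q i) (cls q j)\<bar>)"
    by (simp add: sum.distrib sum_distrib_left)
  also have "\<dots> \<le> \<kappa> * 1 + \<delta>' * 1 + \<delta>"
  proof (intro add_mono mult_left_mono tot num dens[folded \<mu>_def])
    have "(\<Sum>i\<in>I. \<Sum>j\<in>I - {i}. \<mu> i * \<mu> j) \<le> (\<Sum>i\<in>I. \<Sum>j\<in>I. \<mu> i * \<mu> j)"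
      using I(1) \<mu> by (intro sum_mono sum_mono2) auto
    also have "\<dots> = (\<Sum>i\<in>I. \<mu> i) * (\<Sum>i\<in>I. \<mu> i)" by (simp add: sum_product)
    also have "\<dots> \<le> 1" using tot \<mu> by (intro mult_le_one sum_nonneg) auto
    finally show "(\<Sum>i\<in>I. \<Sum>j\<in>I - {i}. \<mu> i * \<mu> j) \<le> 1" .
  qed
  finally show ?thesis by simp
qed

lemma small_parts:
  assumes "q ` V \<subseteq> {..<m}" "0 \<le> \<tau>"
  shows "sum w {x \<in> V. q x \<notin> {i \<in> {..<m}. \<tau> \<le> sum w (cls q i)}} \<le> real m * \<tau>"
proof -
  let ?J = "{i \<in> {..<m}. sum w (cls q i) < \<tau>}"
  have eq: "{x \<in> V. q x \<notin> {i \<in> {..<m}. \<tau> \<le> sum w (cls q i)}} = {x \<in> V. q x \<in> ?J}"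
    using assms(1) by (auto simp: not_le)
  have "sum w {x \<in> V. q x \<in> ?J} = (\<Sum>i\<in>?J. sum w {x \<in> {x \<in> V. q x \<in> ?J}. q x = i})"
    by (intro sum.group[symmetric]) auto
  also have "\<dots> \<le> (\<Sum>i\<in>?J. \<tau>)"
  proof (rule sum_mono)
    fix i assume i: "i \<in> ?J"
    then have "{x \<in> {x \<in> V. q x \<in> ?J}. q x = i} = cls q i" by (auto simp: cls_def)
    with i show "sum w {x \<in> {x \<in> V. q x \<in> ?J}. q x = i} \<le> \<tau>" by simp
  qed
  also have "\<dots> \<le> real m * \<tau>"
  proof -
    have "?J \<subseteq> {..<m}" by auto
    then have "card ?J \<le> m" using card_mono[of "{..<m}" ?J] by simp
    then show ?thesis using assms(2) by (simp add: mult_right_mono)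
  qed
  finally show ?thesis unfolding eq .
qed

end

lemma pmf_replicate:
  "length xs = r \<Longrightarrow> pmf (replicate_pmf r D) xs = (\<Prod>i<r. pmf D (xs ! i))"
proof (induction r arbitrary: xs)
  case 0
  then show ?case by simp
next
  case (Suc r)
  then obtain x ys where xs: "xs = x # ys" "length ys = r" by (auto simp: length_Suc_conv)
  have "replicate_pmf (Suc r) D = map_pmf (\<lambda>(x, ys). x # ys) (pair_pmf D (replicate_pmf r D))"
    by (simp add: pair_pmf_def map_pmf_def bind_assoc_pmf bind_return_pmf)
  moreover have "inj (\<lambda>(x, ys). x # ys :: 'a list)" by (auto simp: inj_on_def)
  ultimately have "pmf (replicate_pmf (Suc r) D) xs = pmf D x * pmf (replicate_pmf r D) ys"
    using pmf_map_inj'[of "\<lambda>(x, ys). x # ys" "pair_pmf D (replicate_pmf r D)" "(x, ys)"]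
    by (simp add: xs pmf_pair)
  then show ?case using Suc.IH[OF xs(2)] by (simp add: xs(1) prod.lessThan_Suc_shift del: prod.lessThan_Suc)
qed

text \<open>For weights \<open>pmf D\<close>, the weight of a tuple is the probability of drawing
  exactly that list, and different tuples give different lists.\<close>

lemma tuple_sum_le_sample_prob:
  assumes wr: "weighted_relation V (pmf D) A"
    and Q: "\<And>z. z \<in> PiE {..<r} B \<Longrightarrow> Q z \<Longrightarrow> map z [0..<r] \<in> S"
    and B: "\<And>v. v < r \<Longrightarrow> B v \<subseteq> V"
  shows "weighted_relation.tuple_sum (pmf D) {..<r} B (\<lambda>z. of_bool (Q z)) \<le>
    measure_pmf.prob (replicate_pmf r D) S"
proof -
  interpret weighted_relation V "pmf D" A by (rule wr)
  define Z where "Z = {z \<in> PiE {..<r} B. Q z}"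
  have "finite (PiE {..<r} B)"
    using B finite_subset[OF _ finite_V] by (intro finite_PiE) auto
  then have finZ: "finite Z" by (simp add: Z_def)
  have "tuple_sum {..<r} B (\<lambda>z. of_bool (Q z)) = (\<Sum>z\<in>Z. \<Prod>v<r. pmf D (z v))"
    unfolding tuple_sum_def Z_def using \<open>finite (PiE {..<r} B)\<close>
    by (simp add: of_bool_def if_distrib[of "\<lambda>c. _ * c"] sum.inter_filter[symmetric] cong: if_cong)
  also have "\<dots> = (\<Sum>z\<in>Z. pmf (replicate_pmf r D) (map z [0..<r]))"
    by (intro sum.cong refl) (simp add: pmf_replicate)
  also have "\<dots> = (\<Sum>xs\<in>(\<lambda>z. map z [0..<r]) ` Z. pmf (replicate_pmf r D) xs)"
  proof -
    have "inj_on (\<lambda>z. map z [0..<r]) Z"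
    proof (rule inj_onI)
      fix z z' assume *: "z \<in> Z" "z' \<in> Z" "map z [0..<r] = map z' [0..<r]"
      show "z = z'"
      proof (rule PiE_ext)
        show "z \<in> PiE {..<r} B" "z' \<in> PiE {..<r} B" using * by (auto simp: Z_def)
        show "z v = z' v" if "v \<in> {..<r}" for v using *(3) that by auto
      qed
    qed
    then show ?thesis by (simp add: sum.reindex)
  qed
  also have "\<dots> = measure_pmf.prob (replicate_pmf r D) ((\<lambda>z. map z [0..<r]) ` Z)"
    using finZ by (simp add: measure_measure_pmf_finite)
  also have "\<dots> \<le> measure_pmf.prob (replicate_pmf r D) S"
    using Q by (intro measure_pmf.finite_measure_mono) (auto simp: Z_def)
  finally show ?thesis .
qed

text \<open>
  A reduced structure \<open>R\<close> on classes \<open>i\<close>, \<open>j\<close> uses \<open>0\<close> for nonadjacent, \<open>1\<close> for adjacent and, if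
  \<open>i \<noteq> j\<close>, \<open>2\<close> for unconstrained. On the diagonal \<open>2\<close> marks a class that consists of one heavy
  vertex, so that at most one vertex may be mapped to it, and \<open>3\<close> marks a discarded class.
\<close>

definition compatible :: "(nat \<times> nat \<Rightarrow> nat) \<Rightarrow> (nat \<Rightarrow> nat) \<Rightarrow> graph \<Rightarrow> bool" where
  "compatible R \<phi> F \<longleftrightarrow> (\<forall>u\<in>verts F. \<forall>v\<in>verts F. R (\<phi> u, \<phi> u) \<noteq> 3 \<and>
     (u \<noteq> v \<longrightarrow>
       (if \<phi> u = \<phi> v then R (\<phi> u, \<phi> u) < 2 \<and> ({u, v} \<in> edges F \<longleftrightarrow> R (\<phi> u, \<phi> u) = 1)
        else (R (\<phi> u, \<phi> v) = 0 \<longrightarrow> {u, v} \<notin> edges F) \<and> (R (\<phi> u, \<phi> v) = 1 \<longrightarrow> {u, v} \<in> edges F))))"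

lemma simple_graph_relabel:
  assumes "simple_graph F"
  obtains F' h where "verts F' = {..<card (verts F)}" "simple_graph F'" "bij_betw h (verts F') (verts F)"
    "\<And>u v. u \<in> verts F' \<Longrightarrow> v \<in> verts F' \<Longrightarrow> {u, v} \<in> edges F' \<longleftrightarrow> {h u, h v} \<in> edges F"
proof -
  let ?r = "card (verts F)"
  have "finite (verts F)" using assms by (simp add: simple_graph_def)
  then obtain h where h: "bij_betw h {..<?r} (verts F)"
    using ex_bij_betw_nat_finite atLeast0LessThan by metis
  define F' where "F' = \<lparr>verts = {..<?r}, edges = {e. \<exists>u<?r. \<exists>v<?r. e = {u, v} \<and> {h u, h v} \<in> edges F}\<rparr>"
  have v: "verts F' = {..<?r}" by (simp add: F'_def)
  have e: "{u, v} \<in> edges F' \<longleftrightarrow> {h u, h v} \<in> edges F" if "u < ?r" "v < ?r" for u v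
    using that by (auto simp: F'_def doubleton_eq_iff insert_commute)
  have "0 < ?r" using assms by (simp add: simple_graph_def card_gt_0_iff)
  moreover have "e \<subseteq> {..<?r} \<and> card e = 2" if e': "e \<in> edges F'" for e
  proof -
    obtain x y where xy: "x < ?r" "y < ?r" "e = {x, y}" "{h x, h y} \<in> edges F"
      using e' by (auto simp: F'_def)
    moreover have "x \<noteq> y" using xy(4) simple_graph_no_loop[OF assms, of "h x"] by auto
    ultimately show ?thesis by simp
  qed
  ultimately have "simple_graph F'" by (auto simp: simple_graph_def v)
  then show ?thesis using that[of F' h] v h e by simp
qed

text \<open>There are only finitely many structures \<open>R\<close> on \<open>n\<close> classes.
  For each one that admits a compatible graph outside \<open>P\<close>, fix one such graph on an
  initial segment; \<open>m\<close> bounds their sizes. This replaces a graph \<open>F\<close> of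
  unbounded size by one whose size depends on \<open>n\<close> alone.\<close>

lemma forbidden_size_bound:
  assumes "graph_property P"
  shows "\<exists>m>0. \<forall>R F \<phi>. R \<in> PiE ({..<n} \<times> {..<n}) (\<lambda>_. {..<4}) \<longrightarrow> simple_graph F \<longrightarrow> F \<notin> P \<longrightarrow>
     compatible R \<phi> F \<longrightarrow> \<phi> ` verts F \<subseteq> {..<n} \<longrightarrow>
     (\<exists>r F' \<phi>'. 0 < r \<and> r \<le> m \<and> verts F' = {..<r} \<and> simple_graph F' \<and> F' \<notin> P \<and>
        compatible R \<phi>' F' \<and> \<phi>' ` {..<r} \<subseteq> {..<n})"
proof -
  let ?\<R> = "PiE ({..<n} \<times> {..<n}) (\<lambda>_. {..<4 :: nat})"
  define bad where "bad R F \<phi> \<longleftrightarrow> simple_graph F \<and> F \<notin> P \<and> compatible R \<phi> F \<and> \<phi> ` verts F \<subseteq> {..<n}"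
    for R F \<phi>
  define ok where "ok R r \<longleftrightarrow> (\<exists>F \<phi>. 0 < r \<and> verts F = {..<r} \<and> bad R F \<phi>)" for R r
  have relabel: "\<exists>r. ok R r" if "bad R F \<phi>" for R F \<phi>
  proof -
    have F: "simple_graph F" "F \<notin> P" "compatible R \<phi> F" "\<phi> ` verts F \<subseteq> {..<n}"
      using that by (auto simp: bad_def)
    from F(1) obtain F' h where F': "verts F' = {..<card (verts F)}" "simple_graph F'"
      "bij_betw h (verts F') (verts F)"
      "\<And>u v. u \<in> verts F' \<Longrightarrow> v \<in> verts F' \<Longrightarrow> {u, v} \<in> edges F' \<longleftrightarrow> {h u, h v} \<in> edges F"
      by (rule simple_graph_relabel) blast
    have "isomorphic F' F" unfolding isomorphic_def using F'(3,4) by blast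
    then have "F' \<notin> P" using graph_property_iso_iff[OF assms F'(2) F(1)] F(2) by blast
    moreover have hv: "h u \<in> verts F" if "u \<in> verts F'" for u using F'(3) that by (rule bij_betwE[rule_format])
    moreover have hi: "h u = h v \<longleftrightarrow> u = v" if "u \<in> verts F'" "v \<in> verts F'" for u v
      using F'(3) that by (auto simp: bij_betw_def inj_on_def)
    have "compatible R (\<phi> \<circ> h) F'"
      unfolding compatible_def
    proof (intro ballI)
      fix u v assume uv: "u \<in> verts F'" "v \<in> verts F'"
      show "R ((\<phi> \<circ> h) u, (\<phi> \<circ> h) u) \<noteq> 3 \<and> (u \<noteq> v \<longrightarrow>
       (if (\<phi> \<circ> h) u = (\<phi> \<circ> h) v then R ((\<phi> \<circ> h) u, (\<phi> \<circ> h) u) < 2 \<and> ({u, v} \<in> edges F' \<longleftrightarrow> R ((\<phi> \<circ> h) u, (\<phi> \<circ> h) u) = 1)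
        else (R ((\<phi> \<circ> h) u, (\<phi> \<circ> h) v) = 0 \<longrightarrow> {u, v} \<notin> edges F') \<and> (R ((\<phi> \<circ> h) u, (\<phi> \<circ> h) v) = 1 \<longrightarrow> {u, v} \<in> edges F')))"
        unfolding F'(4)[OF uv] hi[OF uv, symmetric] o_apply
        using F(3) hv[OF uv(1)] hv[OF uv(2)] unfolding compatible_def by blast
    qed
    moreover have "(\<phi> \<circ> h) ` verts F' \<subseteq> {..<n}" using F(4) hv by auto
    moreover have "0 < card (verts F)" using F(1) by (simp add: simple_graph_def card_gt_0_iff)
    ultimately have "ok R (card (verts F))" using F'(1,2) unfolding ok_def bad_def by blast
    then show ?thesis ..
  qed
  \<comment> \<open>An arbitrary number if no forbidden graph is compatible with \<open>R\<close>;
    the maximum is still finite.\<close>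
  define r where "r R = (SOME r. ok R r)" for R
  have r: "ok R (r R)" if "bad R F \<phi>" for R F \<phi>
    unfolding r_def using someI_ex[OF relabel[OF that]] .
  have fin: "finite ?\<R>" by (intro finite_PiE) auto
  define m where "m = Max (insert 1 (r ` ?\<R>))"
  have m: "0 < m" "\<And>R. R \<in> ?\<R> \<Longrightarrow> r R \<le> m"
  proof -
    have "1 \<le> m" unfolding m_def using fin by (intro Max_ge) auto
    then show "0 < m" by simp
    show "r R \<le> m" if "R \<in> ?\<R>" for R unfolding m_def using fin that by (intro Max_ge) auto
  qed
  show ?thesis
  proof (rule exI[of _ m], intro conjI m(1) allI impI)
    fix R F \<phi> assume R: "R \<in> ?\<R>" and "simple_graph F" "F \<notin> P" "compatible R \<phi> F" "\<phi> ` verts F \<subseteq> {..<n}"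
    then have "ok R (r R)" by (intro r[of R F \<phi>]) (simp add: bad_def)
    then obtain F' \<phi>' where "0 < r R" "verts F' = {..<r R}" "bad R F' \<phi>'" unfolding ok_def by blast
    with m(2)[OF R] show "\<exists>r F' \<phi>'. 0 < r \<and> r \<le> m \<and> verts F' = {..<r} \<and> simple_graph F' \<and> F' \<notin> P \<and>
        compatible R \<phi>' F' \<and> \<phi>' ` {..<r} \<subseteq> {..<n}" unfolding bad_def by metis
  qed
qed

text \<open>Line the vertices up by their names and cut the cumulative weight into intervals of
  length \<open>\<kappa>\<close>. A class spans at most one interval, plus the weight of its last
  vertex.\<close>

lemma light_colouring:
  fixes w :: "nat \<Rightarrow> real"
  assumes "finite L" "\<And>x. x \<in> L \<Longrightarrow> 0 \<le> w x" "\<And>x. x \<in> L \<Longrightarrow> w x \<le> \<kappa>" "sum w L \<le> 1" "0 < \<kappa>"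
  shows "\<exists>q. q ` L \<subseteq> {..nat \<lfloor>1 / \<kappa>\<rfloor>} \<and> (\<forall>i. sum w {x \<in> L. q x = i} \<le> 2 * \<kappa>)"
proof -
  define S where "S x = sum w {y \<in> L. y < x}" for x
  define q where "q x = nat \<lfloor>S x / \<kappa>\<rfloor>" for x
  have S: "0 \<le> S x" "S x \<le> 1" for x
  proof -
    show "0 \<le> S x" unfolding S_def using assms(2) by (intro sum_nonneg) auto
    have "S x \<le> sum w L" unfolding S_def using assms(1,2) by (intro sum_mono2) auto
    then show "S x \<le> 1" using assms(4) by simp
  qed
  have qS: "real (q x) * \<kappa> \<le> S x" "S x < (real (q x) + 1) * \<kappa>" for x
  proof -
    have "0 \<le> S x / \<kappa>" using S(1)[of x] assms(5) by simp
    then have "real (q x) \<le> S x / \<kappa>" "S x / \<kappa> < real (q x) + 1" unfolding q_def by linarith+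
    then show "real (q x) * \<kappa> \<le> S x" "S x < (real (q x) + 1) * \<kappa>"
      using assms(5) by (simp_all add: pos_le_divide_eq pos_divide_less_eq)
  qed
  have "q x \<le> nat \<lfloor>1 / \<kappa>\<rfloor>" for x
    unfolding q_def using S(2)[of x] assms(5) by (intro nat_mono floor_mono divide_right_mono) auto
  moreover have "sum w {x \<in> L. q x = i} \<le> 2 * \<kappa>" for i
  proof (cases "{x \<in> L. q x = i} = {}")
    case True
    then show ?thesis unfolding True using assms(5) by simp
  next
    case False
    define T where "T = {x \<in> L. q x = i}"
    have T: "finite T" "T \<noteq> {}" using False assms(1) by (auto simp: T_def)
    define a b where "a = Min T" "b = Max T"
    have ab: "a \<in> T" "b \<in> T" "\<And>x. x \<in> T \<Longrightarrow> a \<le> x \<and> x \<le> b" using T by (auto simp: a_b_def)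
    have "T \<subseteq> insert b {y \<in> L. a \<le> y \<and> y < b}" using ab(3) by (force simp: T_def)
    then have "sum w T \<le> sum w (insert b {y \<in> L. a \<le> y \<and> y < b})"
      using assms(1,2) ab(2) by (intro sum_mono2) (auto simp: T_def)
    also have "\<dots> = w b + sum w {y \<in> L. a \<le> y \<and> y < b}" using assms(1) by (subst sum.insert) auto
    also have "sum w {y \<in> L. a \<le> y \<and> y < b} = S b - S a"
    proof -
      have "a \<le> b" using ab by auto
      then have "{y \<in> L. y < b} = {y \<in> L. y < a} \<union> {y \<in> L. a \<le> y \<and> y < b}" by auto
      moreover have "sum w ({y \<in> L. y < a} \<union> {y \<in> L. a \<le> y \<and> y < b}) = S a + sum w {y \<in> L. a \<le> y \<and> y < b}"
        unfolding S_def using assms(1) by (intro sum.union_disjoint) auto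
      ultimately have "S b = S a + sum w {y \<in> L. a \<le> y \<and> y < b}" by (simp add: S_def)
      then show ?thesis by simp
    qed
    also have "w b + (S b - S a) \<le> 2 * \<kappa>"
    proof -
      have "w b \<le> \<kappa>" "q a = i" "q b = i" using ab assms(3) by (auto simp: T_def)
      then show ?thesis using qS(2)[of b] qS(1)[of a] by (simp add: algebra_simps)
    qed
    finally show ?thesis by (simp add: T_def)
  qed
  ultimately show ?thesis by (intro exI[of _ q]) auto
qed

text \<open>The number of colours depends on \<open>\<kappa>\<close> and \<open>\<eta>\<close> only.
  It is therefore known before the lower scale \<open>\<eta>'\<close> has to be chosen.\<close>

lemma initial_partition:
  fixes w :: "nat \<Rightarrow> real"
  assumes "finite U" "\<And>x. x \<in> U \<Longrightarrow> 0 \<le> w x" "\<And>x. x \<in> U \<Longrightarrow> w x \<le> \<kappa> \<or> \<eta> < w x" "sum w U \<le> 1" "0 < \<kappa>" "0 < \<eta>"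
  shows "\<exists>p. p ` U \<subseteq> {..<nat \<lfloor>1 / \<kappa>\<rfloor> + 1 + nat \<lfloor>1 / \<eta>\<rfloor>} \<and>
    (\<forall>x\<in>U. \<forall>y\<in>U. p x = p y \<longrightarrow> \<eta> < w x \<longrightarrow> x = y) \<and>
    (\<forall>i. sum w {x \<in> U. p x = i \<and> w x \<le> \<eta>} \<le> 2 * \<kappa>)"
proof -
  define L where "L = {x \<in> U. w x \<le> \<eta>}"
  define H where "H = {x \<in> U. \<eta> < w x}"
  have fin: "finite L" "finite H" using assms(1) by (auto simp: L_def H_def)
  have "sum w L \<le> sum w U" using assms(1,2) by (intro sum_mono2) (auto simp: L_def)
  then have "\<exists>q. q ` L \<subseteq> {..nat \<lfloor>1 / \<kappa>\<rfloor>} \<and> (\<forall>i. sum w {x \<in> L. q x = i} \<le> 2 * \<kappa>)"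
  proof (intro light_colouring)
    show "w x \<le> \<kappa>" if "x \<in> L" for x using assms(3)[of x] that by (auto simp: L_def)
    show "0 \<le> w x" if "x \<in> L" for x using assms(2)[of x] that by (auto simp: L_def)
  qed (use fin assms(4,5) in auto)
  then obtain q where q: "q ` L \<subseteq> {..nat \<lfloor>1 / \<kappa>\<rfloor>}" "\<And>i. sum w {x \<in> L. q x = i} \<le> 2 * \<kappa>" by blast
  obtain h where h: "bij_betw h H {..<card H}"
    using ex_bij_betw_finite_nat[OF fin(2)] atLeast0LessThan by metis
  have "real (card H) * \<eta> = (\<Sum>x\<in>H. \<eta>)" by simp
  also have "\<dots> \<le> sum w H" by (intro sum_mono) (auto simp: H_def)
  also have "\<dots> \<le> sum w U" using assms(1,2) by (intro sum_mono2) (auto simp: H_def)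
  finally have "real (card H) \<le> 1 / \<eta>" using assms(4,6) by (simp add: pos_le_divide_eq)
  then have cH: "card H \<le> nat \<lfloor>1 / \<eta>\<rfloor>" by linarith
  define p where "p x = (if x \<in> H then nat \<lfloor>1 / \<kappa>\<rfloor> + 1 + h x else q x)" for x
  have pH: "nat \<lfloor>1 / \<kappa>\<rfloor> < p x" "p x < nat \<lfloor>1 / \<kappa>\<rfloor> + 1 + nat \<lfloor>1 / \<eta>\<rfloor>" if "x \<in> H" for x
  proof -
    have "h x < card H" using h that by (auto dest: bij_betwE)
    then show "nat \<lfloor>1 / \<kappa>\<rfloor> < p x" "p x < nat \<lfloor>1 / \<kappa>\<rfloor> + 1 + nat \<lfloor>1 / \<eta>\<rfloor>"
      using that cH by (auto simp: p_def)
  qed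
  have pL: "p x = q x" "p x \<le> nat \<lfloor>1 / \<kappa>\<rfloor>" if "x \<in> L" for x
    using that q(1) by (auto simp: p_def H_def L_def)
  have LH: "x \<in> L \<or> x \<in> H" if "x \<in> U" for x using that by (auto simp: L_def H_def)
  have "p ` U \<subseteq> {..<nat \<lfloor>1 / \<kappa>\<rfloor> + 1 + nat \<lfloor>1 / \<eta>\<rfloor>}"
  proof (rule image_subsetI)
    fix x assume "x \<in> U"
    then show "p x \<in> {..<nat \<lfloor>1 / \<kappa>\<rfloor> + 1 + nat \<lfloor>1 / \<eta>\<rfloor>}"
      using LH[of x] pH(2)[of x] pL(2)[of x] by auto
  qed
  moreover have "x = y" if "x \<in> U" "y \<in> U" "p x = p y" "\<eta> < w x" for x y
  proof -
    have x: "x \<in> H" using that by (auto simp: H_def)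
    have "y \<in> H" using LH[OF that(2)] pL(2)[of y] pH(1)[OF x] that(3) by auto
    with x that(3) have "h x = h y" by (simp add: p_def)
    with x \<open>y \<in> H\<close> h show ?thesis by (auto simp: bij_betw_def inj_on_def)
  qed
  moreover have "sum w {x \<in> U. p x = i \<and> w x \<le> \<eta>} \<le> 2 * \<kappa>" for i
  proof -
    have "{x \<in> U. p x = i \<and> w x \<le> \<eta>} = {x \<in> L. q x = i}" using pL(1) by (auto simp: L_def)
    then show ?thesis using q(2) by simp
  qed
  ultimately show ?thesis by blast
qed

lemma sparse_weight_scale:
  fixes e :: "nat \<Rightarrow> real"
  assumes "\<And>j. e (Suc j) \<le> e j" "0 < J"
  shows "\<exists>j<J. measure_pmf.prob D {x. e (Suc j) < pmf D x \<and> pmf D x \<le> e j} \<le> 1 / real J"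
proof (rule ccontr)
  define S where "S j = {x. e (Suc j) < pmf D x \<and> pmf D x \<le> e j}" for j
  have anti: "e j \<le> e i" if "i \<le> j" for i j
    using that assms(1) by (rule lift_Suc_antimono_le[rotated])
  have "S i \<inter> S j = {}" if "i < j" for i j
    using anti[of "Suc i" j] that by (auto simp: S_def)
  then have "disjoint_family_on S {..<J}"
    unfolding disjoint_family_on_def by (metis Int_commute linorder_neqE_nat)
  then have "(\<Sum>j<J. measure_pmf.prob D (S j)) = measure_pmf.prob D (\<Union>j<J. S j)"
    by (intro measure_pmf.finite_measure_finite_Union[symmetric]) auto
  also have "\<dots> \<le> 1" by simp
  finally have le: "(\<Sum>j<J. measure_pmf.prob D (S j)) \<le> 1" .
  assume "\<not> ?thesis"
  then have "1 / real J < measure_pmf.prob D (S j)" if "j < J" for j using that by (auto simp: S_def not_le)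
  then have "(\<Sum>j<J. 1 / real J) < (\<Sum>j<J. measure_pmf.prob D (S j))"
    using assms(2) by (intro sum_strict_mono) auto
  then show False using le assms(2) by simp
qed

lemma finite_positive_lower_bound:
  fixes f :: "'a \<Rightarrow> real"
  assumes "finite S" "\<And>x. x \<in> S \<Longrightarrow> 0 < f x"
  shows "\<exists>c>0. \<forall>x\<in>S. c \<le> f x"
proof -
  have "0 < Min (insert 1 (f ` S))" using assms by (subst Min_gr_iff) auto
  moreover have "Min (insert 1 (f ` S)) \<le> f x" if "x \<in> S" for x using assms(1) that by (intro Min_le) auto
  ultimately show ?thesis by blast
qed

subsection \<open>Hereditary extendable properties are testable\<close>

text \<open>All constants up to \<open>B\<close> depend only on \<open>P\<close>,
  \<open>\<epsilon>\<close> and \<open>\<eta>\<close>; \<open>\<eta>'\<close>, the sample size and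
  \<open>c\<close> are then extrema over the finitely many \<open>m\<close> and \<open>k\<close> up
  to \<open>B\<close>, so they are fixed before \<open>G\<close> and \<open>D\<close>.\<close>

lemma sample_gap_sparse:
  assumes P: "graph_property P" "hereditary P" "extendable P"
    and \<epsilon>: "0 < \<epsilon>" "\<epsilon> < 1" and \<eta>: "0 < \<eta>"
  shows "\<exists>\<eta>'>0. \<eta>' \<le> \<eta> \<and> (\<exists>M>0. \<exists>c>0. \<forall>G D. weighted_graph G D \<longrightarrow> far \<epsilon> G D P \<longrightarrow>
    measure_pmf.prob D {x. \<eta>' < pmf D x \<and> pmf D x \<le> \<eta>} \<le> \<epsilon> / 10 \<longrightarrow> sample_ok P M G D \<le> 1 - c)"
proof -
  \<comment> \<open>Cleaning costs \<open>4 * \<kappa>\<close> and the discarded vertices have weight at most \<open>3 * \<kappa>\<close>, hence contribute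
    at most \<open>6 * \<kappa>\<close>: in total \<open>10 * \<kappa> < \<epsilon>\<close>.\<close>
  define \<kappa> where "\<kappa> = \<epsilon> / 20"
  have \<kappa>: "0 < \<kappa>" "\<kappa> < 1" using \<epsilon> by (auto simp: \<kappa>_def)
  obtain M where M0: "\<And>n. 0 < M n" and M: "\<And>n R F \<phi>. R \<in> PiE ({..<n} \<times> {..<n}) (\<lambda>_. {..<4}) \<Longrightarrow>
      simple_graph F \<Longrightarrow> F \<notin> P \<Longrightarrow> compatible R \<phi> F \<Longrightarrow> \<phi> ` verts F \<subseteq> {..<n} \<Longrightarrow>
     \<exists>r F' \<phi>'. 0 < r \<and> r \<le> M n \<and> verts F' = {..<r} \<and> simple_graph F' \<and> F' \<notin> P \<and>
        compatible R \<phi>' F' \<and> \<phi>' ` {..<r} \<subseteq> {..<n}"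
    using forbidden_size_bound[OF P(1)] by metis
  \<comment> \<open>Discarding up to \<open>n\<close> classes lighter than this loses weight at most
    \<open>\<kappa>\<close>.\<close>
  define \<tau> where "\<tau> n = \<kappa> / (real n + 1)" for n
  \<comment> \<open>The density from \<open>ramsey_density\<close> with
    \<open>a = b = M n\<close>.\<close>
  define \<rho> where "\<rho> n = (1 / 4 :: real) ^ (2 * M n * (2 * M n))" for n
  \<comment> \<open>Makes the regularity error exactly half of the main term in
    \<open>counting_lemma\<close>.\<close>
  define \<gamma> where "\<gamma> n = \<kappa> ^ (M n * M n) * \<rho> n ^ n / (2 * real (M n * M n))" for n
  define N where "N = nat \<lfloor>1 / \<kappa>\<rfloor> + 1 + nat \<lfloor>1 / \<eta>\<rfloor>"
  define B where "B = strong_bound \<tau> \<gamma> \<kappa> N"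
  define c1 where "c1 m k = \<tau> m / (4 * (real m + 1) * (real k + 1))" for m k
  have \<tau>: "0 < \<tau> n" for n using \<kappa> by (simp add: \<tau>_def)
  have \<rho>: "0 < \<rho> n" "\<rho> n \<le> 1" for n by (simp_all add: \<rho>_def power_le_one)
  have \<gamma>: "0 < \<gamma> n" for n using \<kappa> \<rho>[of n] M0[of n] by (simp add: \<gamma>_def)
  have c1: "0 < c1 m k" for m k using \<tau>[of m] unfolding c1_def by (intro divide_pos_pos) auto
  \<comment> \<open>Vertices of weight at most \<open>\<eta>0\<close> meet the lightness condition
    of \<open>ramsey_density\<close> inside every representative, whatever \<open>m\<close> and
    \<open>k\<close> turn out to be.\<close>
  obtain \<eta>0 where \<eta>0: "0 < \<eta>0" "\<And>m k. m \<le> B \<Longrightarrow> k \<le> B \<Longrightarrow> \<eta>0 \<le> c1 m k / (2 * 4 ^ (2 * M m))"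
    using finite_positive_lower_bound[of "{..B} \<times> {..B}" "\<lambda>(m, k). c1 m k / (2 * 4 ^ (2 * M m))"] c1
    by fastforce
  obtain c where c: "0 < c" "\<And>m k. m \<le> B \<Longrightarrow> k \<le> B \<Longrightarrow> c \<le> \<kappa> ^ (M m * M m) * \<rho> m ^ m / 2 * c1 m k ^ M m"
    using finite_positive_lower_bound[of "{..B} \<times> {..B}" "\<lambda>(m, k). \<kappa> ^ (M m * M m) * \<rho> m ^ m / 2 * c1 m k ^ M m"]
      c1 \<rho>(1) \<kappa>(1) by fastforce
  define Mx where "Mx = Max (M ` {..B})"
  have Mx: "M m \<le> Mx" if "m \<le> B" for m unfolding Mx_def using that by (intro Max_ge) auto
  \<comment> \<open>Below \<open>\<eta>0\<close> for Ramsey, below \<open>\<kappa>\<close> so that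
    light vertices qualify for \<open>initial_partition\<close>.\<close>
  define \<eta>' where "\<eta>' = min \<eta>0 (min \<eta> \<kappa>)"
  have \<eta>': "0 < \<eta>'" "\<eta>' \<le> \<eta>" "\<eta>' \<le> \<kappa>" "\<eta>' \<le> \<eta>0" using \<eta>0(1) \<eta> \<kappa>(1) by (auto simp: \<eta>'_def)
  have main: "sample_ok P Mx G D \<le> 1 - c"
    if wG: "weighted_graph G D" and far: "far \<epsilon> G D P"
      and sparse: "measure_pmf.prob D {x. \<eta>' < pmf D x \<and> pmf D x \<le> \<eta>} \<le> \<epsilon> / 10" for G D
  proof (rule ccontr)
    assume neg: "\<not> sample_ok P Mx G D \<le> 1 - c"

    \<comment> \<open>Partition and representatives for a supposed counterexample\<close>
    define w where "w = pmf D"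
    define V where "V = {x \<in> verts G. w x \<le> \<eta>' \<or> \<eta> < w x}"
    define A :: "nat \<Rightarrow> nat \<Rightarrow> real" where "A x y = of_bool ({x, y} \<in> edges G)" for x y
    have sG: "simple_graph G" and DG: "set_pmf D \<subseteq> verts G" using wG by (auto simp: weighted_graph_def)
    have finG: "finite (verts G)" using sG by (simp add: simple_graph_def)
    have w0: "0 \<le> w x" for x by (simp add: w_def)
    have VG: "V \<subseteq> verts G" "finite V" using finG by (auto simp: V_def)
    have wprob: "sum w S = measure_pmf.prob D S" if "finite S" for S
      using that by (simp add: w_def measure_measure_pmf_finite)
    have wr: "weighted_relation V w A"
      by unfold_locales (auto simp: VG w0 wprob A_def insert_commute)
    interpret weighted_relation V w A by (rule wr)
    have "\<exists>p. p ` V \<subseteq> {..<N} \<and> (\<forall>x\<in>V. \<forall>y\<in>V. p x = p y \<longrightarrow> \<eta> < w x \<longrightarrow> x = y) \<and>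
        (\<forall>i. sum w {x \<in> V. p x = i \<and> w x \<le> \<eta>} \<le> 2 * \<kappa>)"
      unfolding N_def
    proof (rule initial_partition)
      show "w x \<le> \<kappa> \<or> \<eta> < w x" if "x \<in> V" for x using that \<eta>'(3) by (auto simp: V_def)
    qed (use VG w0 w_total \<kappa>(1) \<eta> in auto)
    then obtain p where p: "p ` V \<subseteq> {..<N}" "\<And>x y. x \<in> V \<Longrightarrow> y \<in> V \<Longrightarrow> p x = p y \<Longrightarrow> \<eta> < w x \<Longrightarrow> x = y"
        "\<And>i. sum w {x \<in> V. p x = i \<and> w x \<le> \<eta>} \<le> 2 * \<kappa>" by blast
    from strong_regularity[of \<tau> \<gamma> \<kappa> p N, OF \<tau> \<gamma> \<kappa>(1) p(1)]
    obtain m k q b where mk: "m \<le> B" "k \<le> B" and q: "refines q p" "q ` V \<subseteq> {..<m}" and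
      RT: "let I = {i \<in> {..<m}. \<tau> m \<le> sum w (cls q i)} in
      (\<forall>i\<in>I. b i \<subseteq> cls q i \<and> \<tau> m / (4 * (real m + 1) * (real k + 1)) \<le> sum w (b i)) \<and>
      (\<forall>i\<in>I. \<forall>j\<in>I. i \<noteq> j \<longrightarrow> regular_pair (b i) (b j) (\<gamma> m)) \<and>
      (\<Sum>i\<in>I. \<Sum>j\<in>I - {i}. sum w (cls q i) * sum w (cls q j) *
         \<bar>average A (b i) (b j) - average A (cls q i) (cls q j)\<bar>) \<le> \<kappa>"
      unfolding B_def by blast
    define I where "I = {i \<in> {..<m}. \<tau> m \<le> sum w (cls q i)}"
    have b: "\<And>i. i \<in> I \<Longrightarrow> b i \<subseteq> cls q i" "\<And>i. i \<in> I \<Longrightarrow> c1 m k \<le> sum w (b i)"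
      and reg: "\<And>i j. i \<in> I \<Longrightarrow> j \<in> I \<Longrightarrow> i \<noteq> j \<Longrightarrow> regular_pair (b i) (b j) (\<gamma> m)"
      and dens: "(\<Sum>i\<in>I. \<Sum>j\<in>I - {i}. sum w (cls q i) * sum w (cls q j) *
         \<bar>average A (b i) (b j) - average A (cls q i) (cls q j)\<bar>) \<le> \<kappa>"
      using RT unfolding Let_def I_def[symmetric] c1_def by blast+
    have finI: "finite I" and Im: "i \<in> I \<Longrightarrow> i < m" for i by (auto simp: I_def)
    have bV: "b i \<subseteq> V" if "i \<in> I" for i using b(1)[OF that] cls_subset by blast
    define heavy where "heavy i \<longleftrightarrow> (\<exists>x\<in>cls q i. \<eta> < w x)" for i
    have heavy_single: "x = y" if hv: "heavy i" and xy: "x \<in> cls q i" "y \<in> cls q i" for i x y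
    proof -
      obtain z where z: "z \<in> V" "q z = i" "\<eta> < w z" using hv by (auto simp: heavy_def cls_def)
      have "z = x'" if "x' \<in> cls q i" for x'
      proof -
        have "x' \<in> V" "q z = q x'" using that z(2) by (auto simp: cls_def)
        then show ?thesis using p(2)[OF z(1) _ refinesD[OF q(1) z(1)] z(3)] by blast
      qed
      with xy show ?thesis by metis
    qed
    have light: "w x \<le> \<eta>'" if "\<not> heavy i" "x \<in> cls q i" for i x
    proof -
      have "x \<in> V" "\<not> \<eta> < w x" using that cls_subset by (auto simp: heavy_def)
      then show ?thesis by (simp add: V_def)
    qed
    have light_cls: "sum w (cls q i) \<le> 2 * \<kappa>" if "\<not> heavy i" for i
    proof (cases "cls q i = {}")
      case True
      then show ?thesis using \<kappa>(1) by simp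
    next
      case False
      then obtain z where z: "z \<in> V" "q z = i" by (auto simp: cls_def)
      have "cls q i \<subseteq> {x \<in> V. p x = p z \<and> w x \<le> \<eta>}"
      proof
        fix x assume x: "x \<in> cls q i"
        then have "x \<in> V" "q x = q z" using z by (auto simp: cls_def)
        then show "x \<in> {x \<in> V. p x = p z \<and> w x \<le> \<eta>}"
          using refinesD[OF q(1) _ z(1)] light[OF that x] \<eta>'(2) by auto
      qed
      then have "sum w (cls q i) \<le> sum w {x \<in> V. p x = p z \<and> w x \<le> \<eta>}"
        by (intro sum_w_mono) auto
      then show ?thesis using p(3)[of "p z"] by linarith
    qed

    \<comment> \<open>Homogeneous colours, reduced structure and cleaned graph\<close>
    define cliq where "cliq i \<longleftrightarrow> \<rho> m * sum w (b i) ^ M m \<le> hom_weight (\<lambda>x y. A x y = 1) (M m) (b i)" for i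
    have indep: "\<rho> m * sum w (b i) ^ M m \<le> hom_weight (\<lambda>x y. \<not> A x y = 1) (M m) (b i)"
      if i: "i \<in> I" "\<not> heavy i" "\<not> cliq i" for i
    proof -
      have "w x \<le> sum w (b i) / (2 * 4 ^ (2 * M m))" if "x \<in> b i" for x
      proof -
        have "w x \<le> \<eta>0" using light[OF i(2)] b(1)[OF i(1)] that \<eta>'(4) by force
        also have "\<dots> \<le> c1 m k / (2 * 4 ^ (2 * M m))" by (rule \<eta>0(2)[OF mk])
        also have "\<dots> \<le> sum w (b i) / (2 * 4 ^ (2 * M m))"
          using b(2)[OF i(1)] by (intro divide_right_mono) auto
        finally show ?thesis .
      qed
      from ramsey_density[OF bV[OF i(1)] this, of "M m" "M m" "\<lambda>x y. A x y = 1"] i(3)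
      show ?thesis by (simp add: cliq_def \<rho>_def)
    qed
    define R where "R = restrict (\<lambda>(i, j).
        if i = j then (if i \<notin> I then 3 else if heavy i then 2 else if cliq i then 1 else 0)
        else if average A (b i) (b j) < \<kappa> then 0 else if 1 - \<kappa> < average A (b i) (b j) then 1 else (2 :: nat))
      ({..<m} \<times> {..<m})"
    have R_in: "R \<in> PiE ({..<m} \<times> {..<m}) (\<lambda>_. {..<4})" unfolding R_def by auto
    have R_diag: "R (i, i) = (if i \<notin> I then 3 else if heavy i then 2 else if cliq i then 1 else 0)" if "i < m" for i
      using that by (simp add: R_def)
    have R_off: "R (i, j) = (if average A (b i) (b j) < \<kappa> then 0 else if 1 - \<kappa> < average A (b i) (b j) then 1 else 2)"
      if "i < m" "j < m" "i \<noteq> j" for i j using that by (simp add: R_def)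
    have R_sym: "R (i, j) = R (j, i)" if "i < m" "j < m" for i j
      using that average_A_sym[of "b i" "b j"] by (cases "i = j") (simp_all add: R_off)
    define U where "U = {x \<in> V. q x \<in> I}"
    \<comment> \<open>Pairs of classes with intermediate density keep their edges: there both
      adjacency and nonadjacency have density at least \<open>\<kappa>\<close> between the
      representatives.\<close>
    define adj where "adj x y \<longleftrightarrow> (if q x = q y then R (q x, q x) = 1
        else if R (q x, q y) = 2 then {x, y} \<in> edges G else R (q x, q y) = 1)" for x y
    have adj_sym: "adj x y \<longleftrightarrow> adj y x" if "x \<in> U" "y \<in> U" for x y
      using that R_sym[of "q x" "q y"] Im by (auto simp: adj_def U_def insert_commute)
    define G' where "G' = \<lparr>verts = U, edges = {e. \<exists>x\<in>U. \<exists>y\<in>U. e = {x, y} \<and> x \<noteq> y \<and> adj x y}\<rparr>"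
    have vG': "verts G' = U" by (simp add: G'_def)
    have eG': "{x, y} \<in> edges G' \<longleftrightarrow> x \<noteq> y \<and> adj x y" if "x \<in> U" "y \<in> U" for x y
      using that adj_sym[OF that] unfolding G'_def by (auto simp: doubleton_eq_iff)
    have UV: "U \<subseteq> V" "finite U" using VG(2) by (auto simp: U_def)
    define Z where "Z = verts G - U"
    have wZ: "sum w Z \<le> 3 * \<kappa>"
    proof -
      let ?Z1 = "{x \<in> verts G. \<eta>' < w x \<and> w x \<le> \<eta>}"
      have "Z = ?Z1 \<union> {x \<in> V. q x \<notin> I}" using VG(1) by (auto simp: Z_def U_def V_def)
      then have "sum w Z \<le> sum w ?Z1 + sum w {x \<in> V. q x \<notin> I}"
        using finG VG(2) sum.union_inter[of ?Z1 "{x \<in> V. q x \<notin> I}" w] sum_nonneg[of "?Z1 \<inter> {x \<in> V. q x \<notin> I}" w] w0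
        by auto
      moreover have "sum w ?Z1 \<le> 2 * \<kappa>"
      proof -
        have "sum w ?Z1 = measure_pmf.prob D ?Z1" using finG by (intro wprob) auto
        also have "\<dots> \<le> measure_pmf.prob D {x. \<eta>' < pmf D x \<and> pmf D x \<le> \<eta>}"
          by (intro measure_pmf.finite_measure_mono) (auto simp: w_def)
        finally show ?thesis using sparse by (simp add: \<kappa>_def)
      qed
      moreover have "sum w {x \<in> V. q x \<notin> I} \<le> \<kappa>"
      proof -
        have "sum w {x \<in> V. q x \<notin> I} \<le> real m * \<tau> m"
          unfolding I_def using \<tau>[of m] by (intro small_parts q) auto
        also have "\<dots> \<le> \<kappa>" using \<kappa>(1) by (simp add: \<tau>_def field_simps)
        finally show ?thesis .
      qed
      ultimately show ?thesis by linarith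
    qed
    have "sum w (verts G) = 1" unfolding w_def using finG DG by (rule sum_pmf_eq_1)
    moreover have Vsplit: "verts G = U \<union> Z" "U \<inter> Z = {}" "finite Z"
      using UV(1) VG(1) finG by (auto simp: Z_def)
    moreover have "sum w (U \<union> Z) = sum w U + sum w Z"
      by (rule sum.union_disjoint[OF UV(2) Vsplit(3,2)])
    ultimately have UZ: "sum w U + sum w Z = 1" by simp
    have "U \<noteq> {}"
    proof
      assume "U = {}"
      then have "sum w Z = 1" using UZ by simp
      then show False using wZ \<epsilon> by (simp add: \<kappa>_def)
    qed
    then have sG': "simple_graph G'" using UV(2) by (auto simp: simple_graph_def G'_def)

    \<comment> \<open>The cleaned graph lies in \<open>P\<close>\<close>
    have G'P: "G' \<in> P"
    proof (rule ccontr)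
      assume G'P: "G' \<notin> P"
      have comp: "compatible R q G'"
        unfolding compatible_def vG'
      proof (intro ballI conjI impI)
        fix u v assume uv: "u \<in> U" "v \<in> U"
        then have qI: "q u \<in> I" "q v \<in> I" "u \<in> cls q (q u)" "v \<in> cls q (q v)" by (auto simp: U_def cls_def)
        then show "R (q u, q u) \<noteq> 3" using Im by (simp add: R_diag)
        assume ne: "u \<noteq> v"
        show "if q u = q v then R (q u, q u) < 2 \<and> ({u, v} \<in> edges G' \<longleftrightarrow> R (q u, q u) = 1)
          else (R (q u, q v) = 0 \<longrightarrow> {u, v} \<notin> edges G') \<and> (R (q u, q v) = 1 \<longrightarrow> {u, v} \<in> edges G')"
        proof (cases "q u = q v")
          case True
          have "\<not> heavy (q u)" using heavy_single[of "q u" u v] qI ne True by auto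
          then have "R (q u, q u) < 2" using R_diag[OF Im[OF qI(1)]] qI(1) by simp
          moreover have "{u, v} \<in> edges G' \<longleftrightarrow> R (q u, q u) = 1"
            unfolding eG'[OF uv] adj_def if_P[OF True] using ne by blast
          ultimately show ?thesis unfolding if_P[OF True] by blast
        next
          case False
          have "{u, v} \<in> edges G' \<longleftrightarrow> (if R (q u, q v) = 2 then {u, v} \<in> edges G else R (q u, q v) = 1)"
            unfolding eG'[OF uv] adj_def if_not_P[OF False] using ne by blast
          then show ?thesis unfolding if_not_P[OF False] by simp
        qed
      qed
      have "q ` verts G' \<subseteq> {..<m}" using q(2) UV(1) by (auto simp: vG')
      from M[OF R_in sG' G'P comp this]
      obtain r F \<phi> where r: "0 < r" "r \<le> M m" and F: "verts F = {..<r}" "simple_graph F" "F \<notin> P"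
        "compatible R \<phi> F" "\<phi> ` {..<r} \<subseteq> {..<m}"
        by (elim exE conjE) (rule that)
      \<comment> \<open>The counting lemma wants disjoint sets for all indices, hence the empty set
        outside \<open>I\<close>.\<close>
      define b' where "b' i = (if i \<in> I then b i else {})" for i
      \<comment> \<open>A heavy class receives at most one vertex of \<open>F\<close>, so no
        relation has to be imposed there.\<close>
      define Rel where "Rel i = (if heavy i then (\<lambda>_ _. True) else if cliq i then (\<lambda>x y. A x y = 1) else (\<lambda>x y. \<not> A x y = 1))" for i
      have \<phi>I: "\<phi> u \<in> I" if "u < r" for u
      proof (rule ccontr)
        assume "\<phi> u \<notin> I"
        moreover have "\<phi> u < m" using F(5) that by auto
        ultimately have "R (\<phi> u, \<phi> u) = 3" by (simp add: R_diag)
        moreover have "u \<in> verts F" using F(1) that by simp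
        ultimately show False using F(4) unfolding compatible_def by blast
      qed
      have Fs: "R (\<phi> u, \<phi> u) < 2 \<and> ({u, v} \<in> edges F \<longleftrightarrow> R (\<phi> u, \<phi> u) = 1)"
        if "u < r" "v < r" "u \<noteq> v" "\<phi> u = \<phi> v" for u v
      proof -
        have "u \<in> verts F" "v \<in> verts F" using that F(1) by auto
        then show ?thesis using F(4) that(3,4) unfolding compatible_def by metis
      qed
      have Fc: "(R (\<phi> u, \<phi> v) = 0 \<longrightarrow> {u, v} \<notin> edges F) \<and> (R (\<phi> u, \<phi> v) = 1 \<longrightarrow> {u, v} \<in> edges F)"
        if "u < r" "v < r" "\<phi> u \<noteq> \<phi> v" for u v
      proof -
        have "u \<in> verts F" "v \<in> verts F" "u \<noteq> v" using that F(1) by auto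
        then show ?thesis using F(4) that(3) unfolding compatible_def by metis
      qed
      have "(\<kappa> ^ (M m * M m) * \<rho> m ^ m - real (M m * M m) * \<gamma> m) * (\<Prod>v<r. sum w (b' (\<phi> v))) \<le>
        tuple_sum {..<r} (\<lambda>v. b' (\<phi> v)) (\<lambda>z. of_bool (inj_on z {..<r} \<and>
          (\<forall>u\<in>{..<r}. \<forall>v\<in>{..<r}. u \<noteq> v \<longrightarrow> (A (z u) (z v) = 1 \<longleftrightarrow> {u, v} \<in> edges F))))"
      proof (rule counting_lemma[where R = Rel])
        show "card (\<phi> ` {..<r}) \<le> m" using card_mono[OF _ F(5)] by simp
        show "b' i \<subseteq> V" for i using bV by (simp add: b'_def)
        show "b' i \<inter> b' j = {}" if "i \<noteq> j" for i j using that b(1)[of i] b(1)[of j] by (auto simp: b'_def cls_def)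
        show "Rel i x y \<longleftrightarrow> Rel i y x" for i x y using A_sym[of x y] by (simp add: Rel_def)
        show "{u, v} \<in> edges F \<longleftrightarrow> {v, u} \<in> edges F" for u v by (simp add: insert_commute)
        fix i assume "i \<in> \<phi> ` {..<r}"
        then have i: "i \<in> I" using \<phi>I by auto
        define n where "n = card {v \<in> {..<r}. \<phi> v = i}"
        have "n \<le> r" unfolding n_def using card_mono[of "{..<r}" "{v \<in> {..<r}. \<phi> v = i}"] by auto
        then have nM: "n \<le> M m" using r(2) by simp
        have pos: "0 < sum w (b i)" using b(2)[OF i] c1[of m k] by linarith
        have "\<rho> m * sum w (b i) ^ n \<le> hom_weight (Rel i) n (b i)"
        proof (cases "heavy i")
          case True
          have "u = v" if "u < r" "v < r" "\<phi> u = i" "\<phi> v = i" for u v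
          proof (rule ccontr)
            assume "u \<noteq> v"
            then have "R (i, i) < 2" using Fs[of u v] that by auto
            then show False using True i Im by (simp add: R_diag)
          qed
          then have "n \<le> Suc 0" unfolding n_def by (subst card_le_Suc0_iff_eq) auto
          moreover have "\<rho> m * sum w (b i) \<le> 1 * sum w (b i)" using \<rho> pos by (intro mult_right_mono) auto
          ultimately show ?thesis using \<rho>[of m] by (cases n) auto
        next
          case False
          then have "\<rho> m * sum w (b i) ^ M m \<le> hom_weight (Rel i) (M m) (b i)"
            using indep[OF i] by (auto simp: Rel_def cliq_def)
          then show ?thesis using hom_weight_lower[OF bV[OF i] pos _ nM] by blast
        qed
        then show "\<rho> m * sum w (b' i) ^ card {v \<in> {..<r}. \<phi> v = i} \<le> hom_weight (Rel i) (card {v \<in> {..<r}. \<phi> v = i}) (b' i)"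
          using i by (simp only: b'_def n_def if_True)
      next
        fix u v x y assume uv: "u \<in> {..<r}" "v \<in> {..<r}" "u \<noteq> v" "\<phi> u = \<phi> v" and rel: "Rel (\<phi> u) x y"
        then have "R (\<phi> u, \<phi> u) < 2" "{u, v} \<in> edges F \<longleftrightarrow> R (\<phi> u, \<phi> u) = 1" using Fs[of u v] by auto
        moreover have "\<phi> u \<in> I" "\<phi> u < m" using \<phi>I[of u] uv Im by auto
        ultimately have "\<not> heavy (\<phi> u)" "{u, v} \<in> edges F \<longleftrightarrow> cliq (\<phi> u)" by (auto simp: R_diag split: if_splits)
        then show "A x y = 1 \<longleftrightarrow> {u, v} \<in> edges F" using rel by (auto simp: Rel_def split: if_splits)
      next
        fix u v assume uv: "u \<in> {..<r}" "v \<in> {..<r}" "\<phi> u \<noteq> \<phi> v"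
        then have I: "\<phi> u \<in> I" "\<phi> v \<in> I" using \<phi>I by auto
        \<comment> \<open>For a nonadjacent pair with \<open>R\<close> equal to \<open>0\<close>,
          the density is known to be below \<open>\<kappa>\<close>, but \<open>1 - \<kappa>\<close>
          is asked for.\<close>
        have "\<kappa> \<le> 1 - \<kappa>" using \<epsilon> by (simp add: \<kappa>_def)
        then show "regular_pair (b' (\<phi> u)) (b' (\<phi> v)) (\<gamma> m) \<and>
          (if {u, v} \<in> edges F then \<kappa> \<le> average A (b' (\<phi> u)) (b' (\<phi> v)) else average A (b' (\<phi> u)) (b' (\<phi> v)) \<le> 1 - \<kappa>)"
          using reg[OF I uv(3)] Fc[of u v] uv I Im[OF I(1)] Im[OF I(2)]
          by (auto simp: b'_def R_off split: if_splits)
      qed (use r \<kappa> \<rho> \<gamma> in \<open>auto intro: less_imp_le\<close>)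
      also have "\<dots> \<le> measure_pmf.prob (replicate_pmf r D) {xs. induced_subgraph G (set xs) \<notin> P}"
        unfolding w_def
      proof (rule tuple_sum_le_sample_prob[OF wr[unfolded w_def]])
        show "b' (\<phi> v) \<subseteq> V" for v using bV by (simp add: b'_def)
        fix z assume zB: "z \<in> (\<Pi>\<^sub>E v\<in>{..<r}. b' (\<phi> v))" and
          z: "inj_on z {..<r} \<and> (\<forall>u\<in>{..<r}. \<forall>v\<in>{..<r}. u \<noteq> v \<longrightarrow> (A (z u) (z v) = 1 \<longleftrightarrow> {u, v} \<in> edges F))"
        define K where "K = induced_subgraph G (z ` {..<r})"
        have "z v \<in> verts G" if "v < r" for v
          using zB that bV VG(1) by (auto simp: PiE_iff b'_def split: if_splits)
        then have sK: "simple_graph K" unfolding K_def using sG r(1) by (intro simple_induced_subgraph) auto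
        have "isomorphic F K"
          unfolding isomorphic_def
        proof (intro exI[of _ z] conjI ballI)
          show "bij_betw z (verts F) (verts K)" using z F(1) by (simp add: bij_betw_def K_def induced_subgraph_def)
          fix u v assume "u \<in> verts F" "v \<in> verts F"
          then have uv: "u < r" "v < r" using F(1) by auto
          show "{u, v} \<in> edges F \<longleftrightarrow> {z u, z v} \<in> edges K"
          proof (cases "u = v")
            case True
            then show ?thesis using simple_graph_no_loop[OF F(2), of u] simple_graph_no_loop[OF sK, of "z u"] by simp
          next
            case False
            then have "{u, v} \<in> edges F \<longleftrightarrow> {z u, z v} \<in> edges G" using z uv by (auto simp: A_def)
            then show ?thesis using uv by (simp add: K_def induced_subgraph_def)
          qed
        qed
        then have "K \<notin> P" using graph_property_iso_iff[OF P(1) F(2) sK] F(3) by blast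
        then show "map z [0..<r] \<in> {xs. induced_subgraph G (set xs) \<notin> P}"
          by (simp add: K_def atLeast0LessThan)
      qed
      also have "\<dots> = 1 - sample_ok P r G D"
      proof -
        have "{xs. induced_subgraph G (set xs) \<notin> P} = UNIV - {xs. induced_subgraph G (set xs) \<in> P}" by auto
        then show ?thesis
          unfolding sample_ok_def
          using measure_pmf.prob_compl[of "{xs. induced_subgraph G (set xs) \<in> P}" "replicate_pmf r D"] by simp
      qed
      finally have cnt: "(\<kappa> ^ (M m * M m) * \<rho> m ^ m - real (M m * M m) * \<gamma> m) * (\<Prod>v<r. sum w (b' (\<phi> v)))
          \<le> 1 - sample_ok P r G D" .
      have "c1 m k \<le> 1"
      proof -
        have "b (\<phi> 0) \<subseteq> V" "c1 m k \<le> sum w (b (\<phi> 0))" using bV b(2) \<phi>I r(1) by auto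
        then show ?thesis using sum_w_le_1[of "b (\<phi> 0)"] by linarith
      qed
      then have "c1 m k ^ M m \<le> c1 m k ^ r" using c1[of m k] r(2) by (intro power_decreasing) auto
      also have "\<dots> = (\<Prod>v<r. c1 m k)" by simp
      also have "\<dots> \<le> (\<Prod>v<r. sum w (b' (\<phi> v)))"
        using c1[of m k] b(2) \<phi>I by (intro prod_mono) (auto simp: b'_def intro: less_imp_le)
      finally have pr: "c1 m k ^ M m \<le> (\<Prod>v<r. sum w (b' (\<phi> v)))" .
      have half: "\<kappa> ^ (M m * M m) * \<rho> m ^ m - real (M m * M m) * \<gamma> m = \<kappa> ^ (M m * M m) * \<rho> m ^ m / 2"
        using M0[of m] by (simp add: \<gamma>_def)
      have "c \<le> \<kappa> ^ (M m * M m) * \<rho> m ^ m / 2 * c1 m k ^ M m" by (rule c(2)[OF mk])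
      also have "\<dots> \<le> \<kappa> ^ (M m * M m) * \<rho> m ^ m / 2 * (\<Prod>v<r. sum w (b' (\<phi> v)))"
        using pr \<kappa>(1) \<rho>(1)[of m] by (intro mult_left_mono) auto
      also have "\<dots> \<le> 1 - sample_ok P r G D" using cnt unfolding half .
      finally have "sample_ok P r G D \<le> 1 - c" by simp
      moreover have "sample_ok P Mx G D \<le> sample_ok P r G D"
        using Mx[OF mk(1)] r by (intro sample_ok_antimono P) auto
      ultimately show False using neg by simp
    qed

    \<comment> \<open>Restoring the discarded vertices and bounding the distance\<close>
    obtain H where H: "H \<in> P" "verts H = verts G" "\<And>x y. x \<in> U \<Longrightarrow> y \<in> U \<Longrightarrow> {x, y} \<in> edges H \<longleftrightarrow> {x, y} \<in> edges G'"
    proof -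
      have "verts G' \<union> verts G = verts G" using UV(1) VG(1) by (auto simp: vG')
      then show ?thesis using extendable_superset[OF P(1,3) finG G'P] that unfolding vG' by metis
    qed
    have sH: "simple_graph H" using P(1) H(1) by (auto simp: graph_property_def)
    define f where "f x y = (of_bool (({x, y} \<in> edges G) \<noteq> ({x, y} \<in> edges H)) :: real)" for x y
    have f01: "0 \<le> f x y" "f x y \<le> 1" for x y by (simp_all add: f_def)
    have "wsum f U U \<le> 2 * \<kappa> + \<kappa> + \<kappa>"
    proof (rule cleaning_cost[OF finI U_def _ _ f01 _ _ dens])
      fix i assume i: "i \<in> I"
      show "sum w (cls q i) \<le> 2 * \<kappa> \<or> (\<forall>x\<in>cls q i. \<forall>y\<in>cls q i. f x y = 0)"
      proof (cases "heavy i")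
        case True
        have "f x x = 0" for x using simple_graph_no_loop[OF sG, of x] simple_graph_no_loop[OF sH, of x] by (simp add: f_def)
        then show ?thesis using heavy_single[OF True] by metis
      qed (use light_cls in blast)
    next
      fix i j assume ij: "i \<in> I" "j \<in> I" "i \<noteq> j"
      have f: "f x y = of_bool (({x, y} \<in> edges G) \<noteq> (if R (i, j) = 2 then {x, y} \<in> edges G else R (i, j) = 1))"
        if "x \<in> cls q i" "y \<in> cls q j" for x y
      proof -
        have xy: "x \<in> U" "y \<in> U" "q x = i" "q y = j" "x \<noteq> y" using that ij by (auto simp: U_def cls_def)
        then have "{x, y} \<in> edges H \<longleftrightarrow> (if R (i, j) = 2 then {x, y} \<in> edges G else R (i, j) = 1)"
          using ij(3) by (simp add: H(3) eG' adj_def)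
        then show ?thesis by (simp only: f_def)
      qed
      show "(\<forall>x\<in>cls q i. \<forall>y\<in>cls q j. f x y = 0) \<or>
        (\<forall>x\<in>cls q i. \<forall>y\<in>cls q j. f x y = A x y) \<and> average A (b i) (b j) \<le> \<kappa> \<or>
        (\<forall>x\<in>cls q i. \<forall>y\<in>cls q j. f x y = 1 - A x y) \<and> 1 - \<kappa> \<le> average A (b i) (b j)"
      proof -
        consider "average A (b i) (b j) < \<kappa>" "R (i, j) = 0" | "1 - \<kappa> < average A (b i) (b j)" "R (i, j) = 1"
          | "R (i, j) = 2" using R_off[OF Im[OF ij(1)] Im[OF ij(2)] ij(3)] by (auto split: if_splits)
        then show ?thesis
        proof cases
          case 1
          then have "\<forall>x\<in>cls q i. \<forall>y\<in>cls q j. f x y = A x y" by (simp add: f A_def)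
          with 1 show ?thesis by simp
        next
          case 2
          then have "\<forall>x\<in>cls q i. \<forall>y\<in>cls q j. f x y = 1 - A x y" by (simp add: f A_def)
          with 2 show ?thesis by simp
        next
          case 3
          then have "\<forall>x\<in>cls q i. \<forall>y\<in>cls q j. f x y = 0" by (simp add: f)
          then show ?thesis by blast
        qed
      qed
    qed (use \<kappa>(1) in auto)
    then have cost: "wsum f U U \<le> 4 * \<kappa>" by simp
    have bound: "wsum f S T \<le> sum w S * sum w T" for S T
    proof -
      have "wsum f S T \<le> wsum (\<lambda>_ _. 1) S T"
        unfolding wsum_def using f01 w0 by (intro sum_mono mult_left_mono) auto
      then show ?thesis by (simp add: wsum_const)
    qed
    have le1: "sum w S \<le> 1" if "finite S" for S using wprob[OF that] by simp
    have "graph_distance D G H \<le> wsum f (verts G) (verts G)"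
      unfolding wsum_def unfolding w_def f_def by (rule graph_distance_le[OF sG sH H(2)])
    also have "\<dots> = wsum f U U + wsum f U Z + wsum f Z (verts G)"
      unfolding wsum_def Vsplit(1) using UV(2) Vsplit(2,3) by (simp add: sum.union_disjoint sum.distrib)
    also have "\<dots> \<le> 4 * \<kappa> + sum w U * sum w Z + sum w Z * sum w (verts G)"
      using cost bound[of U Z] bound[of Z "verts G"] by linarith
    also have "\<dots> \<le> 4 * \<kappa> + 1 * sum w Z + sum w Z * 1"
      using le1[OF UV(2)] le1[OF finG] sum_nonneg[of Z w] w0
      by (intro add_mono mult_right_mono mult_left_mono) auto
    also have "\<dots> \<le> 10 * \<kappa>" using wZ by simp
    also have "\<dots> < \<epsilon>" using \<epsilon> by (simp add: \<kappa>_def)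
    finally show False using far H(1,2) unfolding far_def by force
  qed
  have "0 < Mx" using M0[of 0] Mx[of 0] by simp
  with main \<eta>'(1,2) c(1) show ?thesis by blast
qed

text \<open>Iterate the passage from \<open>\<eta>\<close> to \<open>\<eta>'\<close>, starting at
  \<open>1\<close>. Among \<open>10 / \<epsilon>\<close> consecutive disjoint bands, rounded up, one
  has probability at most \<open>\<epsilon> / 10\<close>. Which one depends on \<open>D\<close>, so
  the largest sample size and the least gap over all bands are taken.\<close>

lemma hereditary_extendable_sample_gap:
  assumes P: "graph_property P" "hereditary P" "extendable P" and \<epsilon>: "\<epsilon> \<in> {0<..<1}"
  shows "\<exists>m>0. \<exists>c>0. \<forall>G D. weighted_graph G D \<longrightarrow> far \<epsilon> G D P \<longrightarrow> sample_ok P m G D \<le> 1 - c"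
proof -
  define Q where "Q \<eta> \<eta>' M c \<longleftrightarrow> 0 < \<eta>' \<and> \<eta>' \<le> \<eta> \<and> 0 < M \<and> 0 < c \<and>
    (\<forall>G D. weighted_graph G D \<longrightarrow> far \<epsilon> G D P \<longrightarrow>
      measure_pmf.prob D {x. \<eta>' < pmf D x \<and> pmf D x \<le> \<eta>} \<le> \<epsilon> / 10 \<longrightarrow> sample_ok P M G D \<le> 1 - c)"
    for \<eta> \<eta>' c :: real and M :: nat
  have "\<exists>\<eta>' M c. Q \<eta> \<eta>' M c" if "0 < \<eta>" for \<eta>
    using sample_gap_sparse[OF P, of \<epsilon> \<eta>] \<epsilon> that unfolding Q_def greaterThanLessThan_iff by blast
  then obtain E M c where EMc: "\<And>\<eta>. 0 < \<eta> \<Longrightarrow> Q \<eta> (E \<eta>) (M \<eta>) (c \<eta>)"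
    by metis
  have E: "\<And>\<eta>. 0 < \<eta> \<Longrightarrow> 0 < E \<eta> \<and> E \<eta> \<le> \<eta> \<and> 0 < M \<eta> \<and> 0 < c \<eta>"
    and gap: "\<And>\<eta> G D. 0 < \<eta> \<Longrightarrow> weighted_graph G D \<Longrightarrow> far \<epsilon> G D P \<Longrightarrow>
      measure_pmf.prob D {x. E \<eta> < pmf D x \<and> pmf D x \<le> \<eta>} \<le> \<epsilon> / 10 \<Longrightarrow> sample_ok P (M \<eta>) G D \<le> 1 - c \<eta>"
    using EMc unfolding Q_def by blast+
  define e where "e j = (E ^^ j) 1" for j
  have e: "0 < e j" "e (Suc j) = E (e j)" for j
  proof -
    show "0 < e j" by (induction j) (use E in \<open>auto simp: e_def\<close>)
  qed (simp add: e_def)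
  define J where "J = nat \<lceil>10 / \<epsilon>\<rceil>"
  have J: "10 / \<epsilon> \<le> real J" unfolding J_def by linarith
  have "0 < 10 / \<epsilon>" using \<epsilon> by simp
  then have J0: "0 < J" using J by (cases J) auto
  have J\<epsilon>: "1 / real J \<le> \<epsilon> / 10" using J J0 \<epsilon> by (simp add: field_simps)
  define m where "m = Max ((\<lambda>j. M (e j)) ` {..<J})"
  have m: "M (e j) \<le> m" if "j < J" for j unfolding m_def using that by (intro Max_ge) auto
  obtain c' where c': "0 < c'" "\<And>j. j < J \<Longrightarrow> c' \<le> c (e j)"
    using finite_positive_lower_bound[of "{..<J}" "\<lambda>j. c (e j)"] E e(1) by auto
  have "sample_ok P m G D \<le> 1 - c'" if "weighted_graph G D" "far \<epsilon> G D P" for G D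
  proof -
    obtain j where j: "j < J" "measure_pmf.prob D {x. e (Suc j) < pmf D x \<and> pmf D x \<le> e j} \<le> 1 / real J"
      using sparse_weight_scale[of e J D] E e J0 by auto
    then have "measure_pmf.prob D {x. E (e j) < pmf D x \<and> pmf D x \<le> e j} \<le> \<epsilon> / 10"
      using J\<epsilon> by (simp add: e(2))
    then have "sample_ok P (M (e j)) G D \<le> 1 - c (e j)" by (rule gap[OF e(1) that])
    moreover have "sample_ok P m G D \<le> sample_ok P (M (e j)) G D"
      using m[OF j(1)] E e(1) by (intro sample_ok_antimono P) auto
    ultimately show ?thesis using c'(2)[OF j(1)] by linarith
  qed
  moreover have "0 < m" using m[OF J0] E[OF e(1), of 0] by linarith
  ultimately show ?thesis using c'(1) by blast
qed

theorem theorem1: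
  fixes P :: "graph set"
  assumes "graph_property P"
  shows "vdf_testable P \<longleftrightarrow> hereditary P \<and> extendable P"
  using testable_imp_hereditary[OF assms] testable_imp_extendable[OF assms]
    testable_if_sample_gap[OF assms] hereditary_extendable_sample_gap[OF assms] by blast

end
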